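(* Let $\sigma^2\in\mathbb{R}_+$ and let $\alpha$ be a random variable with values in $[0,1)$ having a probability density function of the form $\psi(x)(1-x)^{\beta}$, $x\in[0,1)$, where $\psi$ is an integrable function on $[0,1)$ having a limit $\lim_{x\uparrow 1}\psi(x)=\psi_1\in(0,\infty)$. Let $(\alpha^{(j)},(X^{(j)}_k)_{k\in\mathbb{Z}_+})$, $j\in\mathbb{N}$, be independent copies of $(\alpha,(X_k)_{k\in\mathbb{Z}_+})$, where $(X_k)_{k\in\mathbb{Z}_+}$ is the randomized AR(1) process with random coefficient $\alpha$ and Gaussian innovations with mean zero and variance $\sigma^2$, and for $N,n\in\mathbb{N}$ put $$\widetilde S^{(N,n)}_t:=\sum_{j=1}^N\sum_{k=1}^{\lfloor nt\rfloor}X^{(j)}_k,\qquad t\in\mathbb{R}_+ .$$ If $\beta=1$, then $$\mathcal{D}_{\mathrm f}\text{-}\lim_{N\to\infty}\ \mathcal{D}_{\mathrm f}\text{-}\lim_{n\to\infty}\ \frac{1}{\sqrt{nN\log N}}\,\widetilde S^{(N,n)}=\sqrt{\frac{\sigma^2\psi_1}{2}}\,B,$$ where $B=(B_t)_{t\in\mathbb{R}_+}$ is a standard Wiener process.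
   Context: $\mathbb{Z}_+$, $\mathbb{N}$, $\mathbb{R}_+$ denote the non-negative integers, the positive integers and the non-negative real numbers. Randomized AR(1) process with Gaussian innovations: $$X_k=\alpha X_{k-1}+\varepsilon_k,\qquad k\in\mathbb{N},$$ where $(\varepsilon_k)_{k\in\mathbb{N}}$ are i.i.d. Gaussian random variables with mean $0$ and variance $\sigma^2$, independent of $\alpha$, and, conditionally on $\alpha$, $(X_k)_{k\in\mathbb{Z}_+}$ is a strictly stationary AR(1) process with coefficient $\alpha$ (so that, conditionally on $\alpha$, $X_0$ is independent of $(\varepsilon_k)_{k\in\mathbb{N}}$ and has the unique stationary distribution, namely the normal distribution with mean $0$ and variance $\sigma^2/(1-\alpha^2)$). The innovations are idiosyncratic: the innovation sequences belonging to different copies $j$ are independent. $\mathcal{D}_{\mathrm f}\text{-}\lim$ denotes weak convergence of the finite-dimensional distributions of stochastic processes indexed by $t\in\mathbb{R}_+$. In the iterated limit, one first takes $n\to\infty$ for fixed $N$ (inner limit), and then lets $N\to\infty$ in the resulting limit process (outer limit). *)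

theory Defs
  imports "HOL-Probability.Probability"
begin

(* The normal law with mean m and variance v \<ge> 0; for v = 0 it is the point mass at m
   (the library's normal_density is identically 0 when the standard deviation is 0). *)
definition gaussian :: "real \<Rightarrow> real \<Rightarrow> real measure" where
  "gaussian m v =
     (if v = 0 then return borel m else density lborel (normal_density m (sqrt v)))"

(* Sequences indexed by the positive integers are functions on nat of which only the values on
   {1..} matter. *)
definition gaussian_innovations :: "'a measure \<Rightarrow> real \<Rightarrow> (nat \<Rightarrow> 'a \<Rightarrow> real) \<Rightarrow> bool" where
  "gaussian_innovations P v \<epsilon> \<longleftrightarrow>
     prob_space.indep_vars P (\<lambda>_. borel) \<epsilon> {1..} \<and>
     (\<forall>k\<ge>1. distr P borel (\<epsilon> k) = gaussian 0 v)"

definition strictly_stationary :: "'a measure \<Rightarrow> (nat \<Rightarrow> 'a \<Rightarrow> real) \<Rightarrow> bool" where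
  "strictly_stationary P X \<longleftrightarrow>
     (\<forall>h. distr P (\<Pi>\<^sub>M k\<in>UNIV. borel) (\<lambda>\<omega> k. X (k + h) \<omega>)
        = distr P (\<Pi>\<^sub>M k\<in>UNIV. borel) (\<lambda>\<omega> k. X k \<omega>))"

(* The library's indep_var requires both random elements to have the same type of values. *)
definition indep_elements ::
    "'a measure \<Rightarrow> 'b measure \<Rightarrow> ('a \<Rightarrow> 'b) \<Rightarrow> 'c measure \<Rightarrow> ('a \<Rightarrow> 'c) \<Rightarrow> bool" where
  "indep_elements P S U T V \<longleftrightarrow>
     U \<in> P \<rightarrow>\<^sub>M S \<and> V \<in> P \<rightarrow>\<^sub>M T \<and>
     prob_space.indep_set P {U -` A \<inter> space P |A. A \<in> sets S} {V -` C \<inter> space P |C. C \<in> sets T}"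

definition stationary_AR1 ::
    "'a measure \<Rightarrow> real \<Rightarrow> real \<Rightarrow> (nat \<Rightarrow> 'a \<Rightarrow> real) \<Rightarrow> (nat \<Rightarrow> 'a \<Rightarrow> real) \<Rightarrow> bool" where
  "stationary_AR1 P a v X \<epsilon> \<longleftrightarrow>
     prob_space P \<and> (\<forall>k. X k \<in> borel_measurable P) \<and>
     gaussian_innovations P v \<epsilon> \<and>
     indep_elements P borel (X 0) (\<Pi>\<^sub>M k\<in>{1..}. borel) (\<lambda>\<omega>. \<lambda>k\<in>{1..}. \<epsilon> k \<omega>) \<and>
     (\<forall>k\<ge>1. AE \<omega> in P. X k \<omega> = a * X (k - 1) \<omega> + \<epsilon> k \<omega>) \<and>
     strictly_stationary P X"

(* \<kappa> is a regular conditional distribution of the N-valued random element Z given \<alpha>. *)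
definition regular_cond_distr ::
    "'a measure \<Rightarrow> ('a \<Rightarrow> real) \<Rightarrow> 'b measure \<Rightarrow> ('a \<Rightarrow> 'b) \<Rightarrow> (real \<Rightarrow> 'b measure) \<Rightarrow> bool" where
  "regular_cond_distr P \<alpha> N Z \<kappa> \<longleftrightarrow>
     \<kappa> \<in> borel \<rightarrow>\<^sub>M prob_algebra N \<and>
     (\<forall>A\<in>sets borel. \<forall>C\<in>sets N.
        emeasure P {\<omega> \<in> space P. \<alpha> \<omega> \<in> A \<and> Z \<omega> \<in> C}
          = (\<integral>\<^sup>+a\<in>A. emeasure (\<kappa> a) C \<partial>distr P borel \<alpha>))"

(* "Conditionally on \<alpha>, X is a strictly stationary AR(1) process with coefficient \<alpha>": for
   almost every value a of \<alpha>, the coordinate processes of the pair (X, \<epsilon>) form such a process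
   under the conditional law of (X, \<epsilon>) given \<alpha> = a. The normal law with variance v / (1 - a^2)
   of X 0 is a consequence of stationarity and is not assumed. *)
definition randomized_AR1 ::
    "'a measure \<Rightarrow> real \<Rightarrow> ('a \<Rightarrow> real) \<Rightarrow> (nat \<Rightarrow> 'a \<Rightarrow> real) \<Rightarrow> (nat \<Rightarrow> 'a \<Rightarrow> real) \<Rightarrow> bool" where
  "randomized_AR1 P v \<alpha> X \<epsilon> \<longleftrightarrow>
     prob_space P \<and> \<alpha> \<in> borel_measurable P \<and> (\<forall>k. X k \<in> borel_measurable P) \<and>
     gaussian_innovations P v \<epsilon> \<and>
     indep_elements P borel \<alpha> (\<Pi>\<^sub>M k\<in>{1..}. borel) (\<lambda>\<omega>. \<lambda>k\<in>{1..}. \<epsilon> k \<omega>) \<and>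
     (\<forall>k\<ge>1. AE \<omega> in P. X k \<omega> = \<alpha> \<omega> * X (k - 1) \<omega> + \<epsilon> k \<omega>) \<and>
     (\<exists>\<kappa>. regular_cond_distr P \<alpha> ((\<Pi>\<^sub>M k\<in>UNIV. borel) \<Otimes>\<^sub>M (\<Pi>\<^sub>M k\<in>{1..}. borel))
             (\<lambda>\<omega>. (\<lambda>k. X k \<omega>, \<lambda>k\<in>{1..}. \<epsilon> k \<omega>)) \<kappa> \<and>
          (AE a in distr P borel \<alpha>.
             stationary_AR1 (\<kappa> a) a v (\<lambda>k p. fst p k) (\<lambda>k p. snd p k)))"

definition aggregated_sum ::
    "(nat \<Rightarrow> nat \<Rightarrow> 'a \<Rightarrow> real) \<Rightarrow> nat \<Rightarrow> nat \<Rightarrow> real \<Rightarrow> 'a \<Rightarrow> real" where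
  "aggregated_sum X N n t \<omega> = (\<Sum>j=1..N. \<Sum>k=1..nat \<lfloor>real n * t\<rfloor>. X j k \<omega>)"

(* Processes are indexed by the time set {0..}; values at negative times are irrelevant. *)
definition stochastic_process :: "'a measure \<Rightarrow> (real \<Rightarrow> 'a \<Rightarrow> real) \<Rightarrow> bool" where
  "stochastic_process P X \<longleftrightarrow> prob_space P \<and> (\<forall>t\<ge>0. X t \<in> borel_measurable P)"

definition standard_wiener :: "'a measure \<Rightarrow> (real \<Rightarrow> 'a \<Rightarrow> real) \<Rightarrow> bool" where
  "standard_wiener P B \<longleftrightarrow>
     stochastic_process P B \<and>
     (AE \<omega> in P. B 0 \<omega> = 0) \<and>
     (\<forall>d (\<tau> :: nat \<Rightarrow> real). 0 \<le> \<tau> 0 \<and> (\<forall>i<d. \<tau> i < \<tau> (Suc i)) \<longrightarrow>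
        prob_space.indep_vars P (\<lambda>_. borel) (\<lambda>i \<omega>. B (\<tau> (Suc i)) \<omega> - B (\<tau> i) \<omega>) {..<d}) \<and>
     (\<forall>s t. 0 \<le> s \<and> s < t \<longrightarrow> distr P borel (\<lambda>\<omega>. B t \<omega> - B s \<omega>) = gaussian 0 (t - s)) \<and>
     (AE \<omega> in P. continuous_on {0..} (\<lambda>t. B t \<omega>))"

definition fdd :: "'a measure \<Rightarrow> (real \<Rightarrow> 'a \<Rightarrow> real) \<Rightarrow> real set \<Rightarrow> (real \<Rightarrow> real) measure" where
  "fdd P X J = distr P (\<Pi>\<^sub>M t\<in>J. borel) (\<lambda>\<omega>. \<lambda>t\<in>J. X t \<omega>)"

(* Weak convergence of the finite-dimensional distributions. The processes may live on different
   probability spaces. For finite J, the set PiE J (\<lambda>_. UNIV), with the topology induced by the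
   product topology of real \<Rightarrow> real, is a copy of the Euclidean space of dimension card J. *)
definition fdd_converges ::
    "(nat \<Rightarrow> 'a measure) \<Rightarrow> (nat \<Rightarrow> real \<Rightarrow> 'a \<Rightarrow> real) \<Rightarrow>
     'b measure \<Rightarrow> (real \<Rightarrow> 'b \<Rightarrow> real) \<Rightarrow> bool" where
  "fdd_converges P X Q Y \<longleftrightarrow>
     (\<forall>J f. finite J \<and> J \<subseteq> {0..} \<and>
        continuous_on (PiE J (\<lambda>_. UNIV)) f \<and> bounded (f ` PiE J (\<lambda>_. UNIV)) \<longrightarrow>
        (\<lambda>n. \<integral>x. f x \<partial>fdd (P n) (X n) J) \<longlonglongrightarrow> (\<integral>x. (f x :: real) \<partial>fdd Q Y J))"

(* The iterated limit, first n to infinity for each fixed N \<ge> N0, then N to infinity, of a doubly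
   indexed family of processes Z N n. The inner limits W N are determined only in distribution,
   so they may be taken to live on the path space real \<Rightarrow> real. *)
definition iterated_fdd_converges ::
    "nat \<Rightarrow> 'a measure \<Rightarrow> (nat \<Rightarrow> nat \<Rightarrow> real \<Rightarrow> 'a \<Rightarrow> real) \<Rightarrow>
     'b measure \<Rightarrow> (real \<Rightarrow> 'b \<Rightarrow> real) \<Rightarrow> bool" where
  "iterated_fdd_converges N0 P Z Q Y \<longleftrightarrow>
     (\<exists>(R :: nat \<Rightarrow> (real \<Rightarrow> real) measure) W.
        (\<forall>N\<ge>N0. stochastic_process (R N) (W N) \<and> fdd_converges (\<lambda>_. P) (Z N) (R N) (W N)) \<and>
        fdd_converges R W Q Y)"

end

theory Submission
  imports Defs "HOL-Real_Asymp.Real_Asymp"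
begin

text \<open>Summing the recursion gives, for a stationary AR(1) path with coefficient \<open>a < 1\<close>,
\<open>(1 - a) * (\<Sum>k=1..m. X k) = (\<Sum>k=1..m. \<epsilon> k) + a * (X 0 - X m)\<close> (lemma sum_autoregression).
By stationarity the law of \<open>a * X m\<close> does not depend on \<open>m\<close>, so the boundary terms disappear after
division by \<open>sqrt n\<close> (boundary_terms_vanish). What remains of \<open>N\<close> aggregated copies is a sum of
independent Gaussian innovations, the \<open>j\<close>-th sequence carrying the random weight
\<open>1 / (1 - \<alpha>s j)\<close>, and the weights are independent of the innovations.

Conditionally on the weights, such a weighted sum is again a Gaussian random walk. On the grid of
mesh \<open>1 / n\<close> its law is exactly that of a Brownian motion multiplied by a constant whose square is
\<open>\<sigma>2\<close> times the sum of the squared weights. Hence the rescaled walk has exactly the law of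
this random multiple of the given Wiener process \<open>B\<close>, evaluated at the grid points, with weights
and \<open>B\<close> independent (mixture_law), and the limit
\<open>n \<rightarrow> \<infinity>\<close> is nothing but continuity of the paths of \<open>B\<close> (fdd_weighted_sums_converge);
the vanishing boundary terms are added by a Slutsky argument (fdd_slutsky). So the inner limit is
\<open>sqrt (\<sigma>2 * V N) * B\<close>, where \<open>V N\<close> is the sum of the \<open>1 / (1 - \<alpha>s j)\<^sup>2\<close> over \<open>j \<le> N\<close>, divided by
\<open>N ln N\<close>.

For \<open>\<beta> = 1\<close> the variables \<open>1 / (1 - \<alpha>s j)\<^sup>2\<close> have a tail of order \<open>\<psi>1 / (2 y)\<close>: their mean is
infinite, but only logarithmically, and truncation shows that \<open>V N\<close> converges in probability
to \<open>\<psi>1 / 2\<close> (heavy_tailed_weak_law). Since \<open>B\<close> is independent of \<open>V N\<close>, the outer limit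
follows from the continuity, for each bounded continuous \<open>f\<close>, of the expectation of \<open>f (sqrt (\<sigma>2 * x) * B)\<close> as a function of \<open>x\<close>.\<close>

section \<open>Gaussian laws and independence\<close>

text \<open>Writing every centred normal law as the image of the standard one treats the degenerate case \<open>v = 0\<close>,
in which there is no density, on the same footing as \<open>v > 0\<close>.\<close>
lemma gaussian_eq_scaled_normal:
  assumes "0 \<le> v"
  shows "gaussian 0 v = distr std_normal_distribution borel (\<lambda>x. sqrt v * x)"
proof (cases "v = 0")
  case True
  interpret prob_space std_normal_distribution by (rule prob_space_normal_density) simp
  have "distr std_normal_distribution borel (\<lambda>x. 0::real) = return borel 0"
    by (rule distr_const) simp
  then show ?thesis using True by (simp add: gaussian_def)
next
  case False
  then have v: "v > 0" using assms by simp
  interpret prob_space std_normal_distribution by (rule prob_space_normal_density) simp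
  have "distributed std_normal_distribution lborel (\<lambda>x. x) std_normal_density"
    by (auto simp: distributed_def distr_id2)
  from normal_density_affine[OF this, of "sqrt v" 0] v
  have "distributed std_normal_distribution lborel (\<lambda>x. sqrt v * x) (normal_density 0 (sqrt v))"
    by simp
  from distributed_distr_eq_density[OF this] show ?thesis
    using v by (simp add: gaussian_def cong: distr_cong)
qed

lemma real_distribution_gaussian: "0 \<le> v \<Longrightarrow> real_distribution (gaussian 0 v)"
  unfolding gaussian_eq_scaled_normal
  by (intro prob_space.real_distribution_distr prob_space_normal_density) auto

lemma prob_space_gaussian: "0 \<le> v \<Longrightarrow> prob_space (gaussian 0 v)"
  using real_distribution_gaussian real_distribution.axioms(1) by blast

lemma sets_gaussian [measurable_cong, simp]: "sets (gaussian m v) = sets borel"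
  by (simp add: gaussian_def)

lemma char_gaussian:
  assumes "0 \<le> v"
  shows "char (gaussian 0 v) t = complex_of_real (exp (- (v * t\<^sup>2) / 2))"
proof -
  have "char (gaussian 0 v) t = char std_normal_distribution (sqrt v * t)"
    unfolding gaussian_eq_scaled_normal[OF assms] char_def
    by (subst integral_distr) (auto simp: mult_ac)
  also have "\<dots> = complex_of_real (exp (- (v * t\<^sup>2) / 2))"
    using assms by (simp add: char_std_normal_distribution power_mult_distrib)
  finally show ?thesis .
qed

text \<open>Characteristic functions multiply under independent sums; this argument is uniform in
the weights and in \<open>v\<close>, although the laws of the summands degenerate when one of them is 0.\<close>
lemma (in prob_space) distr_weighted_sum_gaussian:
  assumes ind: "indep_vars (\<lambda>_. borel) Y I"
    and law: "\<And>i. i \<in> I \<Longrightarrow> distr M borel (Y i) = gaussian 0 v"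
    and "0 \<le> v"
  shows "distr M borel (\<lambda>\<omega>. \<Sum>i\<in>I. c i * Y i \<omega>) = gaussian 0 (v * (\<Sum>i\<in>I. (c i)\<^sup>2))"
proof (rule Levy_uniqueness)
  have rv: "random_variable borel (Y i)" if "i \<in> I" for i
    using ind that by (auto simp: indep_vars_def)
  have ind': "indep_vars (\<lambda>_. borel) (\<lambda>i \<omega>. c i * Y i \<omega>) I"
    by (rule indep_vars_compose2[OF ind]) simp
  show "real_distribution (distr M borel (\<lambda>\<omega>. \<Sum>i\<in>I. c i * Y i \<omega>))"
    by (intro real_distribution_distr borel_measurable_sum borel_measurable_times) (auto simp: rv)
  show "real_distribution (gaussian 0 (v * (\<Sum>i\<in>I. (c i)\<^sup>2)))"
    using assms(3) by (intro real_distribution_gaussian mult_nonneg_nonneg sum_nonneg) auto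
  show "char (distr M borel (\<lambda>\<omega>. \<Sum>i\<in>I. c i * Y i \<omega>)) = char (gaussian 0 (v * (\<Sum>i\<in>I. (c i)\<^sup>2)))"
  proof
    fix t
    have "char (distr M borel (\<lambda>\<omega>. c i * Y i \<omega>)) t = complex_of_real (exp (- (v * (c i * t)\<^sup>2) / 2))"
      if "i \<in> I" for i
    proof -
      have "char (distr M borel (\<lambda>\<omega>. c i * Y i \<omega>)) t = char (distr M borel (Y i)) (c i * t)"
        unfolding char_def using rv[OF that] by (simp add: integral_distr mult_ac)
      then show ?thesis by (simp only: law[OF that] char_gaussian[OF assms(3)])
    qed
    then have "char (distr M borel (\<lambda>\<omega>. \<Sum>i\<in>I. c i * Y i \<omega>)) t
        = complex_of_real (\<Prod>i\<in>I. exp (- (v * (c i * t)\<^sup>2) / 2))"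
      by (simp add: char_distr_sum[OF ind'])
    also have "(\<Prod>i\<in>I. exp (- (v * (c i * t)\<^sup>2) / 2)) = exp (- (v * (\<Sum>i\<in>I. (c i)\<^sup>2) * t\<^sup>2) / 2)"
      by (cases "finite I")
        (simp_all add: exp_sum[symmetric] sum_distrib_left sum_distrib_right sum_divide_distrib
          sum_negf power_mult_distrib mult_ac)
    finally show "char (distr M borel (\<lambda>\<omega>. \<Sum>i\<in>I. c i * Y i \<omega>)) t
        = char (gaussian 0 (v * (\<Sum>i\<in>I. (c i)\<^sup>2))) t"
      using assms(3) by (simp add: char_gaussian sum_nonneg)
  qed
qed

text \<open>Independent rows with independent entries form an independent array: on rectangles both factorisations
combine into one product over all entries.\<close>
lemma (in prob_space) indep_vars_flatten:
  fixes Y :: "'i \<times> 'k \<Rightarrow> 'a \<Rightarrow> 'b"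
  assumes ind: "indep_vars (\<lambda>j. PiM K (\<lambda>k. N)) (\<lambda>j \<omega>. \<lambda>k\<in>K. Y (j, k) \<omega>) J"
    and inner: "\<And>j. j \<in> J \<Longrightarrow> indep_vars (\<lambda>_. N) (\<lambda>k. Y (j, k)) K"
    and fin: "finite J" "finite K" "J \<noteq> {}" "K \<noteq> {}"
  shows "indep_vars (\<lambda>_. N) Y (J \<times> K)"
proof -
  have rv: "random_variable N (Y i)" if "i \<in> J \<times> K" for i
    using inner that by (auto simp: indep_vars_def)
  \<comment> \<open>Outside the index set the factors are filled up with one of the given laws, so that all of them are probability measures.\<close>
  have "distr M (PiM (J \<times> K) (\<lambda>_. N)) (\<lambda>x. \<lambda>i\<in>J \<times> K. Y i x) = PiM (J \<times> K) (\<lambda>i. distr M N (if i \<in> J \<times> K then Y i else Y (SOME i. i \<in> J \<times> K)))"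
    (is "?L = PiM _ ?D")
  proof (rule product_sigma_finite.PiM_eqI)
    have ne: "(SOME i. i \<in> J \<times> K) \<in> J \<times> K" using fin(3,4) unfolding some_in_eq by auto
    have ps: "prob_space (?D i)" for i
      using rv rv[OF ne] by (auto intro: prob_space_distr)
    show "product_sigma_finite ?D"
      unfolding product_sigma_finite_def
      using ps prob_space_imp_sigma_finite by blast
    show "finite (J \<times> K)" using fin by simp
    show "sets ?L = sets (PiM (J \<times> K) ?D)"
      by (simp cong: sets_PiM_cong)
    fix A assume A: "\<And>i. i \<in> J \<times> K \<Longrightarrow> A i \<in> sets (?D i)"
    then have A': "\<And>i. i \<in> J \<times> K \<Longrightarrow> A i \<in> sets N" by simp
    have "emeasure ?L (PiE (J \<times> K) A) = emeasure M ((\<lambda>x. \<lambda>i\<in>J \<times> K. Y i x) -` PiE (J \<times> K) A \<inter> space M)"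
      using A' fin rv by (intro emeasure_distr measurable_restrict sets_PiM_I_finite) auto
    also have "(\<lambda>x. \<lambda>i\<in>J \<times> K. Y i x) -` PiE (J \<times> K) A \<inter> space M
       = (\<Inter>j\<in>J. (\<lambda>\<omega>. \<lambda>k\<in>K. Y (j, k) \<omega>) -` (PiE K (\<lambda>k. A (j, k))) \<inter> space M)"
      using fin(3) by (auto simp: PiE_iff)
    also have "emeasure M (\<Inter>j\<in>J. (\<lambda>\<omega>. \<lambda>k\<in>K. Y (j, k) \<omega>) -` (PiE K (\<lambda>k. A (j, k))) \<inter> space M)
       = ennreal (prob (\<Inter>j\<in>J. (\<lambda>\<omega>. \<lambda>k\<in>K. Y (j, k) \<omega>) -` (PiE K (\<lambda>k. A (j, k))) \<inter> space M))"
      by (rule emeasure_eq_measure)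
    also have "prob (\<Inter>j\<in>J. (\<lambda>\<omega>. \<lambda>k\<in>K. Y (j, k) \<omega>) -` (PiE K (\<lambda>k. A (j, k))) \<inter> space M) = (\<Prod>j\<in>J. prob ((\<lambda>\<omega>. \<lambda>k\<in>K. Y (j, k) \<omega>) -` (PiE K (\<lambda>k. A (j, k))) \<inter> space M))"
      using A' fin by (intro indep_varsD_finite[OF ind] sets_PiM_I_finite) auto
    also have "\<dots> = (\<Prod>j\<in>J. \<Prod>k\<in>K. prob (Y (j, k) -` A (j, k) \<inter> space M))"
    proof (rule prod.cong[OF refl])
      fix j assume j: "j \<in> J"
      have "(\<lambda>\<omega>. \<lambda>k\<in>K. Y (j, k) \<omega>) -` (PiE K (\<lambda>k. A (j, k))) \<inter> space M
          = (\<Inter>k\<in>K. Y (j, k) -` A (j, k) \<inter> space M)"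
        using fin(4) by (auto simp: PiE_iff)
      then show "prob ((\<lambda>\<omega>. \<lambda>k\<in>K. Y (j, k) \<omega>) -` (PiE K (\<lambda>k. A (j, k))) \<inter> space M)
          = (\<Prod>k\<in>K. prob (Y (j, k) -` A (j, k) \<inter> space M))"
        using indep_varsD_finite[OF inner[OF j], of "\<lambda>k. A (j, k)"] A' fin j by simp
    qed
    also have "\<dots> = (\<Prod>i\<in>J \<times> K. prob (Y i -` A i \<inter> space M))"
      by (simp add: prod.cartesian_product split_beta)
    also have "ennreal \<dots> = (\<Prod>i\<in>J \<times> K. emeasure (?D i) (A i))"
    proof -
      have "emeasure (?D i) (A i) = ennreal (prob (Y i -` A i \<inter> space M))" if "i \<in> J \<times> K" for i
        using rv[OF that] A'[OF that] that by (simp add: emeasure_distr emeasure_eq_measure)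
      then show ?thesis by (simp add: prod_ennreal)
    qed
    finally show "emeasure ?L (PiE (J \<times> K) A) = (\<Prod>i\<in>J \<times> K. emeasure (?D i) (A i))" .
  qed
  also have "\<dots> = PiM (J \<times> K) (\<lambda>i. distr M N (Y i))"
    by (intro PiM_cong) auto
  finally show ?thesis
    using fin by (subst indep_vars_iff_distr_eq_PiM') (auto simp: rv)
qed

section \<open>Weak convergence on finite products of the real line\<close>

text \<open>Convergence in the product topology is coordinatewise, and off \<open>J\<close> every point of the extensional
product has the same coordinates.\<close>
lemma tendsto_PiE_continuous_on:
  fixes f :: "('i \<Rightarrow> real) \<Rightarrow> real"
  assumes f: "continuous_on (PiE J (\<lambda>_. UNIV)) f"
    and x: "\<And>n. x n \<in> PiE J (\<lambda>_. UNIV)" and l: "l \<in> PiE J (\<lambda>_. UNIV)"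
    and lim: "\<And>t. t \<in> J \<Longrightarrow> ((\<lambda>n. x n t) \<longlongrightarrow> l t) F"
  shows "((\<lambda>n. f (x n)) \<longlongrightarrow> f l) F"
proof -
  have "((\<lambda>n. x n t) \<longlongrightarrow> l t) F" for t
  proof (cases "t \<in> J")
    case False
    then have "x n t = l t" for n using x[of n] l by (auto simp: PiE_iff extensional_def)
    then show ?thesis by simp
  qed (rule lim)
  then have "limitin (product_topology (\<lambda>_. euclidean) UNIV) x l F"
    by (simp add: limitin_componentwise)
  then have "(x \<longlongrightarrow> l) F"
    by (simp add: euclidean_product_topology flip: limitin_canonical_iff)
  from continuous_on_tendsto_compose[OF f this l] x show ?thesis by simp
qed

text \<open>For an uncountable index type the Borel sets of the function space do not form the product sigma algebra. The
coordinates in \<open>J\<close> are therefore first copied to sequences, where the two agree.\<close>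
lemma borel_measurable_PiM_continuous_on:
  fixes f :: "('i \<Rightarrow> real) \<Rightarrow> real"
  assumes J: "finite J" and f: "continuous_on (PiE J (\<lambda>_. UNIV)) f"
  shows "f \<in> borel_measurable (PiM J (\<lambda>_. borel))"
proof -
  obtain e where e: "bij_betw e J {..<card J}" using J bij_betw_iff_card finite_lessThan by (metis card_lessThan)
  define d where "d = the_inv_into J e"
  have d: "d (e t) = t" if "t \<in> J" for t
    unfolding d_def using e that by (auto simp: bij_betw_def the_inv_into_f_f)
  define g :: "(nat \<Rightarrow> real) \<Rightarrow> ('i \<Rightarrow> real)" where "g = (\<lambda>y. \<lambda>t\<in>J. y (e t))"
  define p :: "('i \<Rightarrow> real) \<Rightarrow> nat \<Rightarrow> real" where "p = (\<lambda>x i. if i < card J then x (d i) else 0)"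
  have dJ: "d i \<in> J" if "i < card J" for i
    using e that the_inv_into_into[of e J i J] by (auto simp: d_def bij_betw_def)
  have "continuous_on UNIV g"
    unfolding g_def
  proof (rule continuous_on_coordinatewise_then_product)
    fix t show "continuous_on UNIV (\<lambda>y::nat \<Rightarrow> real. (\<lambda>t\<in>J. y (e t)) t)"
      by (cases "t \<in> J") (auto intro!: continuous_intros continuous_on_product_coordinates)
  qed
  moreover have "range g \<subseteq> PiE J (\<lambda>_. UNIV)" by (auto simp: g_def)
  ultimately have "continuous_on UNIV (f \<circ> g)"
    by (intro continuous_on_compose continuous_on_subset[OF f]) auto
  then have [measurable]: "(f \<circ> g) \<in> borel_measurable (PiM UNIV (\<lambda>_. borel))"
    using borel_measurable_continuous_onI measurable_cong_sets[OF sets_PiM_equal_borel refl] by blast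
  have [measurable]: "p \<in> PiM J (\<lambda>_. borel) \<rightarrow>\<^sub>M PiM UNIV (\<lambda>_. borel)"
  proof (rule measurable_PiM_single')
    fix i
    have "(\<lambda>x. x (d i)) \<in> borel_measurable (PiM J (\<lambda>_. borel))" if "i < card J"
      using dJ[OF that] by measurable
    then show "(\<lambda>x. p x i) \<in> borel_measurable (PiM J (\<lambda>_. borel))"
      by (cases "i < card J") (simp_all add: p_def)
  qed simp
  have "(\<lambda>x. (f \<circ> g) (p x)) \<in> borel_measurable (PiM J (\<lambda>_. borel))" by measurable
  also have "(\<lambda>x. (f \<circ> g) (p x)) \<in> borel_measurable (PiM J (\<lambda>_. borel)) \<longleftrightarrow>
      f \<in> borel_measurable (PiM J (\<lambda>_. borel))"
  proof (rule measurable_cong)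
    fix x assume "x \<in> space (PiM J (\<lambda>_. borel :: real measure))"
    then have x: "x \<in> PiE J (\<lambda>_. UNIV)" by (simp add: space_PiM)
    have "g (p x) = x"
    proof
      fix t show "g (p x) t = x t"
        using x d e by (cases "t \<in> J") (auto simp: g_def p_def PiE_iff extensional_def bij_betw_def)
    qed
    then show "(f \<circ> g) (p x) = f x" by simp
  qed
  finally show ?thesis .
qed

text \<open>Heine--Cantor by sequential compactness of boxes; it is stated coordinatewise because the function space
carries no metric.\<close>
lemma uniformly_continuous_on_bounded_PiE:
  fixes f :: "('i \<Rightarrow> real) \<Rightarrow> real"
  assumes J: "finite J" and f: "continuous_on (PiE J (\<lambda>_. UNIV)) f" and "0 < \<epsilon>"
  obtains \<delta> where "0 < \<delta>"
    "\<And>x y. x \<in> PiE J (\<lambda>_. UNIV) \<Longrightarrow> y \<in> PiE J (\<lambda>_. UNIV) \<Longrightarrow>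
       (\<And>t. t \<in> J \<Longrightarrow> \<bar>x t\<bar> \<le> r) \<Longrightarrow> (\<And>t. t \<in> J \<Longrightarrow> \<bar>y t - x t\<bar> \<le> \<delta>) \<Longrightarrow> \<bar>f y - f x\<bar> \<le> \<epsilon>"
proof (rule ccontr)
  assume contr: "\<not> thesis"
  have "\<exists>x y. x \<in> PiE J (\<lambda>_. UNIV) \<and> y \<in> PiE J (\<lambda>_. UNIV) \<and> (\<forall>t\<in>J. \<bar>x t\<bar> \<le> r) \<and>
      (\<forall>t\<in>J. \<bar>y t - x t\<bar> \<le> inverse (real (Suc n))) \<and> \<not> \<bar>f y - f x\<bar> \<le> \<epsilon>" for n
    using contr that[of "inverse (real (Suc n))"] by (meson inverse_positive_iff_positive of_nat_0_less_iff zero_less_Suc)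
  then obtain x y where xy: "\<And>n. x n \<in> PiE J (\<lambda>_. UNIV)" "\<And>n. y n \<in> PiE J (\<lambda>_. UNIV)"
      "\<And>n t. t \<in> J \<Longrightarrow> \<bar>x n t\<bar> \<le> r" "\<And>n t. t \<in> J \<Longrightarrow> \<bar>y n t - x n t\<bar> \<le> inverse (real (Suc n))"
      "\<And>n. \<not> \<bar>f (y n) - f (x n)\<bar> \<le> \<epsilon>"
    by metis
  have "\<forall>d\<subseteq>J. \<exists>l::'i \<Rightarrow> real. \<exists> q::nat\<Rightarrow>nat. strict_mono q \<and>
      (\<forall>e>0. eventually (\<lambda>n. \<forall>i\<in>d. dist (x (q n) i) (l i) < e) sequentially)"
    using xy(3) by (intro compact_lemma_general[where unproj = "\<lambda>x. x"] J) (auto simp: bounded_iff)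
  then obtain l q where q: "strict_mono (q :: nat \<Rightarrow> nat)"
      and l: "\<And>e. e > 0 \<Longrightarrow> eventually (\<lambda>n. \<forall>i\<in>J. dist (x (q n) i) (l i) < e) sequentially"
    by blast
  have lim: "(\<lambda>n. x (q n) t) \<longlonglongrightarrow> l t" if "t \<in> J" for t
    unfolding tendsto_iff using that by (auto intro: eventually_mono[OF l])
  have "(\<lambda>n. y (q n) t - x (q n) t) \<longlonglongrightarrow> 0" if "t \<in> J" for t
  proof (rule Lim_null_comparison)
    show "\<forall>\<^sub>F n in sequentially. norm (y (q n) t - x (q n) t) \<le> inverse (real (Suc (q n)))"
      using xy(4) that by auto
    show "(\<lambda>n. inverse (real (Suc (q n)))) \<longlonglongrightarrow> 0"
      using LIMSEQ_subseq_LIMSEQ[OF LIMSEQ_inverse_real_of_nat q] by (simp add: o_def)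
  qed
  then have lim': "(\<lambda>n. y (q n) t) \<longlonglongrightarrow> l t" if "t \<in> J" for t
    using tendsto_add[OF _ lim[OF that], of "\<lambda>n. y (q n) t - x (q n) t" 0] that by simp
  define l' where "l' = restrict l J"
  have "(\<lambda>n. f (x (q n))) \<longlonglongrightarrow> f l'" "(\<lambda>n. f (y (q n))) \<longlonglongrightarrow> f l'"
    using xy lim lim' by (intro tendsto_PiE_continuous_on[OF f]; simp add: l'_def)+
  then have "(\<lambda>n. \<bar>f (y (q n)) - f (x (q n))\<bar>) \<longlonglongrightarrow> \<bar>f l' - f l'\<bar>"
    by (intro tendsto_intros)
  then have "\<forall>\<^sub>F n in sequentially. \<bar>f (y (q n)) - f (x (q n))\<bar> < \<epsilon>"
    using \<open>0 < \<epsilon>\<close> by (intro order_tendstoD) auto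
  then obtain N where "\<bar>f (y (q N)) - f (x (q N))\<bar> < \<epsilon>" by (auto simp: eventually_sequentially)
  then show False using xy(5)[of "q N"] by simp
qed

text \<open>Slutsky's theorem. The assumed convergence for all bounded continuous test functions, applied to a
truncation \<open>h r\<close> of the excess over the box of radius \<open>r\<close>, yields the tightness of \<open>D n\<close>; on a
large box \<open>f\<close> is uniformly continuous and a small perturbation \<open>R n\<close> is harmless.\<close>
lemma (in prob_space) fdd_slutsky:
  fixes D R :: "nat \<Rightarrow> 'i \<Rightarrow> 'a \<Rightarrow> real" and Y :: "'i \<Rightarrow> 'b \<Rightarrow> real"
  assumes J: "finite J" and Q: "prob_space Q"
    and D [measurable]: "\<And>n t. t \<in> J \<Longrightarrow> D n t \<in> borel_measurable M"
    and R [measurable]: "\<And>n t. t \<in> J \<Longrightarrow> R n t \<in> borel_measurable M"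
    and Y [measurable]: "\<And>t. t \<in> J \<Longrightarrow> Y t \<in> borel_measurable Q"
    and small: "\<And>t \<epsilon>. t \<in> J \<Longrightarrow> 0 < \<epsilon> \<Longrightarrow> (\<lambda>n. prob {\<omega> \<in> space M. \<epsilon> < \<bar>R n t \<omega>\<bar>}) \<longlonglongrightarrow> 0"
    and conv: "\<And>g. continuous_on (PiE J (\<lambda>_. UNIV)) g \<Longrightarrow> bounded (g ` PiE J (\<lambda>_. UNIV)) \<Longrightarrow>
       (\<lambda>n. \<integral>\<omega>. g (\<lambda>t\<in>J. D n t \<omega>) \<partial>M) \<longlonglongrightarrow> (\<integral>\<omega>. (g (\<lambda>t\<in>J. Y t \<omega>) :: real) \<partial>Q)"
    and f: "continuous_on (PiE J (\<lambda>_. UNIV)) f" and bdd: "bounded (f ` PiE J (\<lambda>_. UNIV))"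
  shows "(\<lambda>n. \<integral>\<omega>. f (\<lambda>t\<in>J. D n t \<omega> + R n t \<omega>) \<partial>M) \<longlonglongrightarrow> (\<integral>\<omega>. (f (\<lambda>t\<in>J. Y t \<omega>) :: real) \<partial>Q)"
proof -
  interpret Q: prob_space Q by (rule Q)
  obtain C where C: "0 < C" "\<And>x. x \<in> PiE J (\<lambda>_. UNIV) \<Longrightarrow> \<bar>f x\<bar> \<le> C"
    using bdd by (auto simp: bounded_pos)
  note [measurable] = borel_measurable_PiM_continuous_on[OF J f]
  have [measurable]: "(\<lambda>\<omega>. \<lambda>t\<in>J. D n t \<omega>) \<in> M \<rightarrow>\<^sub>M PiM J (\<lambda>_. borel)"
    "(\<lambda>\<omega>. \<lambda>t\<in>J. D n t \<omega> + R n t \<omega>) \<in> M \<rightarrow>\<^sub>M PiM J (\<lambda>_. borel)" for n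
    by (intro measurable_restrict; measurable)+
  have int1: "integrable M (\<lambda>\<omega>. f (\<lambda>t\<in>J. D n t \<omega>))" for n
    using C(2) by (intro integrable_const_bound[where B=C]) auto
  have int2: "integrable M (\<lambda>\<omega>. f (\<lambda>t\<in>J. D n t \<omega> + R n t \<omega>))" for n
    using C(2) by (intro integrable_const_bound[where B=C]) auto
  define h :: "nat \<Rightarrow> ('i \<Rightarrow> real) \<Rightarrow> real" where "h = (\<lambda>r x. min 1 (\<Sum>t\<in>J. max 0 (\<bar>x t\<bar> - real r)))"
  have h01: "0 \<le> h r x" "h r x \<le> 1" for r x by (auto simp: h_def intro!: sum_nonneg)
  have h_cont: "continuous_on A (h r)" for r A
    unfolding h_def by (intro continuous_intros continuous_on_product_coordinates[THEN continuous_on_subset]) auto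
  have h_bdd: "bounded (h r ` A)" for r A
    using h01[of r] by (intro boundedI[where B=1]) auto
  note [measurable] = borel_measurable_PiM_continuous_on[OF J h_cont]
  have [measurable]: "(\<lambda>\<omega>. \<lambda>t\<in>J. Y t \<omega>) \<in> Q \<rightarrow>\<^sub>M PiM J (\<lambda>_. borel)"
    by (intro measurable_restrict) measurable
  have intD: "integrable M (\<lambda>\<omega>. h r (\<lambda>t\<in>J. D n t \<omega>))" for r n
    using h01[of r] by (intro integrable_const_bound[where B=1]) auto
  have tail: "(\<lambda>r. \<integral>\<omega>. h r (\<lambda>t\<in>J. Y t \<omega>) \<partial>Q) \<longlonglongrightarrow> (\<integral>\<omega>. 0 \<partial>Q)"
  proof (rule integral_dominated_convergence[where w="\<lambda>_. 1"])
    show "AE \<omega> in Q. (\<lambda>r. h r (\<lambda>t\<in>J. Y t \<omega>)) \<longlonglongrightarrow> 0"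
    proof (intro AE_I2)
      fix \<omega>
      have "\<forall>\<^sub>F r in sequentially. \<bar>Y t \<omega>\<bar> \<le> real r" for t
        using filterlim_real_sequentially by (simp add: filterlim_at_top)
      then have "\<forall>\<^sub>F r in sequentially. \<forall>t\<in>J. \<bar>Y t \<omega>\<bar> \<le> real r"
        using J by (simp add: eventually_ball_finite)
      then have "\<forall>\<^sub>F r in sequentially. h r (\<lambda>t\<in>J. Y t \<omega>) = 0"
      proof (rule eventually_mono)
        fix r assume "\<forall>t\<in>J. \<bar>Y t \<omega>\<bar> \<le> real r"
        then have "(\<Sum>t\<in>J. max 0 (\<bar>(\<lambda>t\<in>J. Y t \<omega>) t\<bar> - real r)) = 0" by (intro sum.neutral) auto
        then show "h r (\<lambda>t\<in>J. Y t \<omega>) = 0" unfolding h_def by simp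
      qed
      then show "(\<lambda>r. h r (\<lambda>t\<in>J. Y t \<omega>)) \<longlonglongrightarrow> 0" by (rule tendsto_eventually)
    qed
  qed (use h01 in auto)
  have "(\<lambda>n. (\<integral>\<omega>. f (\<lambda>t\<in>J. D n t \<omega> + R n t \<omega>) \<partial>M) - (\<integral>\<omega>. f (\<lambda>t\<in>J. D n t \<omega>) \<partial>M)) \<longlonglongrightarrow> 0"
  proof (rule LIMSEQ_I)
    fix e :: real assume e: "0 < e"
    \<comment> \<open>Three error terms: the oscillation of f on the box, the mass of D outside it and the mass where R is large; the last two are weighted by the maximal oscillation 2 C.\<close>
    define \<epsilon> where "\<epsilon> = e / (2 * (1 + 4 * C))"
    have \<epsilon>: "0 < \<epsilon>" using e C by (simp add: \<epsilon>_def)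
    have \<epsilon>_e: "\<epsilon> * (2 * (1 + 4 * C)) = e" using C(1) by (simp add: \<epsilon>_def)
    obtain r where r: "(\<integral>\<omega>. h r (\<lambda>t\<in>J. Y t \<omega>) \<partial>Q) < \<epsilon>"
      using order_tendstoD(2)[OF tail, of \<epsilon>] \<epsilon> by (auto simp: eventually_sequentially)
    obtain \<delta> where \<delta>: "0 < \<delta>"
      "\<And>x y. x \<in> PiE J (\<lambda>_. UNIV) \<Longrightarrow> y \<in> PiE J (\<lambda>_. UNIV) \<Longrightarrow>
       (\<And>t. t \<in> J \<Longrightarrow> \<bar>x t\<bar> \<le> real r + 1) \<Longrightarrow> (\<And>t. t \<in> J \<Longrightarrow> \<bar>y t - x t\<bar> \<le> \<delta>) \<Longrightarrow> \<bar>f y - f x\<bar> \<le> \<epsilon>"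
      using uniformly_continuous_on_bounded_PiE[OF J f \<epsilon>] by blast
    define b where "b = (\<lambda>n t. {\<omega> \<in> space M. \<delta> < \<bar>R n t \<omega>\<bar>})"
    have b_sets [measurable]: "b n t \<in> events" if "t \<in> J" for n t unfolding b_def using that by measurable
    have "(\<lambda>n. \<Sum>t\<in>J. prob (b n t)) \<longlonglongrightarrow> (\<Sum>t\<in>J. 0)"
      unfolding b_def by (intro tendsto_sum small \<delta>)
    then have ev2: "\<forall>\<^sub>F n in sequentially. (\<Sum>t\<in>J. prob (b n t)) < \<epsilon>"
      using \<epsilon> by (intro order_tendstoD) auto
    have ev1: "\<forall>\<^sub>F n in sequentially. (\<integral>\<omega>. h r (\<lambda>t\<in>J. D n t \<omega>) \<partial>M) < \<epsilon>"
      using r by (intro order_tendstoD(2)[OF conv] h_cont h_bdd)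
    have "\<forall>\<^sub>F n in sequentially. \<bar>(\<integral>\<omega>. f (\<lambda>t\<in>J. D n t \<omega> + R n t \<omega>) \<partial>M) - (\<integral>\<omega>. f (\<lambda>t\<in>J. D n t \<omega>) \<partial>M)\<bar> < e"
      using ev1 ev2
    proof eventually_elim
      case (elim n)
      have intb: "integrable M (\<lambda>\<omega>. \<Sum>t\<in>J. indicator (b n t) \<omega> :: real)"
        by (intro Bochner_Integration.integrable_sum) (simp add: emeasure_eq_measure)
      have pt: "\<bar>f (\<lambda>t\<in>J. D n t \<omega> + R n t \<omega>) - f (\<lambda>t\<in>J. D n t \<omega>)\<bar>
          \<le> \<epsilon> + (2 * C) * h r (\<lambda>t\<in>J. D n t \<omega>) + (2 * C) * (\<Sum>t\<in>J. indicator (b n t) \<omega>)"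
        (is "?l \<le> ?a + ?b + ?c") if w: "\<omega> \<in> space M" for \<omega>
      proof -
        have le: "?l \<le> 2 * C"
          using C(2)[of "\<lambda>t\<in>J. D n t \<omega> + R n t \<omega>"] C(2)[of "\<lambda>t\<in>J. D n t \<omega>"] by auto
        have nn: "0 \<le> ?b" "0 \<le> ?c" using h01 C by (auto intro!: mult_nonneg_nonneg sum_nonneg)
        consider (R) t where "t \<in> J" "\<delta> < \<bar>R n t \<omega>\<bar>" | (D) t where "t \<in> J" "real r + 1 < \<bar>D n t \<omega>\<bar>"
          | (G) "\<And>t. t \<in> J \<Longrightarrow> \<bar>R n t \<omega>\<bar> \<le> \<delta>" "\<And>t. t \<in> J \<Longrightarrow> \<bar>D n t \<omega>\<bar> \<le> real r + 1"
          by (meson not_le)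
        then show ?thesis
        proof cases
          case R
          then have "1 = indicator (b n t) \<omega>" using w by (simp add: b_def)
          also have "\<dots> \<le> (\<Sum>t\<in>J. indicator (b n t) \<omega> :: real)"
            using R J by (intro member_le_sum) auto
          finally have "2 * C \<le> ?c" using C(1) by simp
          then show ?thesis using le nn \<epsilon> by linarith
        next
          case D
          then have "1 \<le> max 0 (\<bar>(\<lambda>t\<in>J. D n t \<omega>) t\<bar> - real r)" by simp
          also have "\<dots> \<le> (\<Sum>t\<in>J. max 0 (\<bar>(\<lambda>t\<in>J. D n t \<omega>) t\<bar> - real r))"
            using D J by (intro member_le_sum) auto
          finally have "h r (\<lambda>t\<in>J. D n t \<omega>) = 1" unfolding h_def by linarith
          then show ?thesis using le nn \<epsilon> by simp
        next
          case G
          then have "?l \<le> \<epsilon>" by (intro \<delta>(2)) auto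
          then show ?thesis using nn by linarith
        qed
      qed
      have "\<bar>(\<integral>\<omega>. f (\<lambda>t\<in>J. D n t \<omega> + R n t \<omega>) \<partial>M) - (\<integral>\<omega>. f (\<lambda>t\<in>J. D n t \<omega>) \<partial>M)\<bar>
          = \<bar>\<integral>\<omega>. f (\<lambda>t\<in>J. D n t \<omega> + R n t \<omega>) - f (\<lambda>t\<in>J. D n t \<omega>) \<partial>M\<bar>"
        using int1 int2 by simp
      also have "\<dots> \<le> (\<integral>\<omega>. \<bar>f (\<lambda>t\<in>J. D n t \<omega> + R n t \<omega>) - f (\<lambda>t\<in>J. D n t \<omega>)\<bar> \<partial>M)"
        by (rule integral_abs_bound)
      also have "\<dots> \<le> (\<integral>\<omega>. \<epsilon> + (2 * C) * h r (\<lambda>t\<in>J. D n t \<omega>) + (2 * C) * (\<Sum>t\<in>J. indicator (b n t) \<omega>) \<partial>M)"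
        using int1 int2 intD intb pt
        by (intro integral_mono Bochner_Integration.integrable_add integrable_abs
            Bochner_Integration.integrable_diff integrable_mult_right integrable_const) auto
      also have "\<dots> = \<epsilon> + (2 * C) * (\<integral>\<omega>. h r (\<lambda>t\<in>J. D n t \<omega>) \<partial>M)
          + (2 * C) * (\<integral>\<omega>. (\<Sum>t\<in>J. indicator (b n t) \<omega>) \<partial>M)"
        using intD intb by (simp add: prob_space)
      also have "(\<integral>\<omega>. (\<Sum>t\<in>J. indicator (b n t) \<omega>) \<partial>M) = (\<Sum>t\<in>J. prob (b n t))"
        by (subst Bochner_Integration.integral_sum) (auto simp: emeasure_eq_measure)
      also have "\<epsilon> + (2 * C) * (\<integral>\<omega>. h r (\<lambda>t\<in>J. D n t \<omega>) \<partial>M) + (2 * C) * (\<Sum>t\<in>J. prob (b n t))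
          \<le> \<epsilon> + (2 * C) * \<epsilon> + (2 * C) * \<epsilon>"
        using elim C(1) by (intro add_mono mult_left_mono) auto
      also have "\<dots> = e / 2" using \<epsilon>_e by (simp add: algebra_simps)
      also have "\<dots> < e" using e by simp
      finally show ?case .
    qed
    then show "\<exists>no. \<forall>n\<ge>no. norm ((\<integral>\<omega>. f (\<lambda>t\<in>J. D n t \<omega> + R n t \<omega>) \<partial>M) - (\<integral>\<omega>. f (\<lambda>t\<in>J. D n t \<omega>) \<partial>M) - 0) < e"
      by (simp add: eventually_sequentially)
  qed
  from tendsto_add[OF this conv[OF f bdd]] show ?thesis by simp
qed

text \<open>Off an event of small probability \<open>V n\<close> is close to \<open>c\<close>, where \<open>G\<close> is continuous; on that event
the bound \<open>C\<close> suffices.\<close>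
lemma (in prob_space) expectation_tendsto_in_prob:
  fixes V :: "nat \<Rightarrow> 'a \<Rightarrow> real" and G :: "real \<Rightarrow> real"
  assumes V [measurable]: "\<And>n. random_variable borel (V n)"
    and lim: "\<And>\<epsilon>. 0 < \<epsilon> \<Longrightarrow> (\<lambda>n. prob {\<omega> \<in> space M. \<epsilon> < \<bar>V n \<omega> - c\<bar>}) \<longlonglongrightarrow> 0"
    and G: "continuous_on UNIV G" and bound: "\<And>x. \<bar>G x\<bar> \<le> C"
  shows "(\<lambda>n. expectation (\<lambda>\<omega>. G (V n \<omega>))) \<longlonglongrightarrow> G c"
proof (rule LIMSEQ_I)
  fix r :: real assume r: "0 < r"
  have [measurable]: "G \<in> borel_measurable borel" using G by (rule borel_measurable_continuous_onI)
  have "isCont G c" using G by (simp add: continuous_on_eq_continuous_at)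
  then obtain d where d: "0 < d" "\<And>x. \<bar>x - c\<bar> < d \<Longrightarrow> \<bar>G x - G c\<bar> < r / 2"
    using r unfolding continuous_at_eps_delta dist_real_def by (metis half_gt_zero)
  have C: "0 \<le> C" using bound[of 0] by linarith
  define b where "b = (\<lambda>n. {\<omega> \<in> space M. d / 2 < \<bar>V n \<omega> - c\<bar>})"
  have b [measurable]: "b n \<in> events" for n unfolding b_def by measurable
  have "(\<lambda>n. 2 * C * prob (b n)) \<longlonglongrightarrow> 2 * C * 0"
    unfolding b_def using d(1) by (intro tendsto_mult tendsto_const lim) simp
  then have "\<forall>\<^sub>F n in sequentially. 2 * C * prob (b n) < r / 2"
    using r by (intro order_tendstoD) auto
  then have "\<forall>\<^sub>F n in sequentially. norm (expectation (\<lambda>\<omega>. G (V n \<omega>)) - G c) < r"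
  proof eventually_elim
    case (elim n)
    have i1: "integrable M (\<lambda>\<omega>. G (V n \<omega>))"
      using bound by (intro integrable_const_bound[where B=C]) auto
    have i2: "integrable M (indicator (b n) :: 'a \<Rightarrow> real)" by (simp add: emeasure_eq_measure)
    have "\<bar>expectation (\<lambda>\<omega>. G (V n \<omega>)) - G c\<bar> = \<bar>expectation (\<lambda>\<omega>. G (V n \<omega>) - G c)\<bar>"
      using i1 by (simp add: prob_space)
    also have "\<dots> \<le> expectation (\<lambda>\<omega>. \<bar>G (V n \<omega>) - G c\<bar>)" by (rule integral_abs_bound)
    also have "\<dots> \<le> expectation (\<lambda>\<omega>. r / 2 + 2 * C * indicator (b n) \<omega>)"
    proof (rule integral_mono)
      show "integrable M (\<lambda>\<omega>. \<bar>G (V n \<omega>) - G c\<bar>)" using i1 by auto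
      show "integrable M (\<lambda>\<omega>. r / 2 + 2 * C * indicator (b n) \<omega>)" using i2 by auto
      fix \<omega> assume w: "\<omega> \<in> space M"
      show "\<bar>G (V n \<omega>) - G c\<bar> \<le> r / 2 + 2 * C * indicator (b n) \<omega>"
      proof (cases "\<omega> \<in> b n")
        case True
        then show ?thesis using bound[of "V n \<omega>"] bound[of c] r by simp
      next
        case False
        then have "\<bar>V n \<omega> - c\<bar> < d" using w d(1) by (simp add: b_def)
        from d(2)[OF this] False show ?thesis by simp
      qed
    qed
    also have "\<dots> = r / 2 + 2 * C * prob (b n)" using i2 by (simp add: prob_space)
    also have "\<dots> < r" using elim by simp
    finally show ?case by simp
  qed
  then show "\<exists>no. \<forall>n\<ge>no. norm (expectation (\<lambda>\<omega>. G (V n \<omega>)) - G c) < r"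
    by (simp add: eventually_sequentially)
qed

lemma (in prob_space) tail_probability_tendsto:
  fixes Z :: "'a \<Rightarrow> real"
  assumes Z [measurable]: "random_variable borel Z" and c: "filterlim c at_top sequentially"
  shows "(\<lambda>n. prob {\<omega> \<in> space M. c n < \<bar>Z \<omega>\<bar>}) \<longlonglongrightarrow> 0"
proof -
  have "(\<lambda>n. expectation (indicator {\<omega> \<in> space M. c n < \<bar>Z \<omega>\<bar>})) \<longlonglongrightarrow> expectation (\<lambda>_. 0 :: real)"
  proof (rule integral_dominated_convergence[where w="\<lambda>_. 1"])
    show "AE \<omega> in M. (\<lambda>n. indicator {\<omega> \<in> space M. c n < \<bar>Z \<omega>\<bar>} \<omega> :: real) \<longlonglongrightarrow> 0"
    proof (intro AE_I2 tendsto_eventually)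
      fix \<omega>
      have "\<forall>\<^sub>F n in sequentially. \<bar>Z \<omega>\<bar> \<le> c n" using c by (simp add: filterlim_at_top)
      then show "\<forall>\<^sub>F n in sequentially. indicator {\<omega> \<in> space M. c n < \<bar>Z \<omega>\<bar>} \<omega> = (0 :: real)"
        by eventually_elim simp
    qed
  qed (auto simp: indicator_def)
  then show ?thesis by simp
qed

section \<open>A weak law of large numbers for inverse-square singularities\<close>

text \<open>The mixed terms vanish because independent centred variables are orthogonal.\<close>
lemma (in prob_space) second_moment_sum_indep_centred:
  fixes W :: "'i \<Rightarrow> 'a \<Rightarrow> real"
  assumes "finite I" "indep_vars (\<lambda>_. borel) W I"
    and "\<And>i. i \<in> I \<Longrightarrow> integrable M (\<lambda>\<omega>. (W i \<omega>)\<^sup>2)" "\<And>i. i \<in> I \<Longrightarrow> expectation (W i) = 0"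
  shows "integrable M (\<lambda>\<omega>. (\<Sum>i\<in>I. W i \<omega>)\<^sup>2) \<and>
    expectation (\<lambda>\<omega>. (\<Sum>i\<in>I. W i \<omega>)\<^sup>2) = (\<Sum>i\<in>I. expectation (\<lambda>\<omega>. (W i \<omega>)\<^sup>2))"
  using assms
proof (induction I rule: finite_induct)
  case (insert x F)
  have rv [measurable]: "random_variable borel (W i)" if "i \<in> insert x F" for i
    using insert.prems(1) that by (auto simp: indep_vars_def)
  define S where "S = (\<lambda>\<omega>. \<Sum>i\<in>F. W i \<omega>)"
  have ind: "indep_var borel (W x) borel S"
    unfolding S_def using insert.hyps insert.prems(1) by (intro indep_vars_sum) auto
  then have [measurable]: "random_variable borel S" by (rule indep_var_rv2)
  have IH: "integrable M (\<lambda>\<omega>. (S \<omega>)\<^sup>2)"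
     "expectation (\<lambda>\<omega>. (S \<omega>)\<^sup>2) = (\<Sum>i\<in>F. expectation (\<lambda>\<omega>. (W i \<omega>)\<^sup>2))"
    using insert.IH indep_vars_subset[OF insert.prems(1)] insert.prems(2,3) unfolding S_def by auto
  have i1: "integrable M (W i)" if "i \<in> insert x F" for i
    by (rule square_integrable_imp_integrable[OF rv[OF that] insert.prems(2)[OF that]])
  have iS: "integrable M S" unfolding S_def using i1 by auto
  have ix: "integrable M (W x)" by (rule i1) simp
  have cross: "integrable M (\<lambda>\<omega>. W x \<omega> * S \<omega>)" by (rule indep_var_integrable[OF ind ix iS])
  have "expectation (\<lambda>\<omega>. W x \<omega> * S \<omega>) = expectation (W x) * expectation S"
    by (rule indep_var_lebesgue_integral[OF ind ix iS])
  then have c0: "expectation (\<lambda>\<omega>. W x \<omega> * S \<omega>) = 0" using insert.prems(3)[of x] by simp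
  have eq: "(\<lambda>\<omega>. (\<Sum>i\<in>insert x F. W i \<omega>)\<^sup>2) = (\<lambda>\<omega>. ((W x \<omega>)\<^sup>2 + 2 * (W x \<omega> * S \<omega>)) + (S \<omega>)\<^sup>2)"
    using insert.hyps by (simp add: fun_eq_iff S_def power2_sum algebra_simps)
  have int2: "integrable M (\<lambda>\<omega>. (W x \<omega>)\<^sup>2)" using insert.prems(2) by simp
  show ?case
    unfolding eq using int2 IH cross c0 insert.hyps by simp
qed simp

text \<open>Feller's truncation method, with a truncation set \<open>T N\<close> that depends on the number of summands: with high probability no
summand is cut off (\<open>escape\<close>), the means of the truncated sums have the required limit (\<open>mean\<close>), and
Chebyshev's inequality bounds the fluctuations through the truncated second moments (\<open>var\<close>).\<close>
lemma (in prob_space) weak_law_truncated: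
  fixes A :: "nat \<Rightarrow> 'a \<Rightarrow> real" and g :: "real \<Rightarrow> real"
  assumes ind: "indep_vars (\<lambda>_. borel) A {1..}"
    and law: "\<And>j. 1 \<le> j \<Longrightarrow> distr M borel (A j) = L"
    and g [measurable]: "g \<in> borel_measurable borel" and T [measurable]: "\<And>N. T N \<in> sets borel"
    and sq: "\<And>N. integrable L (\<lambda>x. (g x * indicator (T N) x)\<^sup>2)"
    and b: "\<forall>\<^sub>F N in sequentially. 0 < b N"
    and escape: "(\<lambda>N. real N * measure L (- T N)) \<longlonglongrightarrow> 0"
    and mean: "(\<lambda>N. real N * (\<integral>x. g x * indicator (T N) x \<partial>L) / b N) \<longlonglongrightarrow> c"
    and var: "(\<lambda>N. real N * (\<integral>x. (g x * indicator (T N) x)\<^sup>2 \<partial>L) / (b N)\<^sup>2) \<longlonglongrightarrow> 0"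
    and "0 < \<epsilon>"
  shows "(\<lambda>N. prob {\<omega> \<in> space M. \<epsilon> < \<bar>(\<Sum>j=1..N. g (A j \<omega>)) / b N - c\<bar>}) \<longlonglongrightarrow> 0"
proof -
  have rv [measurable]: "random_variable borel (A j)" if "1 \<le> j" for j
    using ind that by (auto simp: indep_vars_def)
  have L: "prob_space L" using prob_space_distr[OF rv[of 1]] law[of 1] by simp
  interpret L: prob_space L by (rule L)
  have setsL: "sets L = sets borel" using sets_distr[of M borel "A 1"] unfolding law[of 1, OF order_refl] .
  define k where "k = (\<lambda>N x. g x * indicator (T N) x)"
  have k [measurable]: "k N \<in> borel_measurable borel" for N unfolding k_def by measurable
  have kL [measurable]: "k N \<in> borel_measurable L" for N using k[of N] unfolding measurable_cong_sets[OF setsL refl] .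
  have sq': "integrable L (\<lambda>x. (k N x)\<^sup>2)" for N using sq[of N] by (simp only: k_def)
  define q where "q = (\<lambda>N. \<integral>x. (k N x)\<^sup>2 \<partial>L)"
  define \<mu> where "\<mu> = (\<lambda>N. \<integral>x. k N x \<partial>L)"
  have transfer: "expectation (\<lambda>\<omega>. h (A j \<omega>)) = (\<integral>x. h x \<partial>L)"
    if "1 \<le> j" "h \<in> borel_measurable borel" for j and h :: "real \<Rightarrow> real"
    using integral_distr[OF rv[OF that(1)] that(2)] unfolding law[OF that(1)] by (rule sym)
  have transfer_int: "integrable M (\<lambda>\<omega>. h (A j \<omega>)) \<longleftrightarrow> integrable L h"
    if "1 \<le> j" "h \<in> borel_measurable borel" for j and h :: "real \<Rightarrow> real"
    using integrable_distr_eq[OF rv[OF that(1)] that(2)] unfolding law[OF that(1)] by (rule sym)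
  have int1: "integrable L (k N)" for N
    by (rule L.square_integrable_imp_integrable[OF kL sq'])
  have chebyshev: "prob {\<omega> \<in> space M. \<epsilon> * b N / 2 \<le> \<bar>\<Sum>j=1..N. k N (A j \<omega>) - \<mu> N\<bar>}
      \<le> real N * q N / (\<epsilon> * b N / 2)\<^sup>2" if bN: "0 < b N" for N
  proof -
    define W where "W = (\<lambda>j \<omega>. k N (A j \<omega>) - \<mu> N)"
    have W_eq: "W j = (\<lambda>\<omega>. (\<lambda>x. k N x - \<mu> N) (A j \<omega>))" for j by (simp add: W_def)
    have indW: "indep_vars (\<lambda>_. borel) W {1..N}"
      unfolding W_eq by (rule indep_vars_compose2[OF indep_vars_subset[OF ind]]) auto
    have E0: "expectation (W j) = 0" if "j \<in> {1..N}" for j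
      unfolding W_eq using that int1[of N] by (subst transfer) (auto simp: \<mu>_def L.prob_space)
    have ex: "(k N x - \<mu> N)\<^sup>2
         = (k N x)\<^sup>2 - 2 * \<mu> N * (k N x) + (\<mu> N)\<^sup>2" for x
      by (simp add: power2_diff)
    have I2L: "integrable L (\<lambda>x. (k N x - \<mu> N)\<^sup>2)"
      unfolding ex using sq'[of N] int1[of N] by auto
    have I2: "integrable M (\<lambda>\<omega>. (W j \<omega>)\<^sup>2)" if "j \<in> {1..N}" for j
      unfolding W_eq using that I2L by (subst transfer_int[of j "\<lambda>x. (k N x - \<mu> N)\<^sup>2"]) auto
    have E2: "expectation (\<lambda>\<omega>. (W j \<omega>)\<^sup>2) \<le> q N" if "j \<in> {1..N}" for j
    proof -
      have "expectation (\<lambda>\<omega>. (W j \<omega>)\<^sup>2) = (\<integral>x. (k N x - \<mu> N)\<^sup>2 \<partial>L)"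
        unfolding W_eq using that by (subst transfer[of j "\<lambda>x. (k N x - \<mu> N)\<^sup>2"]) auto
      also have "\<dots> = q N - (\<mu> N)\<^sup>2"
        unfolding ex q_def using sq'[of N] int1[of N]
        by (simp add: L.prob_space \<mu>_def power2_eq_square)
      finally show ?thesis by simp
    qed
    have S: "integrable M (\<lambda>\<omega>. (\<Sum>j=1..N. W j \<omega>)\<^sup>2)"
      "expectation (\<lambda>\<omega>. (\<Sum>j=1..N. W j \<omega>)\<^sup>2) = (\<Sum>j=1..N. expectation (\<lambda>\<omega>. (W j \<omega>)\<^sup>2))"
      using second_moment_sum_indep_centred[OF _ indW I2 E0] by auto
    have rvW: "random_variable borel (W j)" if "j \<in> {1..N}" for j
      unfolding W_eq using that by simp
    have sumrv: "random_variable borel (\<lambda>\<omega>. \<Sum>j=1..N. W j \<omega>)"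
      using rvW by (rule borel_measurable_sum)
    have "expectation (\<lambda>\<omega>. \<Sum>j=1..N. W j \<omega>) = (\<Sum>j=1..N. expectation (W j))"
      by (intro Bochner_Integration.integral_sum square_integrable_imp_integrable[OF rvW I2])
    then have m: "expectation (\<lambda>\<omega>. \<Sum>j=1..N. W j \<omega>) = 0" using E0 by simp
    have pos: "0 < \<epsilon> * b N / 2" using bN \<open>0 < \<epsilon>\<close> by simp
    have "prob {\<omega> \<in> space M. \<epsilon> * b N / 2 \<le> \<bar>\<Sum>j=1..N. W j \<omega>\<bar>}
        \<le> expectation (\<lambda>\<omega>. (\<Sum>j=1..N. W j \<omega>)\<^sup>2) / (\<epsilon> * b N / 2)\<^sup>2"
      using Chebyshev_inequality[OF sumrv S(1) pos] unfolding m by simp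
    also have "\<dots> \<le> (real N * q N) / (\<epsilon> * b N / 2)\<^sup>2"
    proof (rule divide_right_mono)
      show "expectation (\<lambda>\<omega>. (\<Sum>j=1..N. W j \<omega>)\<^sup>2) \<le> real N * q N"
        using sum_bounded_above[of "{1..N}", OF E2] unfolding S(2) by simp
    qed simp
    finally show ?thesis by (simp add: W_def)
  qed
  have tri: "\<epsilon> / 2 \<le> \<bar>u - v\<bar>" if "\<epsilon> < \<bar>u\<bar>" "\<bar>v\<bar> < \<epsilon> / 2" for u v :: real
    using that by linarith
  have union: "prob (\<Union>j\<in>{1..N}. {\<omega> \<in> space M. A j \<omega> \<notin> T N}) \<le> real N * measure L (- T N)" for N
  proof -
    have "prob (\<Union>j\<in>{1..N}. {\<omega> \<in> space M. A j \<omega> \<notin> T N}) \<le> (\<Sum>j\<in>{1..N}. prob {\<omega> \<in> space M. A j \<omega> \<notin> T N})"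
      by (intro finite_measure_subadditive_finite) auto
    also have "\<dots> = (\<Sum>j\<in>{1..N}. measure L (- T N))"
    proof (rule sum.cong[OF refl])
      fix j assume "j \<in> {1..N}"
      then have j: "1 \<le> j" by simp
      have "{\<omega> \<in> space M. A j \<omega> \<notin> T N} = A j -` (- T N) \<inter> space M" by auto
      then show "prob {\<omega> \<in> space M. A j \<omega> \<notin> T N} = measure L (- T N)"
        unfolding law[OF j, symmetric] using rv[OF j] by (subst measure_distr) auto
    qed
    finally show ?thesis by simp
  qed
  have lim: "(\<lambda>N. real N * measure L (- T N) + (4 / \<epsilon>\<^sup>2) * (real N * q N / (b N)\<^sup>2)) \<longlonglongrightarrow> 0 + (4 / \<epsilon>\<^sup>2) * 0"
    using escape var unfolding q_def k_def by (intro tendsto_intros)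
  show ?thesis
  proof (rule tendsto_sandwich[OF _ _ tendsto_const])
    show "(\<lambda>N. real N * measure L (- T N) + (4 / \<epsilon>\<^sup>2) * (real N * q N / (b N)\<^sup>2)) \<longlonglongrightarrow> 0"
      using lim by simp
    have "\<forall>\<^sub>F N in sequentially. \<bar>real N * \<mu> N / b N - c\<bar> < \<epsilon> / 2"
      using tendstoD[OF mean, of "\<epsilon> / 2"] \<open>0 < \<epsilon>\<close> by (simp add: \<mu>_def k_def dist_real_def)
    with b show "\<forall>\<^sub>F N in sequentially. prob {\<omega> \<in> space M. \<epsilon> < \<bar>(\<Sum>j=1..N. g (A j \<omega>)) / b N - c\<bar>}
        \<le> real N * measure L (- T N) + (4 / \<epsilon>\<^sup>2) * (real N * q N / (b N)\<^sup>2)"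
    proof eventually_elim
      case (elim N)
      let ?U = "\<Union>j\<in>{1..N}. {\<omega> \<in> space M. A j \<omega> \<notin> T N}"
      let ?V = "{\<omega> \<in> space M. \<epsilon> * b N / 2 \<le> \<bar>\<Sum>j=1..N. k N (A j \<omega>) - \<mu> N\<bar>}"
      have ms: "?U \<in> events" "?V \<in> events" by measurable
      have "{\<omega> \<in> space M. \<epsilon> < \<bar>(\<Sum>j=1..N. g (A j \<omega>)) / b N - c\<bar>} \<subseteq> ?U \<union> ?V"
      proof
        fix \<omega> assume w: "\<omega> \<in> {\<omega> \<in> space M. \<epsilon> < \<bar>(\<Sum>j=1..N. g (A j \<omega>)) / b N - c\<bar>}"
        show "\<omega> \<in> ?U \<union> ?V"
        proof (cases "\<forall>j\<in>{1..N}. A j \<omega> \<in> T N")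
          case True
          have "(\<Sum>j=1..N. k N (A j \<omega>) - \<mu> N) = (\<Sum>j=1..N. g (A j \<omega>)) - real N * \<mu> N"
            using True by (simp add: sum_subtractf k_def)
          also have "\<dots> = b N * (((\<Sum>j=1..N. g (A j \<omega>)) / b N - c) - (real N * \<mu> N / b N - c))"
            using elim(1) by (simp add: field_simps)
          finally have "\<bar>\<Sum>j=1..N. k N (A j \<omega>) - \<mu> N\<bar>
              = b N * \<bar>((\<Sum>j=1..N. g (A j \<omega>)) / b N - c) - (real N * \<mu> N / b N - c)\<bar>"
            using elim(1) by (simp add: abs_mult)
          moreover have "\<epsilon> < \<bar>(\<Sum>j=1..N. g (A j \<omega>)) / b N - c\<bar>" using w by blast
          then have "\<epsilon> / 2 \<le> \<bar>((\<Sum>j=1..N. g (A j \<omega>)) / b N - c) - (real N * \<mu> N / b N - c)\<bar>"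
            using elim(2) by (rule tri)
          ultimately have "\<epsilon> * b N / 2 \<le> \<bar>\<Sum>j=1..N. k N (A j \<omega>) - \<mu> N\<bar>"
            using elim(1) by (simp add: mult.commute mult_left_mono)
          then show ?thesis using w by simp
        qed (use w in auto)
      qed
      then have "prob {\<omega> \<in> space M. \<epsilon> < \<bar>(\<Sum>j=1..N. g (A j \<omega>)) / b N - c\<bar>} \<le> prob (?U \<union> ?V)"
        using ms by (intro finite_measure_mono) auto
      also have "\<dots> \<le> prob ?U + prob ?V" using ms by (rule measure_Un_le)
      also have "\<dots> \<le> real N * measure L (- T N) + real N * q N / (\<epsilon> * b N / 2)\<^sup>2"
        using union chebyshev[OF elim(1)] by (intro add_mono) auto
      finally show ?case by (simp add: power_divide power_mult_distrib field_simps)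
    qed
  qed auto
qed

lemma reciprocal_integral_near_1:
  assumes "a \<le> b" "b < 1"
  shows "integrable lborel (\<lambda>x. 1 / (1 - x) * indicator {a..b} x)"
    and "(\<integral>x. 1 / (1 - x) * indicator {a..b} x \<partial>lborel) = ln (1 - a) - ln (1 - b :: real)"
proof -
  have "has_bochner_integral lborel (\<lambda>x. 1 / (1 - x) * indicator {a..b} x) (- ln (1 - b) - (- ln (1 - a)))"
    using assms by (intro has_bochner_integral_FTC_Icc_real)
      (auto intro!: derivative_eq_intros continuous_intros)
  then show "integrable lborel (\<lambda>x. 1 / (1 - x) * indicator {a..b} x)"
    "(\<integral>x. 1 / (1 - x) * indicator {a..b} x \<partial>lborel) = ln (1 - a) - ln (1 - b :: real)"
    by (auto simp: has_bochner_integral_iff)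
qed

text \<open>The truncation keeps a distance \<open>\<eta>\<close> from the pole at 1.\<close>
lemma integrable_over_pole:
  fixes \<phi> :: "real \<Rightarrow> real"
  assumes "integrable lborel \<phi>" and "0 < \<eta>"
  shows "integrable lborel (\<lambda>x. \<phi> x / (1 - x) * indicator {..1 - \<eta>} x)"
proof (rule Bochner_Integration.integrable_bound)
  show "integrable lborel (\<lambda>x. \<phi> x / \<eta>)" using assms(1) by simp
  show "(\<lambda>x. \<phi> x / (1 - x) * indicator {..1 - \<eta>} x) \<in> borel_measurable lborel"
    using assms(1) by measurable
  show "AE x in lborel. norm (\<phi> x / (1 - x) * indicator {..1 - \<eta>} x) \<le> norm (\<phi> x / \<eta>)"
    using assms(2) by (auto simp: indicator_def intro!: frac_le)
qed

text \<open>Near 1 the function \<open>\<phi>\<close> lies between \<open>\<psi>1 - \<epsilon>\<close> and \<open>\<psi>1 + \<epsilon>\<close>, and the integral of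
\<open>1 / (1 - x)\<close> over \<open>{1 - \<delta>..1 - \<eta>}\<close> is \<open>ln \<delta> - ln \<eta>\<close>; away from 1 the integral is bounded
by \<open>K\<close>, independently of \<open>\<eta>\<close>.\<close>
lemma truncated_mean_bounds:
  fixes \<phi> :: "real \<Rightarrow> real"
  assumes int: "integrable lborel \<phi>" and nn: "\<And>x. 0 \<le> \<phi> x"
    and lim: "(\<phi> \<longlongrightarrow> \<psi>1) (at_left 1)" and "0 < \<epsilon>"
  obtains K \<delta> where "0 < \<delta>" "\<And>x. 1 - \<delta> \<le> x \<Longrightarrow> x < 1 \<Longrightarrow> \<phi> x \<le> \<psi>1 + \<epsilon>"
    "\<And>\<eta>. 0 < \<eta> \<Longrightarrow> \<eta> \<le> \<delta> \<Longrightarrow> (\<psi>1 - \<epsilon>) * (ln \<delta> - ln \<eta>) \<le> (\<integral>x. \<phi> x / (1 - x) * indicator {..1 - \<eta>} x \<partial>lborel)"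
    "\<And>\<eta>. 0 < \<eta> \<Longrightarrow> \<eta> \<le> \<delta> \<Longrightarrow> (\<integral>x. \<phi> x / (1 - x) * indicator {..1 - \<eta>} x \<partial>lborel) \<le> K + (\<psi>1 + \<epsilon>) * (ln \<delta> - ln \<eta>)"
proof -
  have "\<forall>\<^sub>F x in at_left 1. dist (\<phi> x) \<psi>1 < \<epsilon>" using lim \<open>0 < \<epsilon>\<close> by (rule tendstoD)
  then obtain d where d: "d < 1" "\<And>x. d < x \<Longrightarrow> x < 1 \<Longrightarrow> dist (\<phi> x) \<psi>1 < \<epsilon>"
    by (auto simp: eventually_at_left_field)
  \<comment> \<open>Half the distance, so that the closed end point 1 - \<delta> is included.\<close>
  define \<delta> where "\<delta> = (1 - d) / 2"
  have \<delta>: "0 < \<delta>" using d(1) by (simp add: \<delta>_def)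
  have near: "\<psi>1 - \<epsilon> \<le> \<phi> x" "\<phi> x \<le> \<psi>1 + \<epsilon>" if "1 - \<delta> \<le> x" "x < 1" for x
  proof -
    have "2 * \<delta> = 1 - d" by (simp add: \<delta>_def)
    then have "d < x" using that \<delta> by linarith
    from d(2)[OF this that(2)] show "\<psi>1 - \<epsilon> \<le> \<phi> x" "\<phi> x \<le> \<psi>1 + \<epsilon>"
      by (auto simp: dist_real_def)
  qed
  define K where "K = (\<integral>x. \<phi> x / \<delta> \<partial>lborel)"
  have lower: "(\<psi>1 - \<epsilon>) * (ln \<delta> - ln \<eta>) \<le> (\<integral>x. \<phi> x / (1 - x) * indicator {..1 - \<eta>} x \<partial>lborel)"
    if \<eta>: "0 < \<eta>" "\<eta> \<le> \<delta>" for \<eta>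
  proof -
    note I = reciprocal_integral_near_1[of "1 - \<delta>" "1 - \<eta>"]
    have "(\<psi>1 - \<epsilon>) * (ln \<delta> - ln \<eta>) = (\<integral>x. (\<psi>1 - \<epsilon>) * (1 / (1 - x) * indicator {1 - \<delta>..1 - \<eta>} x) \<partial>lborel)"
      using I \<eta> by (subst integral_mult_right_zero) simp
    also have "\<dots> \<le> (\<integral>x. \<phi> x / (1 - x) * indicator {..1 - \<eta>} x \<partial>lborel)"
    proof (rule integral_mono)
      show "integrable lborel (\<lambda>x. (\<psi>1 - \<epsilon>) * (1 / (1 - x) * indicator {1 - \<delta>..1 - \<eta>} x))"
        using I(1) \<eta> by (intro integrable_mult_right) auto
      show "integrable lborel (\<lambda>x. \<phi> x / (1 - x) * indicator {..1 - \<eta>} x)"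
        by (rule integrable_over_pole[OF int \<eta>(1)])
      fix x :: real
      show "(\<psi>1 - \<epsilon>) * (1 / (1 - x) * indicator {1 - \<delta>..1 - \<eta>} x) \<le> \<phi> x / (1 - x) * indicator {..1 - \<eta>} x"
        using near(1)[of x] nn[of x] \<eta> by (auto simp: indicator_def intro!: divide_right_mono)
    qed
    finally show ?thesis .
  qed
  have upper: "(\<integral>x. \<phi> x / (1 - x) * indicator {..1 - \<eta>} x \<partial>lborel) \<le> K + (\<psi>1 + \<epsilon>) * (ln \<delta> - ln \<eta>)"
    if \<eta>: "0 < \<eta>" "\<eta> \<le> \<delta>" for \<eta>
  proof -
    note I = reciprocal_integral_near_1[of "1 - \<delta>" "1 - \<eta>"]
    have i2: "integrable lborel (\<lambda>x. (\<psi>1 + \<epsilon>) * (1 / (1 - x) * indicator {1 - \<delta>..1 - \<eta>} x))"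
      using I(1) \<eta> by (intro integrable_mult_right) auto
    have i1: "integrable lborel (\<lambda>x. \<phi> x / \<delta>)" using int by simp
    have "(\<integral>x. \<phi> x / (1 - x) * indicator {..1 - \<eta>} x \<partial>lborel)
        \<le> (\<integral>x. \<phi> x / \<delta> + (\<psi>1 + \<epsilon>) * (1 / (1 - x) * indicator {1 - \<delta>..1 - \<eta>} x) \<partial>lborel)"
    proof (rule integral_mono)
      show "integrable lborel (\<lambda>x. \<phi> x / (1 - x) * indicator {..1 - \<eta>} x)"
        by (rule integrable_over_pole[OF int \<eta>(1)])
      show "integrable lborel (\<lambda>x. \<phi> x / \<delta> + (\<psi>1 + \<epsilon>) * (1 / (1 - x) * indicator {1 - \<delta>..1 - \<eta>} x))"
        using i1 i2 by (rule Bochner_Integration.integrable_add)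
      fix x :: real
      show "\<phi> x / (1 - x) * indicator {..1 - \<eta>} x \<le> \<phi> x / \<delta> + (\<psi>1 + \<epsilon>) * (1 / (1 - x) * indicator {1 - \<delta>..1 - \<eta>} x)"
      proof (cases "x \<le> 1 - \<eta>")
        case le: True
        show ?thesis
        proof (cases "1 - \<delta> \<le> x")
          case True
          have "\<phi> x / (1 - x) \<le> (\<psi>1 + \<epsilon>) / (1 - x)"
            using near(2)[OF True] le \<eta> by (intro divide_right_mono) auto
          moreover have "0 \<le> \<phi> x / \<delta>" using nn \<delta> by simp
          ultimately have "\<phi> x / (1 - x) \<le> \<phi> x / \<delta> + (\<psi>1 + \<epsilon>) / (1 - x)" by linarith
          then show ?thesis using True le by simp
        next
          case False
          then have "\<phi> x / (1 - x) \<le> \<phi> x / \<delta>" using nn \<delta> by (intro frac_le) auto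
          then show ?thesis using False le by simp
        qed
      next
        case False
        then show ?thesis using nn[of x] \<delta> by (simp add: indicator_def)
      qed
    qed
    also have "\<dots> = K + (\<psi>1 + \<epsilon>) * (ln \<delta> - ln \<eta>)"
    proof -
      have "(\<integral>x. (\<psi>1 + \<epsilon>) * (1 / (1 - x) * indicator {1 - \<delta>..1 - \<eta>} x) \<partial>lborel) = (\<psi>1 + \<epsilon>) * (ln \<delta> - ln \<eta>)"
        using I \<eta> by (subst integral_mult_right_zero) simp
      then show ?thesis using Bochner_Integration.integral_add[OF i1 i2] by (simp only: K_def)
    qed
    finally show ?thesis .
  qed
  from \<delta> near(2) lower upper show thesis by (rule that)
qed

text \<open>The coefficients within this distance of 1 are discarded. With \<open>Y = 1 / (1 - \<alpha>)\<^sup>2\<close> this truncates \<open>Y\<close>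
at a level of order \<open>N sqrt (ln N)\<close>, strictly between \<open>N\<close> and \<open>N ln N\<close> in order of magnitude: high
enough that the \<open>N\<close> copies escape truncation with probability tending to 1, and low enough that the
level times the truncated mean, which bounds the truncated second moment, contributes a variance that is
negligible against \<open>(N ln N)\<^sup>2\<close>. The shifts by 1 and 2 make it
positive for every \<open>N\<close>.\<close>
definition gap :: "nat \<Rightarrow> real" where
  "gap N = 1 / sqrt ((real N + 1) * sqrt (ln (real N + 2)))"

lemma gap_pos: "0 < gap N"
  by (simp add: gap_def)

lemma ln_gap: "- ln (gap N) = ln ((real N + 1) * sqrt (ln (real N + 2))) / 2"
  by (simp add: gap_def ln_div ln_sqrt)

text \<open>The logarithm of \<open>1 / gap N\<close> is asymptotic to \<open>ln N / 2\<close>, which is the origin of the factor one half in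
the limiting variance.\<close>
lemma truncated_mean_asymptotics:
  fixes \<phi> :: "real \<Rightarrow> real"
  assumes int: "integrable lborel \<phi>" and nn: "\<And>x. 0 \<le> \<phi> x"
    and lim: "(\<phi> \<longlongrightarrow> \<psi>1) (at_left 1)"
  shows "(\<lambda>N. (\<integral>x. \<phi> x / (1 - x) * indicator {..1 - gap N} x \<partial>lborel) / ln (real N)) \<longlonglongrightarrow> \<psi>1 / 2"
proof (rule LIMSEQ_I)
  fix r :: real assume r: "0 < r"
  define m where "m = (\<lambda>N. \<integral>x. \<phi> x / (1 - x) * indicator {..1 - gap N} x \<partial>lborel)"
  obtain K \<delta> where \<delta>: "0 < \<delta>" and "\<And>x. 1 - \<delta> \<le> x \<Longrightarrow> x < 1 \<Longrightarrow> \<phi> x \<le> \<psi>1 + r"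
    and lower: "\<And>\<eta>. 0 < \<eta> \<Longrightarrow> \<eta> \<le> \<delta> \<Longrightarrow> (\<psi>1 - r) * (ln \<delta> - ln \<eta>) \<le> (\<integral>x. \<phi> x / (1 - x) * indicator {..1 - \<eta>} x \<partial>lborel)"
    and upper: "\<And>\<eta>. 0 < \<eta> \<Longrightarrow> \<eta> \<le> \<delta> \<Longrightarrow> (\<integral>x. \<phi> x / (1 - x) * indicator {..1 - \<eta>} x \<partial>lborel) \<le> K + (\<psi>1 + r) * (ln \<delta> - ln \<eta>)"
    by (rule truncated_mean_bounds[OF int nn lim r]) blast
  have tri: "\<bar>q - \<psi>1 / 2\<bar> < r" if "(\<psi>1 - r) / 2 - r / 2 < q" "q < (\<psi>1 + r) / 2 + r / 2" for q
    using that by (simp add: abs_less_iff field_simps)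
  have "(\<lambda>N. gap N) \<longlonglongrightarrow> 0" unfolding gap_def by real_asymp
  then have small: "\<forall>\<^sub>F N in sequentially. gap N < \<delta>" using \<delta> by (rule order_tendstoD)
  have asymp: "(\<lambda>N. (k + a * (ln \<delta> + ln ((real N + 1) * sqrt (ln (real N + 2))) / 2)) / ln (real N)) \<longlonglongrightarrow> a / 2" for k a
    by real_asymp
  have "\<forall>\<^sub>F N in sequentially. (0 + (\<psi>1 - r) * (ln \<delta> + ln ((real N + 1) * sqrt (ln (real N + 2))) / 2)) / ln (real N) > (\<psi>1 - r) / 2 - r / 2"
    using r by (intro order_tendstoD(1)[OF asymp]) simp
  moreover have "\<forall>\<^sub>F N in sequentially. (K + (\<psi>1 + r) * (ln \<delta> + ln ((real N + 1) * sqrt (ln (real N + 2))) / 2)) / ln (real N) < (\<psi>1 + r) / 2 + r / 2"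
    using r by (intro order_tendstoD(2)[OF asymp]) simp
  ultimately have "\<forall>\<^sub>F N in sequentially. \<bar>m N / ln (real N) - \<psi>1 / 2\<bar> < r"
    using small eventually_ge_at_top[of 2]
  proof eventually_elim
    case (elim N)
    have lnN: "0 < ln (real N)" using elim(4) by simp
    note pos = gap_pos[of N]
    have e: "ln \<delta> - ln (gap N) = ln \<delta> + ln ((real N + 1) * sqrt (ln (real N + 2))) / 2" using ln_gap[of N] by simp
    have "(0 + (\<psi>1 - r) * (ln \<delta> + ln ((real N + 1) * sqrt (ln (real N + 2))) / 2)) / ln (real N) \<le> m N / ln (real N)"
      using lower[OF pos] elim(3) lnN unfolding e m_def by (intro divide_right_mono) auto
    moreover have "m N / ln (real N) \<le> (K + (\<psi>1 + r) * (ln \<delta> + ln ((real N + 1) * sqrt (ln (real N + 2))) / 2)) / ln (real N)"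
      using upper[OF pos] elim(3) lnN unfolding e m_def by (intro divide_right_mono) auto
    ultimately have "m N / ln (real N) > (\<psi>1 - r) / 2 - r / 2" "m N / ln (real N) < (\<psi>1 + r) / 2 + r / 2"
      using elim(1,2) by linarith+
    then show ?case by (rule tri)
  qed
  then show "\<exists>no. \<forall>N\<ge>no. norm ((\<integral>x. \<phi> x / (1 - x) * indicator {..1 - gap N} x \<partial>lborel) / ln (real N) - \<psi>1 / 2) < r"
    by (simp add: m_def eventually_sequentially)
qed

text \<open>The factor \<open>1 - x\<close> of the density cancels one of the two factors in the denominator of \<open>1 / (1 - x)\<^sup>2\<close>, so the truncated mean
is the logarithmically divergent integral of \<open>\<phi> x / (1 - x)\<close>. Both other conditions of
weak_law_truncated need only crude bounds: the probability of truncation is at most a constant times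
the square of the gap, and the truncated second moment is at most the truncation level times the truncated
mean.\<close>
lemma (in prob_space) heavy_tailed_weak_law:
  fixes A :: "nat \<Rightarrow> 'a \<Rightarrow> real" and \<phi> :: "real \<Rightarrow> real"
  assumes ind: "indep_vars (\<lambda>_. borel) A {1..}"
    and law: "\<And>j. 1 \<le> j \<Longrightarrow> distr M borel (A j) = density lborel (\<lambda>x. ennreal (\<phi> x * (1 - x)))"
    and int: "integrable lborel \<phi>" and nn: "\<And>x. 0 \<le> \<phi> x" and supp: "\<And>x. 1 \<le> x \<Longrightarrow> \<phi> x = 0"
    and lim: "(\<phi> \<longlongrightarrow> \<psi>1) (at_left 1)" and "0 < \<psi>1" and "0 < \<epsilon>"
  shows "(\<lambda>N. prob {\<omega> \<in> space M. \<epsilon> < \<bar>(\<Sum>j=1..N. 1 / (1 - A j \<omega>)\<^sup>2) / (real N * ln (real N)) - \<psi>1 / 2\<bar>}) \<longlonglongrightarrow> 0"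
proof -
  define L where "L = density lborel (\<lambda>x. ennreal (\<phi> x * (1 - x)))"
  have [measurable]: "\<phi> \<in> borel_measurable borel" using int by simp
  have rv1: "random_variable borel (A 1)" using ind by (auto simp: indep_vars_def)
  have "prob_space L" using prob_space_distr[OF rv1] unfolding law[OF order_refl] L_def[symmetric] .
  then interpret L: prob_space L .
  have setsL [measurable_cong]: "sets L = sets borel" by (simp add: L_def)
  have dens_nn: "0 \<le> \<phi> x * (1 - x)" for x
    using nn[of x] supp[of x] by (cases "1 \<le> x") auto
  have intL: "(\<integral>x. h x \<partial>L) = (\<integral>x. \<phi> x * (1 - x) * h x \<partial>lborel)" if "h \<in> borel_measurable borel" for h :: "real \<Rightarrow> real"
    unfolding L_def using that dens_nn by (subst integral_real_density) auto
  define T where "T = (\<lambda>N. {..1 - gap N})"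
  define g where "g = (\<lambda>x::real. 1 / (1 - x)\<^sup>2)"
  define m where "m = (\<lambda>N. \<integral>x. \<phi> x / (1 - x) * indicator {..1 - gap N} x \<partial>lborel)"
  have g [measurable]: "g \<in> borel_measurable borel" unfolding g_def by measurable
  have T [measurable]: "T N \<in> sets borel" for N unfolding T_def by measurable
  have gT [measurable]: "(\<lambda>x. g x * indicator (T N) x) \<in> borel_measurable borel" for N by measurable
  have gT0: "0 \<le> g x * indicator (T N) x" for N x by (simp add: g_def)
  have gT_le: "g x * indicator (T N) x \<le> 1 / (gap N)\<^sup>2" for N x
  proof (cases "x \<in> T N")
    case True
    then have "gap N \<le> 1 - x" by (simp add: T_def)
    then have "1 / (1 - x)\<^sup>2 \<le> 1 / (gap N)\<^sup>2"
      using gap_pos[of N] by (intro frac_le power_mono) auto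
    then show ?thesis using True by (simp add: g_def)
  qed simp
  have mean: "(\<integral>x. g x * indicator (T N) x \<partial>L) = m N" for N
    unfolding m_def intL[OF gT]
  proof (intro Bochner_Integration.integral_cong refl)
    fix x show "\<phi> x * (1 - x) * (g x * indicator (T N) x) = \<phi> x / (1 - x) * indicator {..1 - gap N} x"
      by (cases "x = 1") (auto simp: g_def T_def power2_eq_square)
  qed
  have sq: "integrable L (\<lambda>x. (g x * indicator (T N) x)\<^sup>2)" for N
  proof (rule L.integrable_const_bound)
    show "AE x in L. norm ((g x * indicator (T N) x)\<^sup>2) \<le> (1 / (gap N)\<^sup>2)\<^sup>2"
      using gT0 gT_le by (intro AE_I2) (simp only: real_norm_def abs_power2, intro power_mono)
  qed measurable
  have int1: "integrable L (\<lambda>x. g x * indicator (T N) x)" for N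
  proof (rule L.integrable_const_bound)
    show "AE x in L. norm (g x * indicator (T N) x) \<le> 1 / (gap N)\<^sup>2"
      using gT0 gT_le by (intro AE_I2) (simp only: real_norm_def abs_of_nonneg)
  qed measurable
  have gap2: "1 / (gap N)\<^sup>2 = (real N + 1) * sqrt (ln (real N + 2))" for N
    by (simp add: gap_def power_divide)
  have gap2': "(gap N)\<^sup>2 = 1 / ((real N + 1) * sqrt (ln (real N + 2)))" for N
    by (simp add: gap_def power_divide)
  have ratio: "(\<lambda>N. m N / ln (real N)) \<longlonglongrightarrow> \<psi>1 / 2"
    unfolding m_def by (rule truncated_mean_asymptotics[OF int nn lim])
  obtain K \<delta> where \<delta>: "0 < \<delta>" and near: "\<And>x. 1 - \<delta> \<le> x \<Longrightarrow> x < 1 \<Longrightarrow> \<phi> x \<le> \<psi>1 + 1"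
    and "\<And>\<eta>. 0 < \<eta> \<Longrightarrow> \<eta> \<le> \<delta> \<Longrightarrow> (\<psi>1 - 1) * (ln \<delta> - ln \<eta>) \<le> (\<integral>x. \<phi> x / (1 - x) * indicator {..1 - \<eta>} x \<partial>lborel)"
    and "\<And>\<eta>. 0 < \<eta> \<Longrightarrow> \<eta> \<le> \<delta> \<Longrightarrow> (\<integral>x. \<phi> x / (1 - x) * indicator {..1 - \<eta>} x \<partial>lborel) \<le> K + (\<psi>1 + 1) * (ln \<delta> - ln \<eta>)"
    by (rule truncated_mean_bounds[OF int nn lim zero_less_one]) blast
  have escape_le: "measure L (- T N) \<le> (\<psi>1 + 1) * (gap N)\<^sup>2" if small: "gap N < \<delta>" for N
  proof -
    have "measure L (- T N) = (\<integral>x. indicator (- T N) x \<partial>L)" by (simp add: setsL)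
    also have "\<dots> = (\<integral>x. \<phi> x * (1 - x) * indicator (- T N) x \<partial>lborel)" by (rule intL) measurable
    also have "\<dots> \<le> (\<integral>x. ((\<psi>1 + 1) * gap N) * indicator {1 - gap N..1} x \<partial>lborel)"
    proof (rule integral_mono')
      show "integrable lborel (\<lambda>x. ((\<psi>1 + 1) * gap N) * indicator {1 - gap N..1} x)"
        by (intro integrable_mult_right integrable_real_indicator) (simp_all add: emeasure_lborel_Icc_eq)
      fix x :: real
      show "0 \<le> ((\<psi>1 + 1) * gap N) * indicator {1 - gap N..1} x"
        using gap_pos[of N] \<open>0 < \<psi>1\<close> by simp
      show "\<phi> x * (1 - x) * indicator (- T N) x \<le> ((\<psi>1 + 1) * gap N) * indicator {1 - gap N..1} x"
      proof (cases "1 - gap N < x \<and> x < 1")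
        case True
        then have "\<phi> x * (1 - x) \<le> (\<psi>1 + 1) * gap N"
          using near[of x] nn[of x] small by (intro mult_mono) auto
        then show ?thesis using True by (simp add: T_def)
      next
        case False
        then show ?thesis using supp[of x] gap_pos[of N] \<open>0 < \<psi>1\<close> by (auto simp: T_def)
      qed
    qed
    also have "\<dots> = (\<psi>1 + 1) * (gap N)\<^sup>2"
      using gap_pos[of N] by (simp add: power2_eq_square)
    finally show ?thesis .
  qed
  have gap_small: "\<forall>\<^sub>F N in sequentially. gap N < \<delta>"
  proof (rule order_tendstoD(2)[OF _ \<delta>])
    show "(\<lambda>N. gap N) \<longlonglongrightarrow> 0" unfolding gap_def by real_asymp
  qed
  have escape: "(\<lambda>N. real N * measure L (- T N)) \<longlonglongrightarrow> 0"
  proof (rule tendsto_sandwich[OF _ _ tendsto_const])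
    have "(\<lambda>N. (\<psi>1 + 1) * (real N * (1 / ((real N + 1) * sqrt (ln (real N + 2)))))) \<longlonglongrightarrow> (\<psi>1 + 1) * 0"
      by (intro tendsto_mult tendsto_const) real_asymp
    then show "(\<lambda>N. (\<psi>1 + 1) * (real N * (1 / ((real N + 1) * sqrt (ln (real N + 2)))))) \<longlonglongrightarrow> 0" by simp
    show "\<forall>\<^sub>F N in sequentially. real N * measure L (- T N) \<le> (\<psi>1 + 1) * (real N * (1 / ((real N + 1) * sqrt (ln (real N + 2)))))"
      using gap_small
    proof eventually_elim
      case (elim N)
      from mult_left_mono[OF escape_le[OF elim], of "real N"]
      show ?case by (simp add: gap2' mult_ac)
    qed
  qed simp
  have var: "(\<lambda>N. real N * (\<integral>x. (g x * indicator (T N) x)\<^sup>2 \<partial>L) / (real N * ln (real N))\<^sup>2) \<longlonglongrightarrow> 0"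
  proof (rule tendsto_sandwich[OF _ _ tendsto_const])
    have "(\<lambda>N. ((real N + 1) * sqrt (ln (real N + 2)) / (real N * ln (real N))) * (m N / ln (real N))) \<longlonglongrightarrow> 0 * (\<psi>1 / 2)"
    proof (rule tendsto_mult[OF _ ratio])
      show "(\<lambda>N. (real N + 1) * sqrt (ln (real N + 2)) / (real N * ln (real N))) \<longlonglongrightarrow> 0" by real_asymp
    qed
    then show "(\<lambda>N. ((real N + 1) * sqrt (ln (real N + 2)) / (real N * ln (real N))) * (m N / ln (real N))) \<longlonglongrightarrow> 0"
      by simp
    show "\<forall>\<^sub>F N in sequentially. real N * (\<integral>x. (g x * indicator (T N) x)\<^sup>2 \<partial>L) / (real N * ln (real N))\<^sup>2
        \<le> ((real N + 1) * sqrt (ln (real N + 2)) / (real N * ln (real N))) * (m N / ln (real N))"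
      using eventually_gt_at_top[of 0]
    proof eventually_elim
      case (elim N)
      have "(\<integral>x. (g x * indicator (T N) x)\<^sup>2 \<partial>L) \<le> (\<integral>x. 1 / (gap N)\<^sup>2 * (g x * indicator (T N) x) \<partial>L)"
      proof (rule integral_mono[OF sq])
        show "integrable L (\<lambda>x. 1 / (gap N)\<^sup>2 * (g x * indicator (T N) x))"
          by (rule integrable_mult_right[OF int1])
        fix x show "(g x * indicator (T N) x)\<^sup>2 \<le> 1 / (gap N)\<^sup>2 * (g x * indicator (T N) x)"
          unfolding power2_eq_square[of "g x * indicator (T N) x"] by (rule mult_right_mono[OF gT_le gT0])
      qed
      also have "\<dots> = 1 / (gap N)\<^sup>2 * m N" unfolding mean[symmetric] by (rule integral_mult_right_zero)
      finally have le: "(\<integral>x. (g x * indicator (T N) x)\<^sup>2 \<partial>L) \<le> (real N + 1) * sqrt (ln (real N + 2)) * m N"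
        unfolding gap2 .
      have "real N * (\<integral>x. (g x * indicator (T N) x)\<^sup>2 \<partial>L) / (real N * ln (real N))\<^sup>2
          \<le> real N * ((real N + 1) * sqrt (ln (real N + 2)) * m N) / (real N * ln (real N))\<^sup>2"
        by (intro divide_right_mono mult_left_mono le) auto
      also have "\<dots> = ((real N + 1) * sqrt (ln (real N + 2)) / (real N * ln (real N))) * (m N / ln (real N))"
        using elim by (simp add: power2_eq_square mult_ac)
      finally show ?case .
    qed
  qed simp
  have meanlim: "(\<lambda>N. real N * (\<integral>x. g x * indicator (T N) x \<partial>L) / (real N * ln (real N))) \<longlonglongrightarrow> \<psi>1 / 2"
  proof (rule Lim_transform_eventually[OF ratio])
    show "\<forall>\<^sub>F N in sequentially. m N / ln (real N) = real N * (\<integral>x. g x * indicator (T N) x \<partial>L) / (real N * ln (real N))"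
      using eventually_gt_at_top[of 0] by eventually_elim (simp add: mean)
  qed
  have bpos: "\<forall>\<^sub>F N in sequentially. 0 < real N * ln (real N)"
    using eventually_ge_at_top[of 2] by eventually_elim simp
  have "(\<lambda>N. prob {\<omega> \<in> space M. \<epsilon> < \<bar>(\<Sum>j=1..N. g (A j \<omega>)) / (real N * ln (real N)) - \<psi>1 / 2\<bar>}) \<longlonglongrightarrow> 0"
    using law L_def
    by (intro weak_law_truncated[OF ind _ g T sq bpos escape meanlim var \<open>0 < \<epsilon>\<close>]) simp
  then show ?thesis unfolding g_def .
qed

section \<open>Random mixtures of Gaussian sums and of Brownian motion\<close>

text \<open>The factor \<open>sqrt n\<close> normalises the increments over the grid of mesh \<open>1 / n\<close> to unit variance.\<close>
lemma wiener_increments_law: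
  fixes n :: nat
  assumes B: "standard_wiener P B" and n: "0 < n" and K: "0 < K"
  shows "distr P (PiM {..<K} (\<lambda>_. borel))
      (\<lambda>\<omega>. \<lambda>i\<in>{..<K}. c * (sqrt (real n) * (B (real (Suc i) / real n) \<omega> - B (real i / real n) \<omega>)))
    = PiM {..<K} (\<lambda>_. gaussian 0 (c\<^sup>2))"
proof -
  interpret P: prob_space P using B by (simp add: standard_wiener_def stochastic_process_def)
  define D where "D = (\<lambda>i \<omega>. B (real (Suc i) / real n) \<omega> - B (real i / real n) \<omega>)"
  have indD: "P.indep_vars (\<lambda>_. borel) D {..<K}"
  proof -
    have "\<forall>d (\<tau> :: nat \<Rightarrow> real). 0 \<le> \<tau> 0 \<and> (\<forall>i<d. \<tau> i < \<tau> (Suc i)) \<longrightarrow>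
        P.indep_vars (\<lambda>_. borel) (\<lambda>i \<omega>. B (\<tau> (Suc i)) \<omega> - B (\<tau> i) \<omega>) {..<d}"
      using B by (simp add: standard_wiener_def)
    from this[rule_format, of "\<lambda>i. real i / real n" K] n show ?thesis
      by (simp add: D_def divide_strict_right_mono)
  qed
  have lawD: "distr P borel (D i) = gaussian 0 (1 / real n)" for i
  proof -
    have "\<forall>s t. 0 \<le> s \<and> s < t \<longrightarrow> distr P borel (\<lambda>\<omega>. B t \<omega> - B s \<omega>) = gaussian 0 (t - s)"
      using B by (simp add: standard_wiener_def)
    from this[rule_format, of "real i / real n" "real (Suc i) / real n"] n show ?thesis
      by (simp add: D_def divide_strict_right_mono diff_divide_distrib[symmetric])
  qed
  have rvD: "P.random_variable borel (D i)" if "i < K" for i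
    using indD that by (auto simp: P.indep_vars_def)
  have law: "distr P borel (\<lambda>\<omega>. c * (sqrt (real n) * D i \<omega>)) = gaussian 0 (c\<^sup>2)" if "i < K" for i
  proof -
    have "P.indep_vars (\<lambda>_. borel) D {i}" using P.indep_vars_subset[OF indD] that by simp
    from P.distr_weighted_sum_gaussian[OF this lawD, of "\<lambda>_. c * sqrt (real n)"] n show ?thesis
      by (simp add: power_mult_distrib mult_ac)
  qed
  have "P.indep_vars (\<lambda>_. borel) (\<lambda>i \<omega>. c * (sqrt (real n) * D i \<omega>)) {..<K}"
    by (rule P.indep_vars_compose2[OF indD]) simp
  then have "distr P (PiM {..<K} (\<lambda>_. borel)) (\<lambda>\<omega>. \<lambda>i\<in>{..<K}. c * (sqrt (real n) * D i \<omega>))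
      = PiM {..<K} (\<lambda>i. distr P borel (\<lambda>\<omega>. c * (sqrt (real n) * D i \<omega>)))"
    using K rvD by (subst (asm) P.indep_vars_iff_distr_eq_PiM') auto
  also have "\<dots> = PiM {..<K} (\<lambda>_. gaussian 0 (c\<^sup>2))"
    using law by (intro PiM_cong) auto
  finally show ?thesis by (simp add: D_def)
qed


text \<open>For fixed weights, column sums of an independent Gaussian array are independent, and each is Gaussian
with the squared weights added up. Column 0 of the array is left free for the random weights of the next
lemma.\<close>
lemma (in prob_space) gaussian_column_sums_law:
  fixes Y :: "nat \<times> nat \<Rightarrow> 'a \<Rightarrow> real"
  assumes ind: "indep_vars (\<lambda>_. borel) Y (I \<times> {..K})"
    and law: "\<And>j i. j \<in> I \<Longrightarrow> i < K \<Longrightarrow> distr M borel (Y (j, Suc i)) = gaussian 0 v"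
    and "0 \<le> v" "0 < K"
  shows "distr M (PiM {..<K} (\<lambda>_. borel)) (\<lambda>\<omega>. \<lambda>i\<in>{..<K}. \<Sum>j\<in>I. c j * Y (j, Suc i) \<omega>)
    = PiM {..<K} (\<lambda>_. gaussian 0 (v * (\<Sum>j\<in>I. (c j)\<^sup>2)))"
proof -
  have rv: "random_variable borel (Y p)" if "p \<in> I \<times> {..K}" for p
    using ind that by (auto simp: indep_vars_def)
  have "indep_vars (\<lambda>i. PiM (I \<times> {Suc i}) (\<lambda>_. borel)) (\<lambda>i \<omega>. restrict (\<lambda>p. Y p \<omega>) (I \<times> {Suc i})) {..<K}"
    by (rule indep_vars_restrict[OF ind]) (auto simp: disjoint_family_on_def)
  then have "indep_vars (\<lambda>_. borel) (\<lambda>i \<omega>. (\<lambda>y. \<Sum>j\<in>I. c j * y (j, Suc i)) (restrict (\<lambda>p. Y p \<omega>) (I \<times> {Suc i}))) {..<K}"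
    by (rule indep_vars_compose2) (intro borel_measurable_sum borel_measurable_times borel_measurable_const measurable_component_singleton, auto)
  also have "(\<lambda>i \<omega>. (\<lambda>y. \<Sum>j\<in>I. c j * y (j, Suc i)) (restrict (\<lambda>p. Y p \<omega>) (I \<times> {Suc i})))
      = (\<lambda>i \<omega>. \<Sum>j\<in>I. c j * Y (j, Suc i) \<omega>)"
    by (intro ext sum.cong) auto
  finally have "distr M (PiM {..<K} (\<lambda>_. borel)) (\<lambda>\<omega>. \<lambda>i\<in>{..<K}. \<Sum>j\<in>I. c j * Y (j, Suc i) \<omega>)
      = PiM {..<K} (\<lambda>i. distr M borel (\<lambda>\<omega>. \<Sum>j\<in>I. c j * Y (j, Suc i) \<omega>))"
    using \<open>0 < K\<close> rv by (subst (asm) indep_vars_iff_distr_eq_PiM') auto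
  also have "\<dots> = PiM {..<K} (\<lambda>_. gaussian 0 (v * (\<Sum>j\<in>I. (c j)\<^sup>2)))"
  proof (intro PiM_cong refl)
    fix i assume i: "i \<in> {..<K}"
    have "indep_vars (\<lambda>_. borel) (\<lambda>j. Y (j, Suc i)) I"
    proof -
      have "indep_vars (\<lambda>j. PiM {(j, Suc i)} (\<lambda>_. borel)) (\<lambda>j \<omega>. restrict (\<lambda>p. Y p \<omega>) {(j, Suc i)}) I"
        using i by (intro indep_vars_restrict[OF ind]) (auto simp: disjoint_family_on_def)
      then have "indep_vars (\<lambda>_. borel) (\<lambda>j \<omega>. (\<lambda>y. y (j, Suc i)) (restrict (\<lambda>p. Y p \<omega>) {(j, Suc i)})) I"
        by (rule indep_vars_compose2) (rule measurable_component_singleton, simp)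
      then show ?thesis by simp
    qed
    from distr_weighted_sum_gaussian[OF this law \<open>0 \<le> v\<close>] i
    show "distr M borel (\<lambda>\<omega>. \<Sum>j\<in>I. c j * Y (j, Suc i) \<omega>) = gaussian 0 (v * (\<Sum>j\<in>I. (c j)\<^sup>2))" by simp
  qed
  finally show ?thesis .
qed

text \<open>The array \<open>Y\<close> carries the coefficients in column 0 and the innovations in the columns \<open>1..K\<close>.
Conditionally on column 0, the weighted column sums and the rescaled Brownian increments have the same
product law, namely the Gaussian one with the variance that belongs to these weights; integrating over
column 0 identifies the unconditional laws.\<close>
lemma (in prob_space) mixture_law:
  fixes Y :: "nat \<times> nat \<Rightarrow> 'a \<Rightarrow> real"
  assumes ind: "indep_vars (\<lambda>_. borel) Y (I \<times> {..K})"
    and law: "\<And>j i. j \<in> I \<Longrightarrow> i < K \<Longrightarrow> distr M borel (Y (j, Suc i)) = gaussian 0 v"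
    and "0 \<le> v" "0 < K" and I: "finite I"
    and w [measurable]: "w \<in> borel_measurable borel"
    and B: "standard_wiener P B" and n: "0 < (n::nat)"
  shows "distr M (PiM {..<K} (\<lambda>_. borel)) (\<lambda>\<omega>. \<lambda>i\<in>{..<K}. \<Sum>j\<in>I. w (Y (j, 0) \<omega>) * Y (j, Suc i) \<omega>)
    = distr (M \<Otimes>\<^sub>M P) (PiM {..<K} (\<lambda>_. borel))
       (\<lambda>p. \<lambda>i\<in>{..<K}. sqrt (v * (\<Sum>j\<in>I. (w (Y (j, 0) (fst p)))\<^sup>2))
          * (sqrt (real n) * (B (real (Suc i) / real n) (snd p) - B (real i / real n) (snd p))))"
    (is "?L = ?R")
proof (rule measure_eqI)
  interpret P: prob_space P using B by (simp add: standard_wiener_def stochastic_process_def)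
  have B_meas: "B t \<in> borel_measurable P" if "0 \<le> t" for t
    using B that by (simp add: standard_wiener_def stochastic_process_def)
  have [measurable]: "B (real i / real n) \<in> borel_measurable P" for i by (rule B_meas) simp
  have rv [measurable]: "random_variable borel (Y p)" if "p \<in> I \<times> {..K}" for p
    using ind that by (auto simp: indep_vars_def)
  define S where "S = PiM (I \<times> {0::nat}) (\<lambda>_. borel :: real measure)"
  define T where "T = PiM (I \<times> {1..K}) (\<lambda>_. borel :: real measure)"
  define a where "a = (\<lambda>\<omega>. restrict (\<lambda>p. Y p \<omega>) (I \<times> {0}))"
  define e where "e = (\<lambda>\<omega>. restrict (\<lambda>p. Y p \<omega>) (I \<times> {1..K}))"
  have "indep_var S a T e"
    unfolding S_def T_def a_def e_def by (rule indep_var_restrict[OF ind]) auto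
  then have a [measurable]: "a \<in> M \<rightarrow>\<^sub>M S" and e [measurable]: "e \<in> M \<rightarrow>\<^sub>M T"
    and ae: "distr M S a \<Otimes>\<^sub>M distr M T e = distr M (S \<Otimes>\<^sub>M T) (\<lambda>x. (a x, e x))"
    by (simp_all add: indep_var_distribution_eq)
  have aw [measurable]: "(\<lambda>y. w (y (j, 0))) \<in> borel_measurable S" if "j \<in> I" for j
    unfolding S_def using that by (intro measurable_compose[OF _ w] measurable_component_singleton) auto
  have ey [measurable]: "(\<lambda>x. x (j, Suc i)) \<in> borel_measurable T" if "j \<in> I" "i < K" for i j
    unfolding T_def using that by (intro measurable_component_singleton) auto
  define \<Phi> where "\<Phi> = (\<lambda>y x. \<lambda>i\<in>{..<K}. \<Sum>j\<in>I. w (y (j, 0::nat)) * x (j, Suc i) :: real)"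
  have \<Phi> [measurable]: "(\<lambda>p. \<Phi> (fst p) (snd p)) \<in> S \<Otimes>\<^sub>M T \<rightarrow>\<^sub>M PiM {..<K} (\<lambda>_. borel)"
    unfolding \<Phi>_def by (intro measurable_restrict borel_measurable_sum) measurable
  define s where "s = (\<lambda>y. sqrt (v * (\<Sum>j\<in>I. (w (y (j, 0::nat)))\<^sup>2)))"
  define \<Psi> where "\<Psi> = (\<lambda>c \<omega>'. \<lambda>i\<in>{..<K}. c * (sqrt (real n) * (B (real (Suc i) / real n) \<omega>' - B (real i / real n) \<omega>')) :: real)"
  have s [measurable]: "s \<in> borel_measurable S"
    unfolding s_def by measurable
  have \<Psi> [measurable]: "(\<lambda>p. \<Psi> (s (a (fst p))) (snd p)) \<in> M \<Otimes>\<^sub>M P \<rightarrow>\<^sub>M PiM {..<K} (\<lambda>_. borel)"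
    unfolding \<Psi>_def by (intro measurable_restrict) measurable
  have \<Psi>1 [measurable]: "\<Psi> c \<in> P \<rightarrow>\<^sub>M PiM {..<K} (\<lambda>_. borel)" for c
    unfolding \<Psi>_def by (intro measurable_restrict) measurable
  have L_eq: "(\<lambda>\<omega>. \<lambda>i\<in>{..<K}. \<Sum>j\<in>I. w (Y (j, 0) \<omega>) * Y (j, Suc i) \<omega>) = (\<lambda>\<omega>. \<Phi> (a \<omega>) (e \<omega>))"
    by (auto simp: \<Phi>_def a_def e_def fun_eq_iff intro!: sum.cong)
  have R_eq: "(\<lambda>p. \<lambda>i\<in>{..<K}. sqrt (v * (\<Sum>j\<in>I. (w (Y (j, 0) (fst p)))\<^sup>2))
          * (sqrt (real n) * (B (real (Suc i) / real n) (snd p) - B (real i / real n) (snd p))))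
      = (\<lambda>p. \<Psi> (s (a (fst p))) (snd p))"
    by (auto simp: \<Psi>_def s_def a_def fun_eq_iff)
  \<comment> \<open>The two conditional laws agree for each fixed value y of column 0.\<close>
  have cond: "emeasure (distr M T e) (\<Phi> y -` E \<inter> space T) = emeasure P (\<Psi> (s y) -` E \<inter> space P)"
    if E: "E \<in> sets (PiM {..<K} (\<lambda>_. borel))" and y: "y \<in> space S" for y E
  proof -
    have \<Phi>y [measurable]: "\<Phi> y \<in> T \<rightarrow>\<^sub>M PiM {..<K} (\<lambda>_. borel)"
      unfolding \<Phi>_def by (intro measurable_restrict borel_measurable_sum) measurable
    have "emeasure (distr M T e) (\<Phi> y -` E \<inter> space T) = emeasure (distr M (PiM {..<K} (\<lambda>_. borel)) (\<lambda>\<omega>. \<Phi> y (e \<omega>))) E"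
      using E emeasure_distr[of "\<Phi> y" "distr M T e" "PiM {..<K} (\<lambda>_. borel)" E]
      by (simp add: distr_distr[OF \<Phi>y e] comp_def)
    also have "(\<lambda>\<omega>. \<Phi> y (e \<omega>)) = (\<lambda>\<omega>. \<lambda>i\<in>{..<K}. \<Sum>j\<in>I. w (y (j, 0)) * Y (j, Suc i) \<omega>)"
      by (auto simp: \<Phi>_def e_def fun_eq_iff intro!: sum.cong)
    also have "distr M (PiM {..<K} (\<lambda>_. borel)) \<dots> = PiM {..<K} (\<lambda>_. gaussian 0 ((s y)\<^sup>2))"
      using \<open>0 \<le> v\<close> by (subst gaussian_column_sums_law[OF ind law \<open>0 \<le> v\<close> \<open>0 < K\<close>])
        (auto simp: s_def sum_nonneg)
    also have "\<dots> = distr P (PiM {..<K} (\<lambda>_. borel)) (\<Psi> (s y))"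
      unfolding \<Psi>_def by (rule wiener_increments_law[OF B n \<open>0 < K\<close>, symmetric])
    finally show ?thesis using E by (simp add: emeasure_distr)
  qed
  show "sets ?L = sets ?R" by simp
  fix E assume "E \<in> sets ?L"
  then have E [measurable]: "E \<in> sets (PiM {..<K} (\<lambda>_. borel))" by simp
  interpret Te: prob_space "distr M T e" by (rule prob_space_distr) simp
  have "emeasure ?L E = emeasure (distr M (S \<Otimes>\<^sub>M T) (\<lambda>x. (a x, e x))) ((\<lambda>p. \<Phi> (fst p) (snd p)) -` E \<inter> space (S \<Otimes>\<^sub>M T))"
    unfolding L_eq using measurable_sets[OF \<Phi> E]
    by (subst (1 2) emeasure_distr) (auto simp: measurable_compose[OF _ \<Phi>, of "\<lambda>x. (a x, e x)", simplified] intro!: arg_cong[where f="emeasure M"] dest: measurable_space[OF a] measurable_space[OF e] simp: space_pair_measure)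
  also have "\<dots> = (\<integral>\<^sup>+y. emeasure (distr M T e) (Pair y -` ((\<lambda>p. \<Phi> (fst p) (snd p)) -` E \<inter> space (S \<Otimes>\<^sub>M T))) \<partial>distr M S a)"
    unfolding ae[symmetric] using measurable_sets[OF \<Phi> E] by (intro Te.emeasure_pair_measure_alt) simp
  also have "\<dots> = (\<integral>\<^sup>+y. emeasure P (\<Psi> (s y) -` E \<inter> space P) \<partial>distr M S a)"
  proof (intro nn_integral_cong)
    fix y assume "y \<in> space (distr M S a)"
    then have y: "y \<in> space S" by simp
    have "Pair y -` ((\<lambda>p. \<Phi> (fst p) (snd p)) -` E \<inter> space (S \<Otimes>\<^sub>M T)) = \<Phi> y -` E \<inter> space T"
      using y by (auto simp: space_pair_measure)
    then show "emeasure (distr M T e) (Pair y -` ((\<lambda>p. \<Phi> (fst p) (snd p)) -` E \<inter> space (S \<Otimes>\<^sub>M T))) = emeasure P (\<Psi> (s y) -` E \<inter> space P)"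
      using cond[OF E y] by simp
  qed
  also have "\<dots> = (\<integral>\<^sup>+\<omega>. emeasure P (\<Psi> (s (a \<omega>)) -` E \<inter> space P) \<partial>M)"
  proof (rule nn_integral_distr[OF a])
    have "(\<lambda>p. \<Psi> (s (fst p)) (snd p)) \<in> S \<Otimes>\<^sub>M P \<rightarrow>\<^sub>M PiM {..<K} (\<lambda>_. borel)"
      unfolding \<Psi>_def by (intro measurable_restrict) measurable
    from P.measurable_emeasure_Pair[OF measurable_sets[OF this E]]
    have "(\<lambda>y. emeasure P (Pair y -` ((\<lambda>p. \<Psi> (s (fst p)) (snd p)) -` E \<inter> space (S \<Otimes>\<^sub>M P)))) \<in> borel_measurable S" .
    also have "?this \<longleftrightarrow> (\<lambda>y. emeasure P (\<Psi> (s y) -` E \<inter> space P)) \<in> borel_measurable S"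
      by (intro measurable_cong arg_cong[where f="emeasure P"]) (auto simp: space_pair_measure)
    finally show "(\<lambda>y. emeasure P (\<Psi> (s y) -` E \<inter> space P)) \<in> borel_measurable (distr M S a)" by simp
  qed
  also have "\<dots> = (\<integral>\<^sup>+\<omega>. emeasure P (Pair \<omega> -` ((\<lambda>p. \<Psi> (s (a (fst p))) (snd p)) -` E \<inter> space (M \<Otimes>\<^sub>M P))) \<partial>M)"
    by (intro nn_integral_cong arg_cong[where f="emeasure P"]) (auto simp: space_pair_measure)
  also have "\<dots> = emeasure (M \<Otimes>\<^sub>M P) ((\<lambda>p. \<Psi> (s (a (fst p))) (snd p)) -` E \<inter> space (M \<Otimes>\<^sub>M P))"
    by (rule P.emeasure_pair_measure_alt[symmetric, OF measurable_sets[OF \<Psi> E]])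
  also have "\<dots> = emeasure ?R E" unfolding R_eq using E by (simp add: emeasure_distr[OF \<Psi>])
  finally show "emeasure ?L E = emeasure ?R E" .
qed

lemma (in prob_space) AE_pair_snd:
  assumes "prob_space P" "AE y in P. Q y"
  shows "AE p in M \<Otimes>\<^sub>M P. Q (snd p)"
proof -
  interpret P: prob_space P by fact
  interpret MP: pair_prob_space M P ..
  obtain N where N: "N \<in> null_sets P" "{y \<in> space P. \<not> Q y} \<subseteq> N"
    using assms(2) by (auto simp: eventually_ae_filter)
  have "space M \<times> N \<in> null_sets (M \<Otimes>\<^sub>M P)"
    using N(1) by (auto simp: null_sets_def P.emeasure_pair_measure_Times)
  then show ?thesis
    by (rule AE_I') (use N(2) in \<open>auto simp: space_pair_measure\<close>)
qed

lemma nat_floor_div_tendsto: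
  assumes "0 \<le> t"
  shows "(\<lambda>n. real (nat \<lfloor>real n * t\<rfloor>) / real n) \<longlonglongrightarrow> t"
proof (rule tendsto_sandwich)
  show "(\<lambda>n. t - 1 / real n) \<longlonglongrightarrow> t" by real_asymp
  show "\<forall>\<^sub>F n in sequentially. t - 1 / real n \<le> real (nat \<lfloor>real n * t\<rfloor>) / real n"
    using eventually_gt_at_top[of 0]
  proof eventually_elim
    case (elim n)
    have "(real n * t - 1) / real n \<le> real (nat \<lfloor>real n * t\<rfloor>) / real n"
      using assms by (intro divide_right_mono) linarith+
    then show ?case using elim by (simp add: diff_divide_distrib)
  qed
  show "\<forall>\<^sub>F n in sequentially. real (nat \<lfloor>real n * t\<rfloor>) / real n \<le> t"
    using eventually_gt_at_top[of 0]
  proof eventually_elim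
    case (elim n)
    have "real (nat \<lfloor>real n * t\<rfloor>) \<le> real n * t" using assms by simp
    then show ?case using elim by (simp add: field_simps)
  qed
qed simp

text \<open>The weighted partial sums have exactly the law of the random multiple of \<open>B\<close> at the grid points
\<open>nat \<lfloor>real n * t\<rfloor> / n\<close>, so convergence reduces to the continuity of Brownian paths and dominated
convergence.\<close>
lemma (in prob_space) fdd_weighted_sums_converge:
  fixes Y :: "nat \<times> nat \<Rightarrow> 'a \<Rightarrow> real" and f :: "(real \<Rightarrow> real) \<Rightarrow> real"
  assumes ind: "\<And>K. indep_vars (\<lambda>_. borel) Y (I \<times> {..K})"
    and law: "\<And>j k. j \<in> I \<Longrightarrow> 1 \<le> k \<Longrightarrow> distr M borel (Y (j, k)) = gaussian 0 v"
    and "0 \<le> v" and I: "finite I" and w [measurable]: "w \<in> borel_measurable borel"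
    and B: "standard_wiener P B" and J: "finite J" "J \<subseteq> {0..}"
    and f: "continuous_on (PiE J (\<lambda>_. UNIV)) f" and bdd: "bounded (f ` PiE J (\<lambda>_. UNIV))"
  shows "(\<lambda>n. \<integral>\<omega>. f (\<lambda>t\<in>J. (\<Sum>j\<in>I. w (Y (j, 0) \<omega>) * (\<Sum>k=1..nat \<lfloor>real n * t\<rfloor>. Y (j, k) \<omega>)) / sqrt (real n)) \<partial>M)
    \<longlonglongrightarrow> (\<integral>p. f (\<lambda>t\<in>J. sqrt (v * (\<Sum>j\<in>I. (w (Y (j, 0) (fst p)))\<^sup>2)) * B t (snd p)) \<partial>(M \<Otimes>\<^sub>M P))"
proof -
  interpret P: prob_space P using B by (simp add: standard_wiener_def stochastic_process_def)
  interpret MP: pair_prob_space M P ..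
  have B_meas: "B t \<in> borel_measurable P" if "0 \<le> t" for t
    using B that by (simp add: standard_wiener_def stochastic_process_def)
  have rv: "random_variable borel (Y (j, k))" if "j \<in> I" for j k
    using ind[of k] that by (auto simp: indep_vars_def)
  have [measurable]: "random_variable borel (Y (j, 0))" if "j \<in> I" for j by (rule rv[OF that])
  obtain C where C: "\<And>x. x \<in> PiE J (\<lambda>_. UNIV) \<Longrightarrow> \<bar>f x\<bar> \<le> C"
    using bdd by (auto simp: bounded_iff)
  note f_meas [measurable] = borel_measurable_PiM_continuous_on[OF J(1) f]
  define s where "s = (\<lambda>\<omega>. sqrt (v * (\<Sum>j\<in>I. (w (Y (j, 0) \<omega>))\<^sup>2)))"
  have s [measurable]: "s \<in> borel_measurable M" unfolding s_def by measurable
  define l where "l = (\<lambda>n t. nat \<lfloor>real n * t\<rfloor>)"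
  have vec: "(\<lambda>p. \<lambda>t\<in>J. s (fst p) * B (u t) (snd p)) \<in> M \<Otimes>\<^sub>M P \<rightarrow>\<^sub>M PiM J (\<lambda>_. borel)"
    if "\<And>t. t \<in> J \<Longrightarrow> 0 \<le> u t" for u
    using that by (intro measurable_restrict borel_measurable_times measurable_compose[OF measurable_snd B_meas]
       measurable_compose[OF measurable_fst s])
  have path: "AE p in M \<Otimes>\<^sub>M P. B 0 (snd p) = 0" "AE p in M \<Otimes>\<^sub>M P. continuous_on {0..} (\<lambda>t. B t (snd p))"
    using B AE_pair_snd[OF P.prob_space_axioms] by (auto simp: standard_wiener_def)
  have exact: "(\<integral>\<omega>. f (\<lambda>t\<in>J. (\<Sum>j\<in>I. w (Y (j, 0) \<omega>) * (\<Sum>k=1..l n t. Y (j, k) \<omega>)) / sqrt (real n)) \<partial>M)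
      = (\<integral>p. f (\<lambda>t\<in>J. s (fst p) * B (real (l n t) / real n) (snd p)) \<partial>(M \<Otimes>\<^sub>M P))" if n: "0 < n" for n
  proof -
    \<comment> \<open>Any number of increments that reaches all times in J will do.\<close>
    define K where "K = Suc (\<Sum>t\<in>J. l n t)"
    have lK: "l n t \<le> K" if "t \<in> J" for t
      using member_le_sum[of t J "l n"] that J(1) by (simp add: K_def)
    have K: "0 < K" by (simp add: K_def)
    define \<Theta> where "\<Theta> = (\<lambda>y. \<lambda>t\<in>J. (\<Sum>i<l n t. y i) / sqrt (real n) :: real)"
    have \<Theta> [measurable]: "\<Theta> \<in> PiM {..<K} (\<lambda>_. borel) \<rightarrow>\<^sub>M PiM J (\<lambda>_. borel)"
      unfolding \<Theta>_def
    proof (intro measurable_restrict borel_measurable_divide borel_measurable_sum borel_measurable_const)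
      fix t i assume "t \<in> J" "i \<in> {..<l n t}"
      then have "i \<in> {..<K}" using lK[of t] by auto
      then show "(\<lambda>y. y i) \<in> borel_measurable (PiM {..<K} (\<lambda>_. borel))" by measurable
    qed
    define \<xi> where "\<xi> = (\<lambda>\<omega>. \<lambda>i\<in>{..<K}. \<Sum>j\<in>I. w (Y (j, 0) \<omega>) * Y (j, Suc i) \<omega>)"
    define \<eta> where "\<eta> = (\<lambda>p. \<lambda>i\<in>{..<K}. s (fst p) * (sqrt (real n) * (B (real (Suc i) / real n) (snd p) - B (real i / real n) (snd p))))"
    have \<xi> [measurable]: "\<xi> \<in> M \<rightarrow>\<^sub>M PiM {..<K} (\<lambda>_. borel)"
      unfolding \<xi>_def using rv
      by (intro measurable_restrict borel_measurable_sum borel_measurable_times measurable_compose[OF _ w]) auto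
    have \<eta> [measurable]: "\<eta> \<in> M \<Otimes>\<^sub>M P \<rightarrow>\<^sub>M PiM {..<K} (\<lambda>_. borel)"
      unfolding \<eta>_def
      by (intro measurable_restrict borel_measurable_times borel_measurable_diff borel_measurable_const
         measurable_compose[OF measurable_snd B_meas] measurable_compose[OF measurable_fst s]) auto
    have same: "distr M (PiM {..<K} (\<lambda>_. borel)) \<xi> = distr (M \<Otimes>\<^sub>M P) (PiM {..<K} (\<lambda>_. borel)) \<eta>"
      unfolding \<xi>_def \<eta>_def s_def
      by (rule mixture_law[OF ind _ \<open>0 \<le> v\<close> K I w B n]) (simp add: law)
    have "(\<lambda>t\<in>J. (\<Sum>j\<in>I. w (Y (j, 0) \<omega>) * (\<Sum>k=1..l n t. Y (j, k) \<omega>)) / sqrt (real n)) = \<Theta> (\<xi> \<omega>)" for \<omega>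
    proof
      fix t
      have "(\<Sum>j\<in>I. w (Y (j, 0) \<omega>) * (\<Sum>k=1..l n t. Y (j, k) \<omega>)) = (\<Sum>i<l n t. \<xi> \<omega> i)" if t: "t \<in> J"
      proof -
        have "(\<Sum>j\<in>I. w (Y (j, 0) \<omega>) * (\<Sum>k=1..l n t. Y (j, k) \<omega>)) = (\<Sum>j\<in>I. \<Sum>i<l n t. w (Y (j, 0) \<omega>) * Y (j, Suc i) \<omega>)"
          by (simp add: sum.atLeast1_atMost_eq sum_distrib_left)
        also have "\<dots> = (\<Sum>i<l n t. \<Sum>j\<in>I. w (Y (j, 0) \<omega>) * Y (j, Suc i) \<omega>)" by (rule sum.swap)
        also have "\<dots> = (\<Sum>i<l n t. \<xi> \<omega> i)" using lK[OF t] by (intro sum.cong) (auto simp: \<xi>_def)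
        finally show ?thesis .
      qed
      then show "(\<lambda>t\<in>J. (\<Sum>j\<in>I. w (Y (j, 0) \<omega>) * (\<Sum>k=1..l n t. Y (j, k) \<omega>)) / sqrt (real n)) t = \<Theta> (\<xi> \<omega>) t"
        by (simp add: \<Theta>_def restrict_def)
    qed
    then have "(\<integral>\<omega>. f (\<lambda>t\<in>J. (\<Sum>j\<in>I. w (Y (j, 0) \<omega>) * (\<Sum>k=1..l n t. Y (j, k) \<omega>)) / sqrt (real n)) \<partial>M)
        = (\<integral>\<omega>. f (\<Theta> (\<xi> \<omega>)) \<partial>M)" by simp
    also have "\<dots> = (\<integral>y. f (\<Theta> y) \<partial>distr M (PiM {..<K} (\<lambda>_. borel)) \<xi>)"
      by (subst integral_distr) auto
    also have "\<dots> = (\<integral>p. f (\<Theta> (\<eta> p)) \<partial>(M \<Otimes>\<^sub>M P))"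
      unfolding same by (subst integral_distr) auto
    also have "\<dots> = (\<integral>p. f (\<lambda>t\<in>J. s (fst p) * B (real (l n t) / real n) (snd p)) \<partial>(M \<Otimes>\<^sub>M P))"
    proof (rule integral_cong_AE)
      show "(\<lambda>p. f (\<Theta> (\<eta> p))) \<in> borel_measurable (M \<Otimes>\<^sub>M P)" by measurable
      show "(\<lambda>p. f (\<lambda>t\<in>J. s (fst p) * B (real (l n t) / real n) (snd p))) \<in> borel_measurable (M \<Otimes>\<^sub>M P)"
        by (rule measurable_compose[OF vec f_meas]) simp
      show "AE p in M \<Otimes>\<^sub>M P. f (\<Theta> (\<eta> p)) = f (\<lambda>t\<in>J. s (fst p) * B (real (l n t) / real n) (snd p))"
        using path(1)
      proof eventually_elim
        case (elim p)
        have "\<Theta> (\<eta> p) t = (\<lambda>t\<in>J. s (fst p) * B (real (l n t) / real n) (snd p)) t" for t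
        proof (cases "t \<in> J")
          case True
          have "(\<Sum>i<l n t. \<eta> p i) = (\<Sum>i<l n t. s (fst p) * sqrt (real n) * (B (real (Suc i) / real n) (snd p) - B (real i / real n) (snd p)))"
            using lK[OF True] by (intro sum.cong) (auto simp: \<eta>_def)
          also have "\<dots> = s (fst p) * sqrt (real n) * (B (real (l n t) / real n) (snd p) - B (real 0 / real n) (snd p))"
            unfolding sum_distrib_left[symmetric] by (subst sum_lessThan_telescope) simp
          finally show ?thesis using True n elim by (simp add: \<Theta>_def)
        qed (simp add: \<Theta>_def)
        then show ?case by presburger
      qed
    qed
    finally show ?thesis .
  qed
  have "(\<lambda>n. \<integral>p. f (\<lambda>t\<in>J. s (fst p) * B (real (l n t) / real n) (snd p)) \<partial>(M \<Otimes>\<^sub>M P))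
      \<longlonglongrightarrow> (\<integral>p. f (\<lambda>t\<in>J. s (fst p) * B t (snd p)) \<partial>(M \<Otimes>\<^sub>M P))"
  proof (rule integral_dominated_convergence[where w="\<lambda>_. C"])
    show "(\<lambda>p. f (\<lambda>t\<in>J. s (fst p) * B t (snd p))) \<in> borel_measurable (M \<Otimes>\<^sub>M P)"
      using J(2) by (intro measurable_compose[OF vec f_meas]) auto
    show "(\<lambda>p. f (\<lambda>t\<in>J. s (fst p) * B (real (l n t) / real n) (snd p))) \<in> borel_measurable (M \<Otimes>\<^sub>M P)" for n
      by (rule measurable_compose[OF vec f_meas]) simp
    show "integrable (M \<Otimes>\<^sub>M P) (\<lambda>_. C)" by simp
    show "AE p in M \<Otimes>\<^sub>M P. norm (f (\<lambda>t\<in>J. s (fst p) * B (real (l n t) / real n) (snd p))) \<le> C" for n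
      using C by auto
    show "AE p in M \<Otimes>\<^sub>M P. (\<lambda>n. f (\<lambda>t\<in>J. s (fst p) * B (real (l n t) / real n) (snd p)))
        \<longlonglongrightarrow> f (\<lambda>t\<in>J. s (fst p) * B t (snd p))"
      using path(2)
    proof eventually_elim
      case (elim p)
      show ?case
      proof (rule tendsto_PiE_continuous_on[OF f])
        fix t assume t: "t \<in> J"
        have "(\<lambda>n. B (real (l n t) / real n) (snd p)) \<longlonglongrightarrow> B t (snd p)"
          using t J(2) unfolding l_def
          by (intro continuous_on_tendsto_compose[OF elim nat_floor_div_tendsto]) auto
        then have "(\<lambda>n. s (fst p) * B (real (l n t) / real n) (snd p)) \<longlonglongrightarrow> s (fst p) * B t (snd p)"
          by (rule tendsto_mult_left)
        then show "(\<lambda>n. (\<lambda>t\<in>J. s (fst p) * B (real (l n t) / real n) (snd p)) t) \<longlonglongrightarrow> (\<lambda>t\<in>J. s (fst p) * B t (snd p)) t"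
          using t by simp
      qed auto
    qed
  qed
  then have "(\<lambda>n. \<integral>\<omega>. f (\<lambda>t\<in>J. (\<Sum>j\<in>I. w (Y (j, 0) \<omega>) * (\<Sum>k=1..l n t. Y (j, k) \<omega>)) / sqrt (real n)) \<partial>M)
      \<longlonglongrightarrow> (\<integral>p. f (\<lambda>t\<in>J. s (fst p) * B t (snd p)) \<partial>(M \<Otimes>\<^sub>M P))"
  proof (rule Lim_transform_eventually)
    show "\<forall>\<^sub>F n in sequentially. (\<integral>p. f (\<lambda>t\<in>J. s (fst p) * B (real (l n t) / real n) (snd p)) \<partial>(M \<Otimes>\<^sub>M P))
       = (\<integral>\<omega>. f (\<lambda>t\<in>J. (\<Sum>j\<in>I. w (Y (j, 0) \<omega>) * (\<Sum>k=1..l n t. Y (j, k) \<omega>)) / sqrt (real n)) \<partial>M)"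
      using eventually_gt_at_top[of 0] by eventually_elim (simp only: exact)
  qed
  then show ?thesis unfolding s_def l_def .
qed

section \<open>The randomized autoregression\<close>

text \<open>Rectangles form an intersection-stable generator of the product sigma algebra.\<close>
lemma pair_law_eqI:
  fixes U :: "'a \<Rightarrow> 'b" and V V' :: "'a \<Rightarrow> 'c"
  assumes M: "prob_space M" and [measurable]: "U \<in> M \<rightarrow>\<^sub>M S" "V \<in> M \<rightarrow>\<^sub>M T" "V' \<in> M \<rightarrow>\<^sub>M T"
    and eq: "\<And>A C. A \<in> sets S \<Longrightarrow> C \<in> sets T \<Longrightarrow>
      emeasure M {\<omega> \<in> space M. U \<omega> \<in> A \<and> V \<omega> \<in> C} = emeasure M {\<omega> \<in> space M. U \<omega> \<in> A \<and> V' \<omega> \<in> C}"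
  shows "distr M (S \<Otimes>\<^sub>M T) (\<lambda>\<omega>. (U \<omega>, V \<omega>)) = distr M (S \<Otimes>\<^sub>M T) (\<lambda>\<omega>. (U \<omega>, V' \<omega>))" (is "?L = ?R")
proof -
  interpret prob_space M by (rule M)
  let ?E = "{a \<times> b |a b. a \<in> sets S \<and> b \<in> sets T}" and ?P = "S \<Otimes>\<^sub>M T"
  show ?thesis
  proof (rule measure_eqI_generator_eq[OF Int_stable_pair_measure_generator[of S T]])
    show "?E \<subseteq> Pow (space ?P)"
      using sets.space_closed[of S] sets.space_closed[of T] by (auto simp: space_pair_measure)
    show "sets ?L = sigma_sets (space ?P) ?E" "sets ?R = sigma_sets (space ?P) ?E"
      by (simp_all add: sets_pair_measure space_pair_measure)
    show "range (\<lambda>_::nat. space S \<times> space T) \<subseteq> ?E" by auto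
    show "(\<Union>i::nat. space S \<times> space T) = space ?P" by (simp add: space_pair_measure)
    show "emeasure ?L (space S \<times> space T) \<noteq> \<infinity>"
      by (subst emeasure_distr) (auto simp: emeasure_eq_measure)
    fix X assume "X \<in> ?E"
    then obtain A C where X: "X = A \<times> C" and A: "A \<in> sets S" and C: "C \<in> sets T" by auto
    have "emeasure ?L X = emeasure M {\<omega> \<in> space M. U \<omega> \<in> A \<and> V \<omega> \<in> C}"
      using A C by (subst emeasure_distr) (auto simp: X intro!: arg_cong[where f="emeasure M"])
    also have "\<dots> = emeasure M {\<omega> \<in> space M. U \<omega> \<in> A \<and> V' \<omega> \<in> C}" by (rule eq[OF A C])
    also have "\<dots> = emeasure ?R X"
      using A C by (subst emeasure_distr) (auto simp: X intro!: arg_cong[where f="emeasure M"])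
    finally show "emeasure ?L X = emeasure ?R X" .
  qed
qed

text \<open>Conditionally on \<open>\<alpha>\<close> the process is stationary; integrating the conditional laws over \<open>\<alpha> \<in> A\<close>
transfers this to the joint law of \<open>\<alpha>\<close> and \<open>X m\<close>. The coefficient is included because
the boundary term is the product of \<open>X m\<close> and a function of \<open>\<alpha>\<close>.\<close>
lemma randomized_AR1_pair_law:
  assumes AR: "randomized_AR1 M v \<alpha> X \<epsilon>"
  shows "distr M (borel \<Otimes>\<^sub>M borel) (\<lambda>\<omega>. (\<alpha> \<omega>, X m \<omega>)) = distr M (borel \<Otimes>\<^sub>M borel) (\<lambda>\<omega>. (\<alpha> \<omega>, X 0 \<omega>))"
proof -
  have M: "prob_space M" and \<alpha> [measurable]: "\<alpha> \<in> borel_measurable M"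
    and X [measurable]: "\<And>k. X k \<in> borel_measurable M"
    using AR by (auto simp: randomized_AR1_def)
  define S where "S = PiM (UNIV :: nat set) (\<lambda>_. borel :: real measure)"
  define T where "T = PiM {1::nat..} (\<lambda>_. borel :: real measure)"
  obtain \<kappa> where rcd: "regular_cond_distr M \<alpha> (S \<Otimes>\<^sub>M T) (\<lambda>\<omega>. (\<lambda>k. X k \<omega>, \<lambda>k\<in>{1..}. \<epsilon> k \<omega>)) \<kappa>"
    and stat: "AE a in distr M borel \<alpha>. stationary_AR1 (\<kappa> a) a v (\<lambda>k p. fst p k) (\<lambda>k p. snd p k)"
    using AR unfolding randomized_AR1_def S_def T_def by blast
  have \<kappa>: "\<kappa> \<in> borel \<rightarrow>\<^sub>M prob_algebra (S \<Otimes>\<^sub>M T)" using rcd by (simp add: regular_cond_distr_def)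
  have sets_\<kappa>: "sets (\<kappa> a) = sets (S \<Otimes>\<^sub>M T)" for a
    using measurable_space[OF \<kappa>, of a] by (simp add: space_prob_algebra)
  have space_\<kappa>: "space (\<kappa> a) = space (S \<Otimes>\<^sub>M T)" for a by (rule sets_eq_imp_space_eq[OF sets_\<kappa>])
  have slice: "{p \<in> space (S \<Otimes>\<^sub>M T). fst p k \<in> C} \<in> sets (S \<Otimes>\<^sub>M T)" if [measurable]: "C \<in> sets borel" for C k
    unfolding S_def by measurable
  have joint: "emeasure M {\<omega> \<in> space M. \<alpha> \<omega> \<in> A \<and> X k \<omega> \<in> C}
      = (\<integral>\<^sup>+a\<in>A. emeasure (\<kappa> a) {p \<in> space (S \<Otimes>\<^sub>M T). fst p k \<in> C} \<partial>distr M borel \<alpha>)"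
    if A: "A \<in> sets borel" and C: "C \<in> sets borel" for A C k
  proof -
    have "emeasure M {\<omega> \<in> space M. \<alpha> \<omega> \<in> A \<and>
          (\<lambda>k. X k \<omega>, \<lambda>k\<in>{1..}. \<epsilon> k \<omega>) \<in> {p \<in> space (S \<Otimes>\<^sub>M T). fst p k \<in> C}}
      = (\<integral>\<^sup>+a\<in>A. emeasure (\<kappa> a) {p \<in> space (S \<Otimes>\<^sub>M T). fst p k \<in> C} \<partial>distr M borel \<alpha>)"
      using rcd A slice[OF C] unfolding regular_cond_distr_def by blast
    then show ?thesis by (simp add: space_pair_measure S_def T_def space_PiM)
  qed
  have shift: "AE a in distr M borel \<alpha>. \<forall>C\<in>sets borel. emeasure (\<kappa> a) {p \<in> space (S \<Otimes>\<^sub>M T). fst p m \<in> C}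
      = emeasure (\<kappa> a) {p \<in> space (S \<Otimes>\<^sub>M T). fst p 0 \<in> C}"
    using stat
  proof eventually_elim
    case (elim a)
    show ?case
    proof
      fix C :: "real set" assume C [measurable]: "C \<in> sets borel"
      have fst_meas: "(\<lambda>p. fst p) \<in> \<kappa> a \<rightarrow>\<^sub>M S"
        using measurable_cong_sets[OF sets_\<kappa>[of a] refl, of S] measurable_fst by blast
      have coord: "(\<lambda>p k. fst p (k + h)) \<in> \<kappa> a \<rightarrow>\<^sub>M S" for h
      proof -
        have "(\<lambda>x k. x (k + h)) \<in> S \<rightarrow>\<^sub>M S" unfolding S_def by (rule measurable_PiM_single') auto
        from measurable_compose[OF fst_meas this] show ?thesis by simp
      qed
      have D: "{x \<in> space S. x 0 \<in> C} \<in> sets S" unfolding S_def by measurable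
      have "distr (\<kappa> a) S (\<lambda>p k. fst p (k + m)) = distr (\<kappa> a) S (\<lambda>p k. fst p k)"
        using elim unfolding stationary_AR1_def strictly_stationary_def S_def by blast
      then have "emeasure (distr (\<kappa> a) S (\<lambda>p k. fst p (k + m))) {x \<in> space S. x 0 \<in> C}
          = emeasure (distr (\<kappa> a) S (\<lambda>p k. fst p (k + 0))) {x \<in> space S. x 0 \<in> C}" by simp
      moreover have law: "emeasure (distr (\<kappa> a) S (\<lambda>p k. fst p (k + h))) {x \<in> space S. x 0 \<in> C}
          = emeasure (\<kappa> a) {p \<in> space (S \<Otimes>\<^sub>M T). fst p h \<in> C}" for h
        by (subst emeasure_distr[OF coord D])
          (auto simp: space_\<kappa> S_def space_PiM intro!: arg_cong[where f="emeasure (\<kappa> a)"])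
      ultimately show "emeasure (\<kappa> a) {p \<in> space (S \<Otimes>\<^sub>M T). fst p m \<in> C}
          = emeasure (\<kappa> a) {p \<in> space (S \<Otimes>\<^sub>M T). fst p 0 \<in> C}" using law[of m] law[of 0] by simp
    qed
  qed
  show ?thesis
  proof (rule pair_law_eqI[OF M])
    fix A C :: "real set" assume A: "A \<in> sets borel" and C: "C \<in> sets borel"
    show "emeasure M {\<omega> \<in> space M. \<alpha> \<omega> \<in> A \<and> X m \<omega> \<in> C} = emeasure M {\<omega> \<in> space M. \<alpha> \<omega> \<in> A \<and> X 0 \<omega> \<in> C}"
      unfolding joint[OF A C]
    proof (rule nn_integral_cong_AE)
      show "AE a in distr M borel \<alpha>. emeasure (\<kappa> a) {p \<in> space (S \<Otimes>\<^sub>M T). fst p m \<in> C} * indicator A a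
          = emeasure (\<kappa> a) {p \<in> space (S \<Otimes>\<^sub>M T). fst p 0 \<in> C} * indicator A a"
        using shift by eventually_elim (simp add: C)
    qed
  qed measurable
qed

text \<open>The innovations are recovered from the path and the coefficient by the recursion. Expressing them in this
way makes the statement depend only on the law of \<open>\<alpha>\<close> and \<open>X\<close>, so that it passes to copies for which no
innovations are given.\<close>
lemma randomized_AR1_innovations_law:
  assumes AR: "randomized_AR1 M v \<alpha> X \<epsilon>" and "0 \<le> v"
  shows "distr M (PiM {..K} (\<lambda>_. borel))
      (\<lambda>\<omega>. \<lambda>k\<in>{..K}. if k = 0 then \<alpha> \<omega> else X k \<omega> - \<alpha> \<omega> * X (k - 1) \<omega>)
    = PiM {..K} (\<lambda>k. if k = 0 then distr M borel \<alpha> else gaussian 0 v)"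
proof -
  have M: "prob_space M" and \<alpha> [measurable]: "\<alpha> \<in> borel_measurable M"
    and X [measurable]: "\<And>k. X k \<in> borel_measurable M"
    and innov: "gaussian_innovations M v \<epsilon>"
    and ind: "indep_elements M borel \<alpha> (PiM {1..} (\<lambda>_. borel)) (\<lambda>\<omega>. \<lambda>k\<in>{1..}. \<epsilon> k \<omega>)"
    and rec: "\<And>k. 1 \<le> k \<Longrightarrow> AE \<omega> in M. X k \<omega> = \<alpha> \<omega> * X (k - 1) \<omega> + \<epsilon> k \<omega>"
    using AR by (auto simp: randomized_AR1_def)
  interpret prob_space M by (rule M)
  have ind\<epsilon>: "indep_vars (\<lambda>_. borel) \<epsilon> {1..}" and law\<epsilon>: "\<And>k. 1 \<le> k \<Longrightarrow> distr M borel (\<epsilon> k) = gaussian 0 v"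
    using innov by (auto simp: gaussian_innovations_def)
  have \<epsilon>: "random_variable borel (\<epsilon> k)" if "1 \<le> k" for k
    using ind\<epsilon> that by (auto simp: indep_vars_def)
  define F where "F = (\<lambda>k::nat. if k = 0 then \<alpha> else \<epsilon> k)"
  have F: "random_variable borel (F k)" for k using \<epsilon>[of k] by (cases "k = 0") (simp_all add: F_def)
  define \<mu> where "\<mu> = (\<lambda>k::nat. if k = 0 then distr M borel \<alpha> else gaussian 0 v)"
  have \<mu>: "\<mu> k = distr M borel (F k)" for k using law\<epsilon>[of k] by (simp add: \<mu>_def F_def)
  have "distr M (PiM {..K} (\<lambda>_. borel))
      (\<lambda>\<omega>. \<lambda>k\<in>{..K}. if k = 0 then \<alpha> \<omega> else X k \<omega> - \<alpha> \<omega> * X (k - 1) \<omega>)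
    = distr M (PiM {..K} (\<lambda>_. borel)) (\<lambda>\<omega>. \<lambda>k\<in>{..K}. F k \<omega>)"
  proof (rule distr_cong_AE)
    have "AE \<omega> in M. \<forall>k\<in>{1..}. X k \<omega> = \<alpha> \<omega> * X (k - 1) \<omega> + \<epsilon> k \<omega>"
      using rec by (simp add: AE_ball_countable)
    then show "AE \<omega> in M. (\<lambda>k\<in>{..K}. if k = 0 then \<alpha> \<omega> else X k \<omega> - \<alpha> \<omega> * X (k - 1) \<omega>) = (\<lambda>k\<in>{..K}. F k \<omega>)"
      by eventually_elim (auto simp: F_def fun_eq_iff)
    show "(\<lambda>\<omega>. \<lambda>k\<in>{..K}. if k = 0 then \<alpha> \<omega> else X k \<omega> - \<alpha> \<omega> * X (k - 1) \<omega>) \<in> M \<rightarrow>\<^sub>M PiM {..K} (\<lambda>_. borel)"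
      by (intro measurable_restrict) measurable
    show "(\<lambda>\<omega>. \<lambda>k\<in>{..K}. F k \<omega>) \<in> M \<rightarrow>\<^sub>M PiM {..K} (\<lambda>_. borel)"
      by (intro measurable_restrict F)
  qed simp_all
  also have "\<dots> = PiM {..K} \<mu>" (is "?D = _")
  proof (rule product_sigma_finite.PiM_eqI)
    show "product_sigma_finite \<mu>"
      unfolding product_sigma_finite_def \<mu> using F prob_space_distr prob_space_imp_sigma_finite by blast
    show "sets ?D = sets (PiM {..K} \<mu>)"
      by (simp add: \<mu> cong: sets_PiM_cong)
    fix A assume "\<And>k. k \<in> {..K} \<Longrightarrow> A k \<in> sets (\<mu> k)"
    then have A: "A k \<in> sets borel" if "k \<le> K" for k using that by (simp add: \<mu>)
    define C where "C = {x \<in> space (PiM {1..} (\<lambda>_. borel)). \<forall>k\<in>{1..K}. x k \<in> A k}"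
    have C: "C \<in> sets (PiM {1..} (\<lambda>_. borel))"
      unfolding C_def
    proof (rule sets.sets_Collect_finite_All)
      fix k assume "k \<in> {1..K}"
      then show "{x \<in> space (PiM {1..} (\<lambda>_. borel)). x k \<in> A k} \<in> sets (PiM {1..} (\<lambda>_. borel))"
        using A[of k] by (intro measurable_sets_Collect[of "\<lambda>x. x k" _ borel]) auto
    qed simp
    have VC: "prob ((\<lambda>\<omega>. \<lambda>k\<in>{1..}. \<epsilon> k \<omega>) -` C \<inter> space M) = (\<Prod>k\<in>{1..K}. prob (\<epsilon> k -` A k \<inter> space M))"
    proof (cases "K = 0")
      case True
      then have "(\<lambda>\<omega>. \<lambda>k\<in>{1..}. \<epsilon> k \<omega>) -` C \<inter> space M = space M"
        by (auto simp: C_def space_PiM)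
      then show ?thesis using True by (simp add: prob_space)
    next
      case False
      then have "(\<lambda>\<omega>. \<lambda>k\<in>{1..}. \<epsilon> k \<omega>) -` C \<inter> space M = (\<Inter>k\<in>{1..K}. \<epsilon> k -` A k \<inter> space M)"
        by (auto simp: C_def space_PiM)
      then show ?thesis using False A by (subst indep_varsD[OF ind\<epsilon>, symmetric]) auto
    qed
    have "emeasure ?D (PiE {..K} A) = emeasure M ((\<lambda>\<omega>. \<lambda>k\<in>{..K}. F k \<omega>) -` PiE {..K} A \<inter> space M)"
      using A F by (intro emeasure_distr measurable_restrict sets_PiM_I_finite) auto
    also have "(\<lambda>\<omega>. \<lambda>k\<in>{..K}. F k \<omega>) -` PiE {..K} A \<inter> space M
        = (\<alpha> -` A 0 \<inter> space M) \<inter> ((\<lambda>\<omega>. \<lambda>k\<in>{1..}. \<epsilon> k \<omega>) -` C \<inter> space M)"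
      by (auto simp: F_def C_def space_PiM PiE_iff split: if_splits)
    also have "emeasure M \<dots> = ennreal (prob ((\<alpha> -` A 0 \<inter> space M) \<inter> ((\<lambda>\<omega>. \<lambda>k\<in>{1..}. \<epsilon> k \<omega>) -` C \<inter> space M)))"
      by (rule emeasure_eq_measure)
    also have "prob ((\<alpha> -` A 0 \<inter> space M) \<inter> ((\<lambda>\<omega>. \<lambda>k\<in>{1..}. \<epsilon> k \<omega>) -` C \<inter> space M))
        = prob (\<alpha> -` A 0 \<inter> space M) * prob ((\<lambda>\<omega>. \<lambda>k\<in>{1..}. \<epsilon> k \<omega>) -` C \<inter> space M)"
      using ind A[of 0] C unfolding indep_elements_def by (intro indep_setD) auto
    also have "\<dots> = prob (F 0 -` A 0 \<inter> space M) * (\<Prod>k\<in>{1..K}. prob (F k -` A k \<inter> space M))"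
      unfolding VC by (auto simp: F_def intro!: prod.cong)
    also have "\<dots> = (\<Prod>k\<in>{..K}. prob (F k -` A k \<inter> space M))"
    proof -
      have "{..K} = insert 0 {1..K}" by auto
      then show ?thesis by simp
    qed
    also have "ennreal \<dots> = (\<Prod>k\<in>{..K}. emeasure (\<mu> k) (A k))"
    proof -
      have "emeasure (\<mu> k) (A k) = ennreal (prob (F k -` A k \<inter> space M))" if "k \<le> K" for k
        unfolding \<mu> using F[of k] A[OF that] by (simp add: emeasure_distr emeasure_eq_measure)
      then show ?thesis by (simp add: prod_ennreal)
    qed
    finally show "emeasure ?D (PiE {..K} A) = (\<Prod>k\<in>{..K}. emeasure (\<mu> k) (A k))" .
  qed simp
  finally show ?thesis unfolding \<mu>_def .
qed

text \<open>The discrete Beveridge--Nelson decomposition: shifting the index in the sum of \<open>x (k - 1)\<close> changes it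
only by boundary terms.\<close>
lemma sum_autoregression:
  fixes x :: "nat \<Rightarrow> real"
  shows "(1 - a) * (\<Sum>k=1..m. x k) = (\<Sum>k=1..m. x k - a * x (k - 1)) + a * (x 0 - x m)"
  by (induction m) (simp_all add: algebra_simps)

section \<open>Independent copies and the limit in time\<close>

lemma distr_transfer:
  assumes "distr M S U = distr M' S U'"
    and "U \<in> M \<rightarrow>\<^sub>M S" "U' \<in> M' \<rightarrow>\<^sub>M S" "h \<in> S \<rightarrow>\<^sub>M T"
  shows "distr M T (\<lambda>\<omega>. h (U \<omega>)) = distr M' T (\<lambda>\<omega>. h (U' \<omega>))"
  using distr_distr[OF assms(4,2)] distr_distr[OF assms(4,3)] assms(1) by (simp add: comp_def)

text \<open>One array for all copies: the coefficient of copy \<open>j\<close> sits in column 0 and the innovations, reconstructed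
from its path, in the columns from 1 on. In this form the independence of all coefficients and innovations
is a single statement about real random variables.\<close>
definition coeff_innov ::
    "(nat \<Rightarrow> 'a \<Rightarrow> real) \<Rightarrow> (nat \<Rightarrow> nat \<Rightarrow> 'a \<Rightarrow> real) \<Rightarrow> nat \<times> nat \<Rightarrow> 'a \<Rightarrow> real" where
  "coeff_innov \<alpha>s Xs p \<omega> = (let (j, k) = p in
     if k = 0 then \<alpha>s j \<omega> else Xs j k \<omega> - \<alpha>s j \<omega> * Xs j (k - 1) \<omega>)"

lemma coeff_innov_0 [simp]: "coeff_innov \<alpha>s Xs (j, 0) \<omega> = \<alpha>s j \<omega>"
  by (simp add: coeff_innov_def)

lemma coeff_innov_pos: "1 \<le> k \<Longrightarrow> coeff_innov \<alpha>s Xs (j, k) \<omega> = Xs j k \<omega> - \<alpha>s j \<omega> * Xs j (k - 1) \<omega>"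
  by (simp add: coeff_innov_def)

locale AR1_copies = prob_space M for M :: "'b measure" +
  fixes M0 :: "'a measure" and \<alpha> :: "'a \<Rightarrow> real" and X \<epsilon> :: "nat \<Rightarrow> 'a \<Rightarrow> real"
    and \<alpha>s :: "nat \<Rightarrow> 'b \<Rightarrow> real" and Xs :: "nat \<Rightarrow> nat \<Rightarrow> 'b \<Rightarrow> real" and v :: real
  assumes v: "0 \<le> v" and AR: "randomized_AR1 M0 v \<alpha> X \<epsilon>"
    and \<alpha>_range: "\<forall>\<omega>\<in>space M0. \<alpha> \<omega> \<in> {0..<1}"
    and indep: "indep_vars (\<lambda>_. borel \<Otimes>\<^sub>M (\<Pi>\<^sub>M k\<in>UNIV. borel)) (\<lambda>j \<omega>. (\<alpha>s j \<omega>, \<lambda>k. Xs j k \<omega>)) {1..}"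
    and same_law: "\<forall>j\<ge>1. distr M (borel \<Otimes>\<^sub>M (\<Pi>\<^sub>M k\<in>UNIV. borel)) (\<lambda>\<omega>. (\<alpha>s j \<omega>, \<lambda>k. Xs j k \<omega>))
             = distr M0 (borel \<Otimes>\<^sub>M (\<Pi>\<^sub>M k\<in>UNIV. borel)) (\<lambda>\<omega>. (\<alpha> \<omega>, \<lambda>k. X k \<omega>))"
begin

abbreviation "Z j \<equiv> (\<lambda>\<omega>. (\<alpha>s j \<omega>, \<lambda>k. Xs j k \<omega>))"
abbreviation "Z0 \<equiv> (\<lambda>\<omega>. (\<alpha> \<omega>, \<lambda>k. X k \<omega>))"
abbreviation "SP \<equiv> (borel :: real measure) \<Otimes>\<^sub>M (\<Pi>\<^sub>M k\<in>(UNIV :: nat set). (borel :: real measure))"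
abbreviation "Y \<equiv> coeff_innov \<alpha>s Xs"

lemma Z_meas: "1 \<le> j \<Longrightarrow> Z j \<in> M \<rightarrow>\<^sub>M SP"
  using indep by (simp add: indep_vars_def)

lemma \<alpha>s_meas [measurable]: "1 \<le> j \<Longrightarrow> \<alpha>s j \<in> borel_measurable M"
  using measurable_compose[OF Z_meas measurable_fst] by simp

lemma Xs_meas [measurable]: "1 \<le> j \<Longrightarrow> Xs j k \<in> borel_measurable M"
  using measurable_compose[OF measurable_compose[OF Z_meas measurable_snd] measurable_component_singleton[of k UNIV]]
  by simp

lemma Z0_meas: "Z0 \<in> M0 \<rightarrow>\<^sub>M SP"
  using AR by (intro measurable_Pair measurable_PiM_single') (auto simp: randomized_AR1_def)

lemma transfer:
  assumes "1 \<le> j" "h \<in> SP \<rightarrow>\<^sub>M T"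
  shows "distr M T (\<lambda>\<omega>. h (Z j \<omega>)) = distr M0 T (\<lambda>\<omega>. h (Z0 \<omega>))"
  by (rule distr_transfer[OF same_law[rule_format, OF assms(1)] Z_meas[OF assms(1)] Z0_meas assms(2)])

lemma \<alpha>s_law: "1 \<le> j \<Longrightarrow> distr M borel (\<alpha>s j) = distr M0 borel \<alpha>"
  using transfer[of j fst borel] by simp

lemma pair_law:
  assumes "1 \<le> j"
  shows "distr M (borel \<Otimes>\<^sub>M borel) (\<lambda>\<omega>. (\<alpha>s j \<omega>, Xs j m \<omega>)) = distr M (borel \<Otimes>\<^sub>M borel) (\<lambda>\<omega>. (\<alpha>s j \<omega>, Xs j 0 \<omega>))"
proof -
  have h: "(\<lambda>z. (fst z, snd z k)) \<in> SP \<rightarrow>\<^sub>M borel \<Otimes>\<^sub>M borel" for k by measurable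
  show ?thesis
    using transfer[OF assms h[of m]] transfer[OF assms h[of 0]] randomized_AR1_pair_law[OF AR, of m] by simp
qed

lemma AE_\<alpha>s: "1 \<le> j \<Longrightarrow> AE \<omega> in M. \<alpha>s j \<omega> \<noteq> 1"
proof -
  assume j: "1 \<le> j"
  have \<alpha>: "\<alpha> \<in> borel_measurable M0" using AR by (simp add: randomized_AR1_def)
  have "AE a in distr M0 borel \<alpha>. a \<noteq> 1"
    using \<alpha>_range by (subst AE_distr_iff[OF \<alpha>]) (auto intro!: AE_I2)
  then show "AE \<omega> in M. \<alpha>s j \<omega> \<noteq> 1"
    unfolding \<alpha>s_law[OF j, symmetric] by (subst (asm) AE_distr_iff[OF \<alpha>s_meas[OF j]]) auto
qed

lemma indep_\<alpha>s: "indep_vars (\<lambda>_. borel) \<alpha>s {1..}"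
  using indep_vars_compose2[OF indep, of "\<lambda>_. fst" "\<lambda>_. borel"] by simp

lemma Y_meas: "1 \<le> j \<Longrightarrow> Y (j, k) \<in> borel_measurable M"
  by (cases "k = 0") (simp_all add: coeff_innov_def[abs_def])

lemma row_law:
  assumes j: "1 \<le> j"
  shows "distr M (PiM {..K} (\<lambda>_. borel)) (\<lambda>\<omega>. \<lambda>k\<in>{..K}. Y (j, k) \<omega>)
    = PiM {..K} (\<lambda>k. if k = 0 then distr M0 borel \<alpha> else gaussian 0 v)"
proof -
  define h where "h = (\<lambda>z :: real \<times> (nat \<Rightarrow> real). \<lambda>k\<in>{..K}. if k = 0 then fst z else snd z k - fst z * snd z (k - 1))"
  have h: "h \<in> SP \<rightarrow>\<^sub>M PiM {..K} (\<lambda>_. borel)"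
    unfolding h_def by (intro measurable_restrict) measurable
  have "(\<lambda>\<omega>. \<lambda>k\<in>{..K}. Y (j, k) \<omega>) = (\<lambda>\<omega>. h (Z j \<omega>))"
    by (auto simp: h_def coeff_innov_def fun_eq_iff)
  then show ?thesis
    using transfer[OF j h] randomized_AR1_innovations_law[OF AR v, of K] by (simp add: h_def cong: if_cong)
qed

lemma prob_space_\<alpha>_law: "prob_space (distr M0 borel \<alpha>)"
  using AR by (intro prob_space.prob_space_distr) (auto simp: randomized_AR1_def)

lemma coordinate_law:
  assumes j: "1 \<le> j"
  shows "distr M borel (Y (j, k)) = (if k = 0 then distr M0 borel \<alpha> else gaussian 0 v)"
proof -
  define \<mu> where "\<mu> = (\<lambda>k::nat. if k = 0 then distr M0 borel \<alpha> else gaussian 0 v)"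
  have \<mu>: "prob_space (\<mu> i)" "sets (\<mu> i) = sets borel" for i
    using prob_space_\<alpha>_law prob_space_gaussian[OF v] by (simp_all add: \<mu>_def)
  have m: "(\<lambda>\<omega>. \<lambda>i\<in>{..k}. Y (j, i) \<omega>) \<in> M \<rightarrow>\<^sub>M PiM {..k} (\<lambda>_. borel)"
    by (intro measurable_restrict Y_meas j)
  have "distr M borel (Y (j, k)) = distr (distr M (PiM {..k} (\<lambda>_. borel)) (\<lambda>\<omega>. \<lambda>i\<in>{..k}. Y (j, i) \<omega>)) borel (\<lambda>x. x k)"
    by (subst distr_distr[OF _ m]) (simp_all add: comp_def)
  also have "\<dots> = distr (PiM {..k} \<mu>) (\<mu> k) (\<lambda>x. x k)"
    unfolding row_law[OF j] \<mu>_def[symmetric] using \<mu>(2) by (intro distr_cong) auto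
  also have "\<dots> = \<mu> k" using \<mu>(1) by (intro distr_PiM_component) auto
  finally show ?thesis by (simp add: \<mu>_def)
qed

text \<open>The rows are independent because the copies are; within a row the entries are independent by the
product form of row_law.\<close>
lemma indep_Y:
  assumes "1 \<le> N"
  shows "indep_vars (\<lambda>_. borel) Y ({1..N} \<times> {..K})"
proof (rule indep_vars_flatten)
  define h where "h = (\<lambda>z :: real \<times> (nat \<Rightarrow> real). \<lambda>k\<in>{..K}. if k = 0 then fst z else snd z k - fst z * snd z (k - 1))"
  have h: "h \<in> SP \<rightarrow>\<^sub>M PiM {..K} (\<lambda>_. borel)"
    unfolding h_def by (intro measurable_restrict) measurable
  have "indep_vars (\<lambda>j. PiM {..K} (\<lambda>_. borel)) (\<lambda>j \<omega>. h (Z j \<omega>)) {1..N}"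
    by (rule indep_vars_compose2[OF indep_vars_subset[OF indep]]) (use h in auto)
  also have "(\<lambda>j \<omega>. h (Z j \<omega>)) = (\<lambda>j \<omega>. \<lambda>k\<in>{..K}. Y (j, k) \<omega>)"
    by (auto simp: h_def coeff_innov_def fun_eq_iff)
  finally show "indep_vars (\<lambda>j. PiM {..K} (\<lambda>_. borel)) (\<lambda>j \<omega>. \<lambda>k\<in>{..K}. Y (j, k) \<omega>) {1..N}" .
  fix j assume "j \<in> {1..N}"
  then have j: "1 \<le> j" by simp
  show "indep_vars (\<lambda>_. borel) (\<lambda>k. Y (j, k)) {..K}"
    using row_law[OF j, of K] Y_meas[OF j]
    by (subst indep_vars_iff_distr_eq_PiM') (auto simp: coordinate_law[OF j])
qed (use assms in auto)

lemma aggregate_decomposition: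
  assumes "\<And>j. j \<in> {1..N} \<Longrightarrow> \<alpha>s j \<omega> \<noteq> 1"
  shows "aggregated_sum Xs N n t \<omega> =
     (\<Sum>j=1..N. 1 / (1 - \<alpha>s j \<omega>) * (\<Sum>k=1..nat \<lfloor>real n * t\<rfloor>. Y (j, k) \<omega>))
   + (\<Sum>j=1..N. \<alpha>s j \<omega> / (1 - \<alpha>s j \<omega>) * Xs j 0 \<omega> - \<alpha>s j \<omega> / (1 - \<alpha>s j \<omega>) * Xs j (nat \<lfloor>real n * t\<rfloor>) \<omega>)"
  unfolding aggregated_sum_def sum.distrib[symmetric]
proof (rule sum.cong[OF refl])
  fix j assume j: "j \<in> {1..N}"
  define m where "m = nat \<lfloor>real n * t\<rfloor>"
  have ne: "1 - \<alpha>s j \<omega> \<noteq> 0" using assms[OF j] by simp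
  have "(1 - \<alpha>s j \<omega>) * (\<Sum>k=1..m. Xs j k \<omega>) = (\<Sum>k=1..m. Y (j, k) \<omega>) + \<alpha>s j \<omega> * (Xs j 0 \<omega> - Xs j m \<omega>)"
    by (subst sum_autoregression) (simp add: coeff_innov_pos)
  then have "(\<Sum>k=1..m. Xs j k \<omega>) = ((\<Sum>k=1..m. Y (j, k) \<omega>) + \<alpha>s j \<omega> * (Xs j 0 \<omega> - Xs j m \<omega>)) / (1 - \<alpha>s j \<omega>)"
    using ne by (simp add: nonzero_eq_divide_eq mult.commute)
  then show "(\<Sum>k=1..m. Xs j k \<omega>) = 1 / (1 - \<alpha>s j \<omega>) * (\<Sum>k=1..m. Y (j, k) \<omega>)
      + (\<alpha>s j \<omega> / (1 - \<alpha>s j \<omega>) * Xs j 0 \<omega> - \<alpha>s j \<omega> / (1 - \<alpha>s j \<omega>) * Xs j m \<omega>)"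
    by (simp add: add_divide_distrib diff_divide_distrib right_diff_distrib)
qed

text \<open>By pair_law each boundary term at time \<open>m n\<close> has the law of the one at time 0, which is a fixed random
variable. Hence, whatever the times \<open>m n\<close>, its probability of exceeding a multiple of \<open>sqrt n\<close> tends
to 0.\<close>
lemma boundary_terms_vanish:
  assumes "0 < \<delta>"
  shows "(\<lambda>n. prob {\<omega> \<in> space M. \<delta> < \<bar>\<kappa> / sqrt (real n) *
      (\<Sum>j=1..N. \<alpha>s j \<omega> / (1 - \<alpha>s j \<omega>) * Xs j 0 \<omega> - \<alpha>s j \<omega> / (1 - \<alpha>s j \<omega>) * Xs j (m n) \<omega>)\<bar>}) \<longlonglongrightarrow> 0"
proof (rule tendsto_sandwich[OF _ _ tendsto_const])
  define g where "g = (\<lambda>z :: real \<times> real. \<kappa> * (fst z / (1 - fst z) * snd z))"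
  have g [measurable]: "g \<in> borel_measurable (borel \<Otimes>\<^sub>M borel)" unfolding g_def by measurable
  \<comment> \<open>At most 2 N boundary terms; Suc keeps the denominator positive for N = 0.\<close>
  define c where "c = \<delta> / (2 * real (Suc N))"
  have c: "0 < c" using assms by (simp add: c_def)
  define b where "b = (\<lambda>n j k. {\<omega> \<in> space M. c * sqrt (real n) < \<bar>g (\<alpha>s j \<omega>, Xs j k \<omega>)\<bar>})"
  have pm [measurable]: "(\<lambda>\<omega>. g (\<alpha>s j \<omega>, Xs j k \<omega>)) \<in> borel_measurable M" if "1 \<le> j" for j k
    using that by measurable
  have b [measurable]: "b n j k \<in> events" if "1 \<le> j" for n j k
    unfolding b_def using that by measurable
  have b_law: "prob (b n j k) = prob (b n j 0)" if j: "1 \<le> j" for n j k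
  proof -
    define E where "E = {z. c * sqrt (real n) < \<bar>g z\<bar>}"
    have E: "E \<in> sets (borel \<Otimes>\<^sub>M borel)"
    proof -
      have "{z \<in> space (borel \<Otimes>\<^sub>M borel). c * sqrt (real n) < \<bar>g z\<bar>} \<in> sets (borel \<Otimes>\<^sub>M borel)" by measurable
      then show ?thesis by (simp add: E_def space_pair_measure)
    qed
    have "prob (b n j i) = measure (distr M (borel \<Otimes>\<^sub>M borel) (\<lambda>\<omega>. (\<alpha>s j \<omega>, Xs j i \<omega>))) E" for i
      using E j by (subst measure_distr) (auto simp: b_def E_def intro!: arg_cong[where f=prob])
    then show ?thesis using pair_law[OF j, of k] by simp
  qed
  show "(\<lambda>n. \<Sum>j=1..N. prob (b n j 0) + prob (b n j 0)) \<longlonglongrightarrow> 0"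
  proof -
    have "(\<lambda>n. prob (b n j 0)) \<longlonglongrightarrow> 0" if "j \<in> {1..N}" for j
    proof -
      have "filterlim (\<lambda>n. c * sqrt (real n)) at_top sequentially" using c by real_asymp
      then show ?thesis unfolding b_def using that by (intro tail_probability_tendsto pm) auto
    qed
    then have "(\<lambda>n. \<Sum>j=1..N. prob (b n j 0) + prob (b n j 0)) \<longlonglongrightarrow> (\<Sum>j=1..N. 0 + 0)"
      by (intro tendsto_sum tendsto_add)
    then show ?thesis by simp
  qed
  show "\<forall>\<^sub>F n in sequentially. prob {\<omega> \<in> space M. \<delta> < \<bar>\<kappa> / sqrt (real n) *
      (\<Sum>j=1..N. \<alpha>s j \<omega> / (1 - \<alpha>s j \<omega>) * Xs j 0 \<omega> - \<alpha>s j \<omega> / (1 - \<alpha>s j \<omega>) * Xs j (m n) \<omega>)\<bar>}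
      \<le> (\<Sum>j=1..N. prob (b n j 0) + prob (b n j 0))"
    using eventually_gt_at_top[of 0]
  proof eventually_elim
    case (elim n)
    have sn: "0 < sqrt (real n)" using elim by simp
    let ?A = "{\<omega> \<in> space M. \<delta> < \<bar>\<kappa> / sqrt (real n) *
      (\<Sum>j=1..N. \<alpha>s j \<omega> / (1 - \<alpha>s j \<omega>) * Xs j 0 \<omega> - \<alpha>s j \<omega> / (1 - \<alpha>s j \<omega>) * Xs j (m n) \<omega>)\<bar>}"
    have sub: "?A \<subseteq> (\<Union>j\<in>{1..N}. b n j 0 \<union> b n j (m n))"
    proof
      fix \<omega> assume w: "\<omega> \<in> ?A"
      show "\<omega> \<in> (\<Union>j\<in>{1..N}. b n j 0 \<union> b n j (m n))"
      proof (rule ccontr)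
        assume "\<not> ?thesis"
        then have le: "\<bar>g (\<alpha>s j \<omega>, Xs j 0 \<omega>)\<bar> \<le> c * sqrt (real n)" "\<bar>g (\<alpha>s j \<omega>, Xs j (m n) \<omega>)\<bar> \<le> c * sqrt (real n)"
          if "j \<in> {1..N}" for j
          using that w by (auto simp: b_def not_less)
        have "\<bar>\<Sum>j=1..N. g (\<alpha>s j \<omega>, Xs j 0 \<omega>) - g (\<alpha>s j \<omega>, Xs j (m n) \<omega>)\<bar>
            \<le> (\<Sum>j=1..N. \<bar>g (\<alpha>s j \<omega>, Xs j 0 \<omega>) - g (\<alpha>s j \<omega>, Xs j (m n) \<omega>)\<bar>)" by (rule sum_abs)
        also have "\<dots> \<le> (\<Sum>j=1..N. c * sqrt (real n) + c * sqrt (real n))"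
        proof (rule sum_mono)
          fix j assume "j \<in> {1..N}"
          from add_mono[OF le[OF this]]
          show "\<bar>g (\<alpha>s j \<omega>, Xs j 0 \<omega>) - g (\<alpha>s j \<omega>, Xs j (m n) \<omega>)\<bar> \<le> c * sqrt (real n) + c * sqrt (real n)"
            using abs_triangle_ineq4 order_trans by blast
        qed
        also have "\<dots> = 2 * real N * c * sqrt (real n)" by simp
        also have "\<dots> \<le> \<delta> * sqrt (real n)"
          using assms by (intro mult_right_mono) (simp_all add: c_def field_simps)
        also have "(\<Sum>j=1..N. g (\<alpha>s j \<omega>, Xs j 0 \<omega>) - g (\<alpha>s j \<omega>, Xs j (m n) \<omega>))
            = \<kappa> * (\<Sum>j=1..N. \<alpha>s j \<omega> / (1 - \<alpha>s j \<omega>) * Xs j 0 \<omega> - \<alpha>s j \<omega> / (1 - \<alpha>s j \<omega>) * Xs j (m n) \<omega>)"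
          by (simp add: g_def sum_distrib_left right_diff_distrib)
        finally have "\<bar>\<kappa> / sqrt (real n) *
          (\<Sum>j=1..N. \<alpha>s j \<omega> / (1 - \<alpha>s j \<omega>) * Xs j 0 \<omega> - \<alpha>s j \<omega> / (1 - \<alpha>s j \<omega>) * Xs j (m n) \<omega>)\<bar> \<le> \<delta>"
          using sn by (simp add: abs_mult field_simps)
        then show False using w by simp
      qed
    qed
    have "prob ?A \<le> prob (\<Union>j\<in>{1..N}. b n j 0 \<union> b n j (m n))"
      by (rule finite_measure_mono[OF sub]) auto
    also have "\<dots> \<le> (\<Sum>j=1..N. prob (b n j 0 \<union> b n j (m n)))"
      by (rule finite_measure_subadditive_finite) auto
    also have "\<dots> \<le> (\<Sum>j=1..N. prob (b n j 0) + prob (b n j 0))"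
    proof (rule sum_mono)
      fix j assume "j \<in> {1..N}"
      then have j: "1 \<le> j" by simp
      show "prob (b n j 0 \<union> b n j (m n)) \<le> prob (b n j 0) + prob (b n j 0)"
        using measure_Un_le[OF b[OF j] b[OF j], of n 0 n "m n"] b_law[OF j, of n "m n"] by simp
    qed
    finally show ?case .
  qed
qed simp

text \<open>The aggregated sum is split into the weighted innovation sums \<open>D\<close> and the boundary terms \<open>R\<close>, which are
asymptotically negligible.\<close>
lemma inner_limit:
  fixes f :: "(real \<Rightarrow> real) \<Rightarrow> real"
  assumes N: "1 \<le> N" and B: "standard_wiener P B" and J: "finite J" "J \<subseteq> {0..}"
    and f: "continuous_on (PiE J (\<lambda>_. UNIV)) f" and bdd: "bounded (f ` PiE J (\<lambda>_. UNIV))"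
  shows "(\<lambda>n. \<integral>\<omega>. f (\<lambda>t\<in>J. \<kappa> / sqrt (real n) * aggregated_sum Xs N n t \<omega>) \<partial>M)
    \<longlonglongrightarrow> (\<integral>p. f (\<lambda>t\<in>J. sqrt (v * (\<Sum>j=1..N. (\<kappa> / (1 - \<alpha>s j (fst p)))\<^sup>2)) * B t (snd p)) \<partial>(M \<Otimes>\<^sub>M P))"
proof -
  interpret P: prob_space P using B by (simp add: standard_wiener_def stochastic_process_def)
  interpret MP: pair_prob_space M P ..
  have B_meas: "B t \<in> borel_measurable P" if "0 \<le> t" for t
    using B that by (simp add: standard_wiener_def stochastic_process_def)
  define w where "w = (\<lambda>a::real. \<kappa> / (1 - a))"
  have w [measurable]: "w \<in> borel_measurable borel" unfolding w_def by measurable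
  define D where "D = (\<lambda>n t \<omega>. (\<Sum>j=1..N. w (Y (j, 0) \<omega>) * (\<Sum>k=1..nat \<lfloor>real n * t\<rfloor>. Y (j, k) \<omega>)) / sqrt (real n))"
  define R where "R = (\<lambda>n t \<omega>. \<kappa> / sqrt (real n) * aggregated_sum Xs N n t \<omega> - D n t \<omega>)"
  have D_meas: "D n t \<in> borel_measurable M" for n t
    unfolding D_def
    by (intro borel_measurable_divide borel_measurable_sum borel_measurable_times
      measurable_compose[OF Y_meas w] Y_meas borel_measurable_const) auto
  have S_meas: "aggregated_sum Xs N n t \<in> borel_measurable M" for n t
    unfolding aggregated_sum_def[abs_def] by (intro borel_measurable_sum Xs_meas) auto
  have R_meas: "R n t \<in> borel_measurable M" for n t
    unfolding R_def by (intro borel_measurable_diff borel_measurable_times borel_measurable_const S_meas D_meas)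
  have Y_MP: "(\<lambda>p. sqrt (v * (\<Sum>j=1..N. (w (Y (j, 0) (fst p)))\<^sup>2)) * B t (snd p)) \<in> borel_measurable (M \<Otimes>\<^sub>M P)"
    if "t \<in> J" for t
    using that J(2)
    by (intro borel_measurable_times measurable_compose[OF measurable_snd B_meas] measurable_compose[OF _ borel_measurable_sqrt]
       borel_measurable_const borel_measurable_sum borel_measurable_power
       measurable_compose[OF _ w] measurable_compose[OF measurable_fst Y_meas]) auto
  have AE1: "AE \<omega> in M. \<forall>j\<in>{1..N}. \<alpha>s j \<omega> \<noteq> 1"
    using AE_\<alpha>s by (simp add: AE_ball_countable)
  have R_eq: "AE \<omega> in M. R n t \<omega> = \<kappa> / sqrt (real n) *
      (\<Sum>j=1..N. \<alpha>s j \<omega> / (1 - \<alpha>s j \<omega>) * Xs j 0 \<omega> - \<alpha>s j \<omega> / (1 - \<alpha>s j \<omega>) * Xs j (nat \<lfloor>real n * t\<rfloor>) \<omega>)" for n t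
    using AE1
  proof eventually_elim
    case (elim \<omega>)
    have "D n t \<omega> = \<kappa> / sqrt (real n) * (\<Sum>j=1..N. 1 / (1 - \<alpha>s j \<omega>) * (\<Sum>k=1..nat \<lfloor>real n * t\<rfloor>. Y (j, k) \<omega>))"
      unfolding D_def w_def by (simp add: sum_distrib_left sum_divide_distrib mult_ac)
    then show ?case unfolding R_def using elim by (subst aggregate_decomposition) (auto simp: distrib_left)
  qed
  have small: "(\<lambda>n. prob {\<omega> \<in> space M. \<delta> < \<bar>R n t \<omega>\<bar>}) \<longlonglongrightarrow> 0" if "0 < \<delta>" for t \<delta>
  proof -
    have "prob {\<omega> \<in> space M. \<delta> < \<bar>R n t \<omega>\<bar>} = prob {\<omega> \<in> space M. \<delta> < \<bar>\<kappa> / sqrt (real n) *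
      (\<Sum>j=1..N. \<alpha>s j \<omega> / (1 - \<alpha>s j \<omega>) * Xs j 0 \<omega> - \<alpha>s j \<omega> / (1 - \<alpha>s j \<omega>) * Xs j (nat \<lfloor>real n * t\<rfloor>) \<omega>)\<bar>}" for n
    proof (rule finite_measure_eq_AE)
      show "AE \<omega> in M. \<omega> \<in> {\<omega> \<in> space M. \<delta> < \<bar>R n t \<omega>\<bar>} \<longleftrightarrow> \<omega> \<in> {\<omega> \<in> space M. \<delta> < \<bar>\<kappa> / sqrt (real n) *
        (\<Sum>j=1..N. \<alpha>s j \<omega> / (1 - \<alpha>s j \<omega>) * Xs j 0 \<omega> - \<alpha>s j \<omega> / (1 - \<alpha>s j \<omega>) * Xs j (nat \<lfloor>real n * t\<rfloor>) \<omega>)\<bar>}"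
        using R_eq[of n t] by eventually_elim simp
      show "{\<omega> \<in> space M. \<delta> < \<bar>R n t \<omega>\<bar>} \<in> events" using R_meas[of n t] by measurable
      have "(\<lambda>\<omega>. \<kappa> / sqrt (real n) *
        (\<Sum>j=1..N. \<alpha>s j \<omega> / (1 - \<alpha>s j \<omega>) * Xs j 0 \<omega> - \<alpha>s j \<omega> / (1 - \<alpha>s j \<omega>) * Xs j (nat \<lfloor>real n * t\<rfloor>) \<omega>)) \<in> borel_measurable M"
        by (intro borel_measurable_times borel_measurable_sum borel_measurable_diff borel_measurable_divide
           \<alpha>s_meas Xs_meas borel_measurable_const) auto
      then show "{\<omega> \<in> space M. \<delta> < \<bar>\<kappa> / sqrt (real n) *
        (\<Sum>j=1..N. \<alpha>s j \<omega> / (1 - \<alpha>s j \<omega>) * Xs j 0 \<omega> - \<alpha>s j \<omega> / (1 - \<alpha>s j \<omega>) * Xs j (nat \<lfloor>real n * t\<rfloor>) \<omega>)\<bar>} \<in> events"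
        by measurable
    qed
    then show ?thesis using boundary_terms_vanish[OF that, where \<kappa>=\<kappa> and N=N and m="\<lambda>n. nat \<lfloor>real n * t\<rfloor>"] by simp
  qed
  have "(\<lambda>n. \<integral>\<omega>. f (\<lambda>t\<in>J. D n t \<omega> + R n t \<omega>) \<partial>M)
    \<longlonglongrightarrow> (\<integral>p. f (\<lambda>t\<in>J. sqrt (v * (\<Sum>j=1..N. (w (Y (j, 0) (fst p)))\<^sup>2)) * B t (snd p)) \<partial>(M \<Otimes>\<^sub>M P))"
  proof (rule fdd_slutsky[OF J(1) MP.P.prob_space_axioms D_meas R_meas Y_MP small _ f bdd])
    fix g :: "(real \<Rightarrow> real) \<Rightarrow> real"
    assume g: "continuous_on (PiE J (\<lambda>_. UNIV)) g" "bounded (g ` PiE J (\<lambda>_. UNIV))"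
    show "(\<lambda>n. \<integral>\<omega>. g (\<lambda>t\<in>J. D n t \<omega>) \<partial>M)
      \<longlonglongrightarrow> (\<integral>p. g (\<lambda>t\<in>J. sqrt (v * (\<Sum>j=1..N. (w (Y (j, 0) (fst p)))\<^sup>2)) * B t (snd p)) \<partial>(M \<Otimes>\<^sub>M P))"
      unfolding D_def
      by (rule fdd_weighted_sums_converge[OF indep_Y[OF N] _ v _ w B J g]) (auto simp: coordinate_law)
  qed
  then show ?thesis by (simp add: R_def w_def)
qed

end

section \<open>The limit in the number of copies\<close>

text \<open>Dominated convergence, since \<open>f\<close> is continuous and bounded by \<open>C\<close>.\<close>
lemma wiener_mixing_functional_continuous:
  fixes f :: "(real \<Rightarrow> real) \<Rightarrow> real"
  assumes B: "standard_wiener P B" and J: "finite J" "J \<subseteq> {0..}"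
    and f: "continuous_on (PiE J (\<lambda>_. UNIV)) f" and C: "\<And>x. x \<in> PiE J (\<lambda>_. UNIV) \<Longrightarrow> \<bar>f x\<bar> \<le> C"
  shows "continuous_on UNIV (\<lambda>x. \<integral>\<omega>. f (\<lambda>t\<in>J. sqrt (v * x) * B t \<omega>) \<partial>P)"
proof -
  interpret P: prob_space P using B by (simp add: standard_wiener_def stochastic_process_def)
  have vec: "(\<lambda>\<omega>. \<lambda>t\<in>J. c * B t \<omega>) \<in> P \<rightarrow>\<^sub>M PiM J (\<lambda>_. borel)" for c
    using B J(2) by (intro measurable_restrict borel_measurable_times borel_measurable_const)
      (auto simp: standard_wiener_def stochastic_process_def)
  note meas = measurable_compose[OF vec borel_measurable_PiM_continuous_on[OF J(1) f]]
  show ?thesis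
    unfolding continuous_on_sequentially comp_def
  proof (intro ballI allI impI)
    fix u :: "nat \<Rightarrow> real" and a assume u: "(\<forall>n. u n \<in> UNIV) \<and> u \<longlonglongrightarrow> a"
    show "(\<lambda>n. \<integral>\<omega>. f (\<lambda>t\<in>J. sqrt (v * u n) * B t \<omega>) \<partial>P) \<longlonglongrightarrow> (\<integral>\<omega>. f (\<lambda>t\<in>J. sqrt (v * a) * B t \<omega>) \<partial>P)"
    proof (rule integral_dominated_convergence[where w="\<lambda>_. C"])
      show "AE \<omega> in P. (\<lambda>n. f (\<lambda>t\<in>J. sqrt (v * u n) * B t \<omega>)) \<longlonglongrightarrow> f (\<lambda>t\<in>J. sqrt (v * a) * B t \<omega>)"
      proof (intro AE_I2 tendsto_PiE_continuous_on[OF f])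
        fix \<omega> t assume "t \<in> J"
        have "(\<lambda>n. sqrt (v * u n) * B t \<omega>) \<longlonglongrightarrow> sqrt (v * a) * B t \<omega>"
          using u by (intro tendsto_intros) auto
        then show "(\<lambda>n. (\<lambda>t\<in>J. sqrt (v * u n) * B t \<omega>) t) \<longlonglongrightarrow> (\<lambda>t\<in>J. sqrt (v * a) * B t \<omega>) t"
          using \<open>t \<in> J\<close> by simp
      qed auto
    qed (use meas C in auto)
  qed
qed

context AR1_copies
begin

text \<open>Up to the factor \<open>v\<close>, the random variance of the limit of \<open>N\<close> aggregated copies.\<close>
definition variance_avg :: "nat \<Rightarrow> 'b \<Rightarrow> real" where
  "variance_avg N \<omega> = (\<Sum>j=1..N. 1 / (1 - \<alpha>s j \<omega>)\<^sup>2) / (real N * ln (real N))"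

lemma variance_avg_meas [measurable]: "variance_avg N \<in> borel_measurable M"
  unfolding variance_avg_def[abs_def]
  by (intro borel_measurable_divide borel_measurable_sum borel_measurable_const
    borel_measurable_power borel_measurable_diff \<alpha>s_meas) auto

lemma variance_avg_eq:
  "(\<Sum>j=1..N. (1 / sqrt (real N * ln (real N)) / (1 - \<alpha>s j \<omega>))\<^sup>2) = variance_avg N \<omega>"
proof -
  have "0 \<le> real N * ln (real N)" by (cases "N = 0") auto
  then show ?thesis
    by (simp add: variance_avg_def power_divide power_mult_distrib sum_divide_distrib mult.commute)
qed

text \<open>The function \<open>\<psi>\<close> is extended by 0 to the real line, which changes neither its integral nor
its left limit at 1.\<close>
lemma variance_avg_tendsto:
  fixes \<psi> :: "real \<Rightarrow> real"
  assumes dens: "distributed M0 lborel \<alpha> (\<lambda>x. ennreal (if x \<in> {0..<1} then \<psi> x * (1 - x) powr 1 else 0))"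
    and nn: "\<forall>x\<in>{0..<1}. 0 \<le> \<psi> x" and int: "set_integrable lborel {0..<1} \<psi>"
    and lim: "(\<psi> \<longlongrightarrow> \<psi>1) (at_left 1)" and "0 < \<psi>1" and "0 < \<delta>"
  shows "(\<lambda>N. prob {\<omega> \<in> space M. \<delta> < \<bar>variance_avg N \<omega> - \<psi>1 / 2\<bar>}) \<longlonglongrightarrow> 0"
proof -
  define \<phi> where "\<phi> = (\<lambda>x. indicator {0..<1} x * \<psi> x)"
  have "(\<lambda>x. ennreal (if x \<in> {0..<1} then \<psi> x * (1 - x) powr 1 else 0)) = (\<lambda>x. ennreal (\<phi> x * (1 - x)))"
    by (auto simp: \<phi>_def fun_eq_iff)
  then have law: "distr M0 borel \<alpha> = density lborel (\<lambda>x. ennreal (\<phi> x * (1 - x)))"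
    using distributed_distr_eq_density[OF dens] by (simp cong: distr_cong)
  show ?thesis
    unfolding variance_avg_def
  proof (rule heavy_tailed_weak_law[OF indep_\<alpha>s _ _ _ _ _ \<open>0 < \<psi>1\<close> \<open>0 < \<delta>\<close>])
    show "distr M borel (\<alpha>s j) = density lborel (\<lambda>x. ennreal (\<phi> x * (1 - x)))" if "1 \<le> j" for j
      using \<alpha>s_law[OF that] law by simp
    show "integrable lborel \<phi>" using int by (simp add: set_integrable_def \<phi>_def)
    show "0 \<le> \<phi> x" for x using nn by (simp add: \<phi>_def indicator_def)
    show "\<phi> x = 0" if "1 \<le> x" for x using that by (simp add: \<phi>_def)
    show "(\<phi> \<longlongrightarrow> \<psi>1) (at_left 1)"
    proof (rule Lim_transform_eventually[OF lim])
      have "\<forall>\<^sub>F x in at_left 1. (0::real) < x \<and> x < 1"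
        by (auto simp: eventually_at_left_field intro!: exI[of _ 0])
      then show "\<forall>\<^sub>F x in at_left 1. \<psi> x = \<phi> x"
        by eventually_elim (simp add: \<phi>_def)
    qed
  qed
qed

end

theorem theorem3p4:
  fixes M0 :: "'a measure" and \<alpha> :: "'a \<Rightarrow> real" and X \<epsilon> :: "nat \<Rightarrow> 'a \<Rightarrow> real"
    and M :: "'b measure" and \<alpha>s :: "nat \<Rightarrow> 'b \<Rightarrow> real" and Xs :: "nat \<Rightarrow> nat \<Rightarrow> 'b \<Rightarrow> real"
    and P :: "'c measure" and B :: "real \<Rightarrow> 'c \<Rightarrow> real"
    and \<psi> :: "real \<Rightarrow> real" and \<sigma>2 \<beta> \<psi>1 :: real
  assumes "0 \<le> \<sigma>2"
    and "\<forall>\<omega>\<in>space M0. \<alpha> \<omega> \<in> {0..<1}"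
    and "distributed M0 lborel \<alpha>
           (\<lambda>x. ennreal (if x \<in> {0..<1} then \<psi> x * (1 - x) powr \<beta> else 0))"
    and "\<forall>x\<in>{0..<1}. 0 \<le> \<psi> x"
    and "set_integrable lborel {0..<1} \<psi>"
    and "(\<psi> \<longlongrightarrow> \<psi>1) (at_left 1)" and "0 < \<psi>1"
    and "randomized_AR1 M0 \<sigma>2 \<alpha> X \<epsilon>"
    and "prob_space M"
    and "prob_space.indep_vars M (\<lambda>_. borel \<Otimes>\<^sub>M (\<Pi>\<^sub>M k\<in>UNIV. borel))
           (\<lambda>j \<omega>. (\<alpha>s j \<omega>, \<lambda>k. Xs j k \<omega>)) {1..}"
    and "\<forall>j\<ge>1. distr M (borel \<Otimes>\<^sub>M (\<Pi>\<^sub>M k\<in>UNIV. borel)) (\<lambda>\<omega>. (\<alpha>s j \<omega>, \<lambda>k. Xs j k \<omega>))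
             = distr M0 (borel \<Otimes>\<^sub>M (\<Pi>\<^sub>M k\<in>UNIV. borel)) (\<lambda>\<omega>. (\<alpha> \<omega>, \<lambda>k. X k \<omega>))"
    and "standard_wiener P B"
    and "\<beta> = 1"
  shows "iterated_fdd_converges 2 M
           (\<lambda>N n t \<omega>. 1 / sqrt (real n * real N * ln (real N)) * aggregated_sum Xs N n t \<omega>)
           P (\<lambda>t \<omega>. sqrt (\<sigma>2 * \<psi>1 / 2) * B t \<omega>)"
proof -
  interpret AR1_copies M M0 \<alpha> X \<epsilon> \<alpha>s Xs \<sigma>2
    using assms by (simp add: AR1_copies_def AR1_copies_axioms_def)
  note B = assms(12)
  interpret P: prob_space P using B by (simp add: standard_wiener_def stochastic_process_def)
  interpret MP: pair_prob_space M P ..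
  have B_meas: "B t \<in> borel_measurable P" if "0 \<le> t" for t
    using B that by (simp add: standard_wiener_def stochastic_process_def)
  \<comment> \<open>Paths are functions on the whole real line; at negative times, where B need not be measurable, the limit process is set to 0.\<close>
  define lim_proc where "lim_proc = (\<lambda>N t p. if 0 \<le> t then sqrt (\<sigma>2 * variance_avg N (fst p)) * B t (snd p) else 0)"
  have lim_meas: "lim_proc N t \<in> borel_measurable (M \<Otimes>\<^sub>M P)" for N t
  proof (cases "0 \<le> t")
    case True
    then have eq: "lim_proc N t = (\<lambda>p. sqrt (\<sigma>2 * variance_avg N (fst p)) * B t (snd p))"
      by (simp add: lim_proc_def)
    show ?thesis
      unfolding eq by (intro borel_measurable_times measurable_compose[OF measurable_snd B_meas[OF True]]) measurable
  qed (simp add: lim_proc_def)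
  define R where "R = (\<lambda>N. distr (M \<Otimes>\<^sub>M P) (PiM UNIV (\<lambda>_. borel)) (\<lambda>p t. lim_proc N t p))"
  define W where "W = (\<lambda>(N::nat) (t::real) x. x t :: real)"
  have path_meas: "(\<lambda>p t. lim_proc N t p) \<in> M \<Otimes>\<^sub>M P \<rightarrow>\<^sub>M PiM UNIV (\<lambda>_. borel)" for N
    by (rule measurable_PiM_single') (use lim_meas in auto)
  have fdd_R: "(\<integral>x. f x \<partial>fdd (R N) (W N) J) = (\<integral>p. f (\<lambda>t\<in>J. sqrt (\<sigma>2 * variance_avg N (fst p)) * B t (snd p)) \<partial>(M \<Otimes>\<^sub>M P))"
    if J: "finite J" "J \<subseteq> {0..}" and f: "continuous_on (PiE J (\<lambda>_. UNIV)) f" for N J and f :: "(real \<Rightarrow> real) \<Rightarrow> real"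
  proof -
    have r: "(\<lambda>x. \<lambda>t\<in>J. W N t x) \<in> PiM UNIV (\<lambda>_. borel) \<rightarrow>\<^sub>M PiM J (\<lambda>_. borel)"
      unfolding W_def by (intro measurable_restrict) simp
    have "fdd (R N) (W N) J = distr (M \<Otimes>\<^sub>M P) (PiM J (\<lambda>_. borel)) (\<lambda>p. \<lambda>t\<in>J. lim_proc N t p)"
      unfolding fdd_def R_def by (subst distr_distr[OF r path_meas]) (simp add: comp_def W_def)
    moreover have "(\<lambda>p. \<lambda>t\<in>J. lim_proc N t p) \<in> M \<Otimes>\<^sub>M P \<rightarrow>\<^sub>M PiM J (\<lambda>_. borel)"
      by (intro measurable_restrict lim_meas)
    ultimately have "(\<integral>x. f x \<partial>fdd (R N) (W N) J) = (\<integral>p. f (\<lambda>t\<in>J. lim_proc N t p) \<partial>(M \<Otimes>\<^sub>M P))"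
      by (simp add: integral_distr borel_measurable_PiM_continuous_on[OF J(1) f])
    also have "(\<lambda>p. \<lambda>t\<in>J. lim_proc N t p) = (\<lambda>p. \<lambda>t\<in>J. sqrt (\<sigma>2 * variance_avg N (fst p)) * B t (snd p))"
      using J(2) by (auto simp: lim_proc_def fun_eq_iff)
    then have "(\<integral>p. f (\<lambda>t\<in>J. lim_proc N t p) \<partial>(M \<Otimes>\<^sub>M P)) = (\<integral>p. f (\<lambda>t\<in>J. sqrt (\<sigma>2 * variance_avg N (fst p)) * B t (snd p)) \<partial>(M \<Otimes>\<^sub>M P))"
      by metis
    finally show ?thesis .
  qed
  have inner: "stochastic_process (R N) (W N) \<and> fdd_converges (\<lambda>_. M)
      (\<lambda>n t \<omega>. 1 / sqrt (real n * real N * ln (real N)) * aggregated_sum Xs N n t \<omega>) (R N) (W N)"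
    if N: "2 \<le> N" for N
  proof
    show "stochastic_process (R N) (W N)"
      unfolding stochastic_process_def R_def W_def
      using MP.P.prob_space_distr[OF path_meas] by auto
    define \<kappa> where "\<kappa> = 1 / sqrt (real N * ln (real N))"
    have scale: "1 / sqrt (real n * real N * ln (real N)) = \<kappa> / sqrt (real n)" for n
      by (simp add: \<kappa>_def real_sqrt_mult mult_ac)
    show "fdd_converges (\<lambda>_. M)
      (\<lambda>n t \<omega>. 1 / sqrt (real n * real N * ln (real N)) * aggregated_sum Xs N n t \<omega>) (R N) (W N)"
      unfolding fdd_converges_def
    proof (intro allI impI, elim conjE)
      fix J and f :: "(real \<Rightarrow> real) \<Rightarrow> real"
      assume J: "finite J" "J \<subseteq> {0..}" and f: "continuous_on (PiE J (\<lambda>_. UNIV)) f"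
        and bdd: "bounded (f ` PiE J (\<lambda>_. UNIV))"
      have S_meas: "aggregated_sum Xs N n t \<in> borel_measurable M" for n t
        unfolding aggregated_sum_def[abs_def] by (intro borel_measurable_sum Xs_meas) auto
      have "(\<integral>x. f x \<partial>fdd M (\<lambda>t \<omega>. 1 / sqrt (real n * real N * ln (real N)) * aggregated_sum Xs N n t \<omega>) J)
          = (\<integral>\<omega>. f (\<lambda>t\<in>J. \<kappa> / sqrt (real n) * aggregated_sum Xs N n t \<omega>) \<partial>M)" for n
      proof -
        have "(\<lambda>\<omega>. \<lambda>t\<in>J. 1 / sqrt (real n * real N * ln (real N)) * aggregated_sum Xs N n t \<omega>) \<in> M \<rightarrow>\<^sub>M PiM J (\<lambda>_. borel)"
          by (intro measurable_restrict borel_measurable_times borel_measurable_const S_meas)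
        then have "(\<integral>x. f x \<partial>fdd M (\<lambda>t \<omega>. 1 / sqrt (real n * real N * ln (real N)) * aggregated_sum Xs N n t \<omega>) J)
          = (\<integral>\<omega>. f (\<lambda>t\<in>J. 1 / sqrt (real n * real N * ln (real N)) * aggregated_sum Xs N n t \<omega>) \<partial>M)"
          unfolding fdd_def by (rule integral_distr[OF _ borel_measurable_PiM_continuous_on[OF J(1) f]])
        then show ?thesis by (simp only: scale)
      qed
      moreover have "(\<lambda>n. \<integral>\<omega>. f (\<lambda>t\<in>J. \<kappa> / sqrt (real n) * aggregated_sum Xs N n t \<omega>) \<partial>M)
          \<longlonglongrightarrow> (\<integral>p. f (\<lambda>t\<in>J. sqrt (\<sigma>2 * variance_avg N (fst p)) * B t (snd p)) \<partial>(M \<Otimes>\<^sub>M P))"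
        using inner_limit[OF _ B J f bdd, of N \<kappa>] N unfolding \<kappa>_def variance_avg_eq by simp
      ultimately show "(\<lambda>n. \<integral>x. f x \<partial>fdd M (\<lambda>t \<omega>. 1 / sqrt (real n * real N * ln (real N)) * aggregated_sum Xs N n t \<omega>) J)
          \<longlonglongrightarrow> (\<integral>x. f x \<partial>fdd (R N) (W N) J)"
        by (simp only: fdd_R[OF J f])
    qed
  qed
  have outer: "fdd_converges R W P (\<lambda>t \<omega>. sqrt (\<sigma>2 * \<psi>1 / 2) * B t \<omega>)"
    unfolding fdd_converges_def
  proof (intro allI impI, elim conjE)
    fix J and f :: "(real \<Rightarrow> real) \<Rightarrow> real"
    assume J: "finite J" "J \<subseteq> {0..}" and f: "continuous_on (PiE J (\<lambda>_. UNIV)) f"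
      and bdd: "bounded (f ` PiE J (\<lambda>_. UNIV))"
    obtain C where C: "\<And>x. x \<in> PiE J (\<lambda>_. UNIV) \<Longrightarrow> \<bar>f x\<bar> \<le> C"
      using bdd by (auto simp: bounded_iff)
    note f_meas = borel_measurable_PiM_continuous_on[OF J(1) f]
    define G where "G = (\<lambda>x. \<integral>\<omega>. f (\<lambda>t\<in>J. sqrt (\<sigma>2 * x) * B t \<omega>) \<partial>P)"
    have vec: "(\<lambda>p. \<lambda>t\<in>J. sqrt (\<sigma>2 * variance_avg N (fst p)) * B t (snd p)) \<in> M \<Otimes>\<^sub>M P \<rightarrow>\<^sub>M PiM J (\<lambda>_. borel)" for N
    proof (intro measurable_restrict borel_measurable_times)
      fix t assume "t \<in> J"
      then show "(\<lambda>p. B t (snd p)) \<in> borel_measurable (M \<Otimes>\<^sub>M P)"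
        using J(2) by (intro measurable_compose[OF measurable_snd B_meas]) auto
    qed measurable
    have vecP: "(\<lambda>\<omega>. \<lambda>t\<in>J. c * B t \<omega>) \<in> P \<rightarrow>\<^sub>M PiM J (\<lambda>_. borel)" for c
      using J(2) by (intro measurable_restrict borel_measurable_times borel_measurable_const B_meas) auto
    have G_bound: "\<bar>G x\<bar> \<le> C" for x
    proof -
      have i: "integrable P (\<lambda>\<omega>. f (\<lambda>t\<in>J. sqrt (\<sigma>2 * x) * B t \<omega>))"
        using C by (intro P.integrable_const_bound[where B=C] measurable_compose[OF vecP f_meas]) auto
      have "\<bar>G x\<bar> \<le> (\<integral>\<omega>. \<bar>f (\<lambda>t\<in>J. sqrt (\<sigma>2 * x) * B t \<omega>)\<bar> \<partial>P)"
        unfolding G_def by (rule integral_abs_bound)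
      also have "\<dots> \<le> C" using i C by (intro P.integral_le_const) auto
      finally show ?thesis .
    qed
    have "(\<integral>p. f (\<lambda>t\<in>J. sqrt (\<sigma>2 * variance_avg N (fst p)) * B t (snd p)) \<partial>(M \<Otimes>\<^sub>M P))
        = expectation (\<lambda>\<omega>. G (variance_avg N \<omega>))" for N
    proof -
      have "integrable (M \<Otimes>\<^sub>M P) (\<lambda>p. f (\<lambda>t\<in>J. sqrt (\<sigma>2 * variance_avg N (fst p)) * B t (snd p)))"
        using C by (intro MP.P.integrable_const_bound[where B=C] measurable_compose[OF vec f_meas]) auto
      from MP.integral_fst'[OF this] show ?thesis by (simp add: G_def)
    qed
    moreover have "(\<lambda>N. expectation (\<lambda>\<omega>. G (variance_avg N \<omega>))) \<longlonglongrightarrow> G (\<psi>1 / 2)"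
    proof (rule expectation_tendsto_in_prob[OF variance_avg_meas _ _ G_bound])
      show "continuous_on UNIV G"
        unfolding G_def by (rule wiener_mixing_functional_continuous[OF B J f C])
      fix \<delta> :: real assume "0 < \<delta>"
      then show "(\<lambda>N. prob {\<omega> \<in> space M. \<delta> < \<bar>variance_avg N \<omega> - \<psi>1 / 2\<bar>}) \<longlonglongrightarrow> 0"
        using assms(3) unfolding \<open>\<beta> = 1\<close> by (intro variance_avg_tendsto[OF _ assms(4-7)])
    qed
    moreover have "G (\<psi>1 / 2) = (\<integral>x. f x \<partial>fdd P (\<lambda>t \<omega>. sqrt (\<sigma>2 * \<psi>1 / 2) * B t \<omega>) J)"
      unfolding G_def fdd_def by (simp add: integral_distr[OF vecP f_meas])
    ultimately show "(\<lambda>N. \<integral>x. f x \<partial>fdd (R N) (W N) J)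
        \<longlonglongrightarrow> (\<integral>x. f x \<partial>fdd P (\<lambda>t \<omega>. sqrt (\<sigma>2 * \<psi>1 / 2) * B t \<omega>) J)"
      by (simp only: fdd_R[OF J f])
  qed
  show ?thesis
    unfolding iterated_fdd_converges_def using inner outer by blast
qed

end
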